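(* Let $\Gamma$ be a connected (finite) graph with $|\Gamma|$ vertices, and fix a vertex $v$ of $\Gamma$. For $n\ge|\Gamma|$ let $\Gamma_n$ denote the graph with $n$ vertices obtained by adding a $2$-valent tree of length $n-|\Gamma|$ to $\Gamma$ at $v$, and let $M_n$ be the adjacency matrix of $\Gamma_n$. For any $\Gamma$ (and $v$) there exists an effective (i.e. effectively computable) constant $N$ such that for all $n\ge N$, either: (1) all the eigenvalues of $M_n$ are of the form $\zeta+\zeta^{-1}$ for some root of unity $\zeta$, and the graphs $\Gamma_n$ are the Dynkin diagrams $A_n$ or $D_n$; or (2) the largest eigenvalue $\lambda$ of $M_n$ is greater than $2$, and the field $\mathbb{Q}(\lambda^2)$ is not abelian (over $\mathbb{Q}$).
   Context: Adding a $2$-valent tree of length $m$ to $\Gamma$ at $v$ means adjoining a path with $m$ new vertices $w_1,\dots,w_m$ (consecutive ones joined by an edge) and an edge joining $v$ to $w_1$. A number field is called abelian if it is Galois over $\mathbb{Q}$ with abelian Galois group. *)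

theory Defs
  imports
    "HOL-Library.Nat_Bijection"
    "HOL-Algebra.Bij"
    "HOL-Algebra.Embedded_Algebras"
    "HOL-Algebra.Generated_Fields"
    "Jordan_Normal_Form.Spectral_Radius"
    "Jordan_Normal_Form.VS_Connect"
    "Graph_Theory.Graph_Theory"
begin

section \<open>Graphs\<close>

text \<open>
  Finite simple graphs are symmetric, loop-free, finite pair digraphs (locale
  \<^locale>\<open>pair_graph\<close>): an undirected edge is a pair of opposite arcs.
  Vertices are natural numbers, so that a graph is a finite input for a computable function.
\<close>

definition undirected_graph :: "nat set \<Rightarrow> (nat \<times> nat) set \<Rightarrow> nat pair_pre_digraph" where
  "undirected_graph V E = \<lparr>pverts = V, parcs = E \<union> E\<inverse>\<rparr>"

text \<open>
  For a graph on \<open>{..<k}\<close> the new vertices are \<open>w\<^sub>i = k + i - 1\<close> for \<open>1 \<le> i \<le> m\<close>.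
\<close>

definition add_path :: "nat pair_pre_digraph \<Rightarrow> nat \<Rightarrow> nat \<Rightarrow> nat pair_pre_digraph" where
  "add_path G v m =
     (let k = card (pverts G) in
      undirected_graph
        (pverts G \<union> {k..<k + m})
        (parcs G \<union> (if m = 0 then {} else {(v, k)}) \<union> {(k + i, k + Suc i) |i. Suc i < m}))"

definition dynkin_A :: "nat \<Rightarrow> nat pair_pre_digraph" where
  "dynkin_A n = undirected_graph {..<n} {(i, Suc i) |i. Suc i < n}"

text \<open>
  A path on \<open>{..<n - 1}\<close> with the extra vertex \<open>n - 1\<close> joined to its penultimate vertex;
  only meaningful for \<open>n \<ge> 4\<close>.
\<close>

definition dynkin_D :: "nat \<Rightarrow> nat pair_pre_digraph" where
  "dynkin_D n =
     undirected_graph {..<n} (insert (n - 3, n - 1) {(i, Suc i) |i. Suc i < n - 1})"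

text \<open>For graphs on an initial segment of the natural numbers.\<close>

definition adjacency_matrix :: "nat pair_pre_digraph \<Rightarrow> 'a :: {zero, one} mat" where
  "adjacency_matrix G =
     (let n = card (pverts G) in mat n n (\<lambda>(i, j). if (i, j) \<in> parcs G then 1 else 0))"


section \<open>Abelian number fields\<close>

definition root_of_unity :: "complex \<Rightarrow> bool" where
  "root_of_unity z \<longleftrightarrow> (\<exists>k>0. z ^ k = 1)"

text \<open>Number fields are represented as subfields of the complex numbers.\<close>

abbreviation complex_ring :: "complex ring" where
  "complex_ring \<equiv> class_ring"

definition rat_adjoin :: "complex \<Rightarrow> complex set" where
  "rat_adjoin a = generate_field complex_ring {a}"

definition number_field :: "complex set \<Rightarrow> bool" where
  "number_field K \<longleftrightarrow> subfield K complex_ring \<and> ring.finite_dimension complex_ring \<rat> K"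

definition galois_group :: "complex set \<Rightarrow> (complex \<Rightarrow> complex) monoid" where
  "galois_group K =
     BijGroup K
       \<lparr>carrier := {\<sigma> \<in> Bij K.
          \<sigma> \<in> Ring.ring_hom (complex_ring\<lparr>carrier := K\<rparr>) (complex_ring\<lparr>carrier := K\<rparr>) \<and>
          (\<forall>q\<in>\<rat>. \<sigma> q = q)}\<rparr>"

text \<open>A finite extension is Galois if the fixed field of its automorphism group is the base field.\<close>

definition galois_over_rat :: "complex set \<Rightarrow> bool" where
  "galois_over_rat K \<longleftrightarrow>
     number_field K \<and> {x \<in> K. \<forall>\<sigma>\<in>carrier (galois_group K). \<sigma> x = x} = \<rat>"

definition abelian_number_field :: "complex set \<Rightarrow> bool" where
  "abelian_number_field K \<longleftrightarrow> galois_over_rat K \<and> comm_group (galois_group K)"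


section \<open>Computable functions\<close>

text \<open>
  Total recursive functions of arity \<open>k\<close>, as functions on argument lists; the values on lists of
  any other length are irrelevant. Minimisation is only applied to functions that have a zero for
  all values of the parameters, which yields exactly the total computable functions of arity \<open>k\<close>.
\<close>

inductive recursive :: "nat \<Rightarrow> (nat list \<Rightarrow> nat) \<Rightarrow> bool" where
  zero: "recursive k (\<lambda>xs. 0)"
| succ: "recursive 1 (\<lambda>xs. Suc (xs ! 0))"
| proj: "i < k \<Longrightarrow> recursive k (\<lambda>xs. xs ! i)"
| comp: "recursive (length gs) f \<Longrightarrow> (\<forall>g\<in>set gs. recursive k g) \<Longrightarrow>
    recursive k (\<lambda>xs. f (map (\<lambda>g. g xs) gs))"
| prim_rec: "recursive k f \<Longrightarrow> recursive (Suc (Suc k)) g \<Longrightarrow>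
    recursive (Suc k) (\<lambda>xs. rec_nat (f (tl xs)) (\<lambda>y r. g (y # r # tl xs)) (hd xs))"
| minim: "recursive (Suc k) f \<Longrightarrow> (\<forall>xs. length xs = k \<longrightarrow> (\<exists>y. f (y # xs) = 0)) \<Longrightarrow>
    recursive k (\<lambda>xs. LEAST y. f (y # xs) = 0)"

text \<open>
  A graph on \<open>{..<k}\<close> with a marked vertex, as the input of a function of arity 3: the number of
  vertices, a code for the finite set of arcs, and the marked vertex.
\<close>

definition graph_code :: "nat pair_pre_digraph \<Rightarrow> nat \<Rightarrow> nat list" where
  "graph_code G v = [card (pverts G), set_encode (prod_encode ` parcs G), v]"

end

theory Submission
  imports
    Defs
    "HOL-Number_Theory.Prime_Powers"
    "HOL-Number_Theory.Residues"
    "HOL-Real_Asymp.Real_Asymp"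
    "HOL-Analysis.Function_Topology"
    "HOL-Analysis.Convex"
begin

text \<open>
  Let \<open>k = |\<Gamma>|\<close>, \<open>m = n - k\<close>, let \<open>\<lambda>\<close> be the largest eigenvalue of \<open>M\<^sub>n\<close> and \<open>\<beta> = \<lambda>\<^sup>2\<close>.
  If \<open>\<lambda> \<le> 2\<close> and the tail is long, Rayleigh quotients of test vectors supported on a path from the
  end of the tail to the first branch vertex leave only \<open>A\<^sub>n\<close> and \<open>D\<^sub>n\<close>.

  Let \<open>\<lambda> > 2\<close> and let \<open>\<rat>(\<beta>)\<close> be abelian with group \<open>G\<close> of order \<open>d\<close>. The conjugates of \<open>\<beta>\<close> lie
  in \<open>[0, \<beta>]\<close>, and at most \<open>k\<close> of them exceed \<open>4\<close>, because \<open>M\<^sub>n\<close> has norm at most \<open>2\<close> on the tail.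
  Let \<open>D\<^sub>p\<close> be the Dickson polynomial, \<open>D\<^sub>p(t + 1/t) = t\<^sup>p + 1/t\<^sup>p\<close>, and \<open>x = \<beta> - 2\<close>. For a prime
  \<open>p\<close> with \<open>d < p \<le> 8 d\<close>, which exists for large \<open>d\<close>, some nonzero \<open>D\<^sub>p(x) - \<phi> x\<close> (Frobenius, if \<open>p\<close> is
  unramified) or \<open>D\<^sub>p(x) - D\<^sub>p(\<sigma> x)\<close> (\<open>\<sigma>\<close> in the inertia group) has norm divisible by \<open>p\<^sup>d\<close>. As
  \<open>|D\<^sub>p| \<le> 2\<close> on \<open>[-2, 2]\<close>, the norm is at most \<open>4\<^sup>d (k + 1)\<^bsup>4 k p\<^esup>\<close>, and this bounds \<open>d\<close> in terms of \<open>k\<close>.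

  Solving the eigenvector recursion along the tail gives a polynomial \<open>R\<close> over the integers, depending
  only on \<open>\<Gamma>\<close> and \<open>v\<close>, with \<open>0 < R(\<lambda>) \<le> H / (m + 1)\<^sup>2\<close>. Hence \<open>R(\<lambda>) R(-\<lambda>)\<close>, or the even part of \<open>R\<close>
  at \<open>\<lambda>\<close> if that product vanishes, is a nonzero algebraic integer of \<open>\<rat>(\<beta>)\<close> with one conjugate of size
  \<open>O(m\<^bsup>-2\<^esup>)\<close> and the others bounded; since its norm is at least \<open>1\<close> and \<open>d\<close> is bounded, so is \<open>m\<close>.
\<close>

section \<open>Sums and products of algebraic integers\<close>

text \<open>Modulo p one could use x^p instead of D_p(x), but conjugates in [-2, 2] might then
  contribute factors of size 2^p; D_p agrees with x^p modulo p and stays in [-2, 2] there, so only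
  the at most k large conjugates cost a factor that grows with p. Commutativity of G turns a
  congruence modulo one prime above p into a congruence for all conjugates; this yields the full
  power p^d in the norm. The range of p is chosen from both sides: p >= d makes z^p divisible by p
  when all conjugates of z lie in that prime, and p = O(d) keeps C^(2kp) below the d-th power of a
  constant, which d^d outgrows. Along the tail the eigenvector obeys g(j+1) = lambda g(j) - g(j-1),
  which preserves X^2 - lambda X Y + Y^2. R is this form at the characteristic polynomials of Gamma
  and of Gamma without v; it is small since the eigenvector grows at least linearly towards v while
  the form keeps its value from the end of the tail. Gamma need not be bipartite, so R need not be
  even and R(lambda) need not lie in the field of lambda^2; hence the product with R(-lambda), or
  the even part.\<close>

lemma algebraic_int_if_stabilises_nat:
  fixes v :: "nat \<Rightarrow> complex" and a :: "nat \<Rightarrow> nat \<Rightarrow> int"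
  assumes i0: "i0 < n" "v i0 \<noteq> 0"
    and eq: "\<And>i. i < n \<Longrightarrow> z * v i = (\<Sum>j<n. of_int (a i j) * v j)"
  shows "algebraic_int z"
proof -
  define A where "A = mat n n (\<lambda>(i, j). a i j)"
  have A: "A \<in> carrier_mat n n" by (simp add: A_def)
  let ?B = "map_mat of_int A :: complex mat"
  have B: "?B \<in> carrier_mat n n" using A by simp
  have "eigenvector ?B (vec n v) z"
  proof -
    have "vec n v \<noteq> 0\<^sub>v n"
      using i0 by (metis index_vec index_zero_vec(1))
    moreover have "?B *\<^sub>v vec n v = z \<cdot>\<^sub>v vec n v"
    proof (rule eq_vecI)
      fix i assume "i < dim_vec (z \<cdot>\<^sub>v vec n v)"
      then have i: "i < n" by simp
      have "(?B *\<^sub>v vec n v) $ i = (\<Sum>j = 0..<n. of_int (a i j) * v j)"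
        using i by (simp add: A_def scalar_prod_def)
      then show "(?B *\<^sub>v vec n v) $ i = (z \<cdot>\<^sub>v vec n v) $ i"
        using eq[OF i] i by (simp add: atLeast0LessThan)
    qed (simp add: A_def)
    ultimately show ?thesis using A by (simp add: eigenvector_def)
  qed
  then have "eigenvalue ?B z" by (auto simp: eigenvalue_def)
  then have "poly (char_poly ?B) z = 0" using eigenvalue_root_char_poly[OF B] by simp
  then have "poly (of_int_poly (char_poly A)) z = 0"
    using of_int_hom.char_poly_hom[OF A, where ?'a = complex] by simp
  moreover have "lead_coeff (char_poly A) = 1"
    using degree_monic_char_poly[OF A] by simp
  ultimately show ?thesis by (auto simp: algebraic_int_altdef_ipoly)
qed

text \<open>The multiplier ring of the additive group generated by the \<open>v i\<close>. Its
  closure under sums and products is immediate, whereas monic equations for sums and products are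
  not.\<close>

definition stabiliser :: "'i set \<Rightarrow> ('i \<Rightarrow> complex) \<Rightarrow> complex set" where
  "stabiliser I v = {z. \<forall>i\<in>I. \<exists>a :: 'i \<Rightarrow> int. z * v i = (\<Sum>j\<in>I. of_int (a j) * v j)}"

text \<open>The coefficients form an integer matrix with the nonzero eigenvector \<open>v\<close>
  for \<open>z\<close>, so \<open>z\<close> is a root of a monic characteristic polynomial.\<close>

lemma stabiliser_algebraic_int:
  assumes "finite I" "i0 \<in> I" "v i0 \<noteq> 0" "z \<in> stabiliser I v"
  shows "algebraic_int z"
proof -
  obtain b where b: "bij_betw b {..<card I} I"
    using ex_bij_betw_nat_finite[OF assms(1)] by (auto simp: atLeast0LessThan)
  obtain a :: "'a \<Rightarrow> 'a \<Rightarrow> int"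
    where a: "\<And>i. i \<in> I \<Longrightarrow> z * v i = (\<Sum>j\<in>I. of_int (a i j) * v j)"
    using assms(4) unfolding stabiliser_def by (simp add: bchoice_iff) metis
  obtain k where k: "k < card I" "b k = i0"
    using b assms(2) by (force simp: bij_betw_def)
  show ?thesis
  proof (rule algebraic_int_if_stabilises_nat[of k "card I" "v \<circ> b" z "\<lambda>i j. a (b i) (b j)"])
    fix i assume "i < card I"
    then have "b i \<in> I" using b by (auto simp: bij_betw_def)
    from a[OF this] show "z * (v \<circ> b) i = (\<Sum>j<card I. of_int (a (b i) (b j)) * (v \<circ> b) j)"
      using sum.reindex_bij_betw[OF b, of "\<lambda>j. of_int (a (b i) j) * v j"] by simp
  qed (use k assms in auto)
qed

lemma stabiliser_add:
  assumes "x \<in> stabiliser I v" "y \<in> stabiliser I v"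
  shows "x + y \<in> stabiliser I v"
  unfolding stabiliser_def
proof (intro CollectI ballI)
  fix i assume i: "i \<in> I"
  obtain a b :: "'a \<Rightarrow> int" where "x * v i = (\<Sum>j\<in>I. of_int (a j) * v j)"
    "y * v i = (\<Sum>j\<in>I. of_int (b j) * v j)"
    using assms i unfolding stabiliser_def by blast
  then have "(x + y) * v i = (\<Sum>j\<in>I. of_int (a j + b j) * v j)"
    by (simp add: algebra_simps sum.distrib)
  then show "\<exists>a. (x + y) * v i = (\<Sum>j\<in>I. of_int (a j) * v j)" by metis
qed

lemma stabiliser_mult:
  assumes "x \<in> stabiliser I v" "y \<in> stabiliser I v"
  shows "x * y \<in> stabiliser I v"
  unfolding stabiliser_def
proof (intro CollectI ballI)
  fix i assume i: "i \<in> I"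
  obtain a :: "'a \<Rightarrow> 'a \<Rightarrow> int"
    where a: "\<And>i. i \<in> I \<Longrightarrow> x * v i = (\<Sum>j\<in>I. of_int (a i j) * v j)"
    using assms(1) unfolding stabiliser_def by (simp add: bchoice_iff) metis
  obtain b :: "'a \<Rightarrow> int" where b: "y * v i = (\<Sum>j\<in>I. of_int (b j) * v j)"
    using assms i unfolding stabiliser_def by blast
  have "(x * y) * v i = (\<Sum>j\<in>I. of_int (b j) * (x * v j))"
    using b by (simp add: algebra_simps sum_distrib_left)
  also have "\<dots> = (\<Sum>j\<in>I. of_int (b j) * (\<Sum>l\<in>I. of_int (a j l) * v l))"
    by (intro sum.cong) (simp_all add: a)
  also have "\<dots> = (\<Sum>l\<in>I. \<Sum>j\<in>I. of_int (b j) * (of_int (a j l) * v l))"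
    unfolding sum_distrib_left by (rule sum.swap)
  also have "\<dots> = (\<Sum>l\<in>I. of_int (\<Sum>j\<in>I. b j * a j l) * v l)"
    by (intro sum.cong) (simp_all add: sum_distrib_right mult.assoc)
  finally show "\<exists>a. (x * y) * v i = (\<Sum>j\<in>I. of_int (a j) * v j)" by metis
qed

lemma algebraic_int_stabilises_powers:
  assumes "algebraic_int (x :: complex)"
  obtains m c where "m > 0"
    "\<And>i. i < m \<Longrightarrow> x * x ^ i = (\<Sum>l<m. of_int (c i l :: int) * x ^ l)"
proof -
  obtain p :: "int poly" where p: "poly (of_int_poly p) x = 0" "lead_coeff p = 1"
    using assms by (auto simp: algebraic_int_altdef_ipoly)
  define m where "m = degree p"
  have m: "m > 0"
  proof (rule ccontr)
    assume "\<not> m > 0"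
    then obtain a where "p = [:a:]" by (metis degree_0_id gr0I m_def degree_eq_zeroE)
    with p show False by simp
  qed
  have "0 = (\<Sum>i\<le>m. of_int (coeff p i) * x ^ i)"
    using p(1) by (simp add: poly_altdef m_def)
  also have "\<dots> = (\<Sum>i<m. of_int (coeff p i) * x ^ i) + x ^ m"
    using p(2) by (simp add: m_def lessThan_Suc_atMost[symmetric])
  finally have xm: "x ^ m = (\<Sum>i<m. of_int (- coeff p i) * x ^ i)"
    by (simp add: sum_negf eq_neg_iff_add_eq_0 add.commute)
  \<comment> \<open>Companion matrix: multiplication by \<open>x\<close> shifts the powers, and only
    the top one is reduced by the monic equation.\<close>
  define c where "c i l = (if Suc i = m then - coeff p l else if l = Suc i then 1 else 0)" for i l
  show thesis
  proof (rule that[OF m, of c])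
    fix i assume i: "i < m"
    show "x * x ^ i = (\<Sum>l<m. of_int (c i l) * x ^ l)"
    proof (cases "Suc i = m")
      case True
      then show ?thesis using xm by (simp add: c_def flip: power_Suc)
    next
      case False
      then have "Suc i < m" using i by simp
      have "(\<Sum>l<m. of_int (c i l) * x ^ l) = (\<Sum>l<m. if l = Suc i then x ^ l else 0)"
        using False by (intro sum.cong) (auto simp: c_def)
      also have "\<dots> = x ^ Suc i" using \<open>Suc i < m\<close> by simp
      finally show ?thesis by simp
    qed
  qed
qed

text \<open>The monomials \<open>x ^ i * y ^ j\<close> below the two degrees span a group that both
  numbers preserve; the monomial at \<open>(0, 0)\<close> is 1, hence nonzero.\<close>

lemma algebraic_ints_common_stabiliser:
  fixes x y :: complex
  assumes "algebraic_int x" "algebraic_int y"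
  obtains I :: "(nat \<times> nat) set" and v i0 where "finite I" "i0 \<in> I" "v i0 \<noteq> 0"
    "x \<in> stabiliser I v" "y \<in> stabiliser I v"
proof -
  obtain m c where c: "m > 0" "\<And>i. i < m \<Longrightarrow> x * x ^ i = (\<Sum>l<m. of_int (c i l :: int) * x ^ l)"
    using algebraic_int_stabilises_powers[OF assms(1)] by blast
  obtain n e where e: "n > 0" "\<And>i. i < n \<Longrightarrow> y * y ^ i = (\<Sum>l<n. of_int (e i l :: int) * y ^ l)"
    using algebraic_int_stabilises_powers[OF assms(2)] by blast
  let ?I = "{..<m} \<times> {..<n}" and ?v = "\<lambda>(i, j). x ^ i * y ^ j"
  have x: "x * ?v (i, j) = (\<Sum>p\<in>?I. of_int (if snd p = j then c i (fst p) else 0) * ?v p)"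
    if "i < m" "j < n" for i j
  proof -
    have "(\<Sum>p\<in>?I. of_int (if snd p = j then c i (fst p) else 0) * ?v p) =
       (\<Sum>l<m. \<Sum>k<n. if k = j then of_int (c i l) * (x ^ l * y ^ k) else 0)"
      unfolding sum.cartesian_product by (intro sum.cong) (auto split: prod.splits)
    also have "\<dots> = (\<Sum>l<m. of_int (c i l) * (x ^ l * y ^ j))"
      using that by simp
    also have "\<dots> = (x * x ^ i) * y ^ j"
      unfolding c(2)[OF that(1)] by (simp add: sum_distrib_right mult.assoc)
    finally show ?thesis by simp
  qed
  have x: "x \<in> stabiliser ?I ?v"
    unfolding stabiliser_def mem_Collect_eq Ball_def split_paired_All
    by (intro allI impI exI) (rule x, simp_all)
  have y: "y * ?v (i, j) = (\<Sum>p\<in>?I. of_int (if fst p = i then e j (snd p) else 0) * ?v p)"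
    if "i < m" "j < n" for i j
  proof -
    have "(\<Sum>p\<in>?I. of_int (if fst p = i then e j (snd p) else 0) * ?v p) =
       (\<Sum>l<m. \<Sum>k<n. if l = i then of_int (e j k) * (x ^ l * y ^ k) else 0)"
      unfolding sum.cartesian_product by (intro sum.cong) (auto split: prod.splits)
    also have "\<dots> = (\<Sum>k<n. \<Sum>l<m. if l = i then of_int (e j k) * (x ^ l * y ^ k) else 0)"
      by (rule sum.swap)
    also have "\<dots> = (\<Sum>k<n. of_int (e j k) * (x ^ i * y ^ k))"
      using that by simp
    also have "\<dots> = x ^ i * (y * y ^ j)"
      unfolding e(2)[OF that(2)] by (simp add: sum_distrib_left mult_ac)
    finally show ?thesis by (simp add: mult_ac)
  qed
  have "y \<in> stabiliser ?I ?v"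
    unfolding stabiliser_def mem_Collect_eq Ball_def split_paired_All
    by (intro allI impI exI) (rule y, simp_all)
  with x show thesis using c(1) e(1) by (intro that[of ?I "(0, 0)" ?v]) auto
qed

lemma algebraic_int_add:
  assumes "algebraic_int (x :: complex)" "algebraic_int y"
  shows "algebraic_int (x + y)"
proof -
  obtain I :: "(nat \<times> nat) set" and v i0 where "finite I" "i0 \<in> I" "v i0 \<noteq> 0"
    "x \<in> stabiliser I v" "y \<in> stabiliser I v"
    by (rule algebraic_ints_common_stabiliser[OF assms])
  then show ?thesis using stabiliser_algebraic_int stabiliser_add by metis
qed

lemma algebraic_int_mult:
  assumes "algebraic_int (x :: complex)" "algebraic_int y"
  shows "algebraic_int (x * y)"
proof -
  obtain I :: "(nat \<times> nat) set" and v i0 where "finite I" "i0 \<in> I" "v i0 \<noteq> 0"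
    "x \<in> stabiliser I v" "y \<in> stabiliser I v"
    by (rule algebraic_ints_common_stabiliser[OF assms])
  then show ?thesis using stabiliser_algebraic_int stabiliser_mult by metis
qed

lemma algebraic_int_diff:
  assumes "algebraic_int (x :: complex)" "algebraic_int y"
  shows "algebraic_int (x - y)"
  using algebraic_int_add[of x "- y"] assms by simp

lemma algebraic_int_of_int: "algebraic_int (of_int n :: complex)"
  by (simp add: int_imp_algebraic_int)

section \<open>Primes between \<open>d\<close> and \<open>8 d\<close>\<close>

lemma prod_primes_dvd:
  fixes N :: nat
  assumes "finite A" "\<And>p. p \<in> A \<Longrightarrow> prime p" "\<And>p. p \<in> A \<Longrightarrow> p dvd N"
  shows "\<Prod>A dvd N"
  using assms
proof (induction A rule: finite_induct)
  case (insert q A)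
  have "coprime q (\<Prod>A)"
    using insert.hyps(2) insert.prems(1) by (intro prod_coprime_right) (metis insertCI primes_coprime)
  then show ?case using insert by (simp add: divides_mult)
qed simp

text \<open>The two middle coefficients of row \<open>2 * m + 1\<close> are equal, and together they
  are at most the row sum \<open>2 * 4 ^ m\<close>.\<close>

lemma odd_central_binomial_le: "(2 * m + 1) choose m \<le> 4 ^ m"
proof -
  have "2 * ((2 * m + 1) choose m) = (\<Sum>k\<in>{m, Suc m}. (2 * m + 1) choose k)"
    using binomial_symmetric[of m "2 * m + 1"] by simp
  also have "\<dots> \<le> (\<Sum>k\<le>2 * m + 1. (2 * m + 1) choose k)"
    by (intro sum_mono2) auto
  also have "\<dots> = 2 * 4 ^ m"
    by (simp only: choose_row_sum) (simp add: power_mult)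
  finally show ?thesis by simp
qed

text \<open>Erdos' induction: an even n > 2 is not prime, and for n = 2m + 1 the primes above m + 1
  all divide the binomial coefficient \<open>(2 * m + 1) choose m\<close>, which is at most 4^m,
  while the smaller primes are covered by the induction hypothesis at m + 1.\<close>

lemma primorial_le: "\<Prod>{p. prime p \<and> p \<le> n} \<le> (4 :: nat) ^ n"
proof (induction n rule: less_induct)
  case (less n)
  consider "n \<le> 1" | "n = 2" | "n > 2" "even n" | m where "n = 2 * m + 1" "m \<ge> 1"
    by (metis Suc_eq_plus1 evenE le_less_linear not_less_eq_eq numeral_2_eq_2 oddE le_Suc_eq One_nat_def
        add.commute mult_is_0 not_less less_Suc0 add_0 mult_0_right)
  then show ?case
  proof cases
    case 1
    then have "{p. prime p \<and> p \<le> n} = {}" by (auto dest: prime_gt_1_nat)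
    then show ?thesis by (simp only: prod.empty) simp
  next
    case 2
    then have "{p. prime p \<and> p \<le> n} = {2}" by (auto dest: prime_ge_2_nat)
    then show ?thesis using 2 by simp
  next
    case 3
    then have "\<not> prime n" using prime_odd_nat by blast
    then have "{p. prime p \<and> p \<le> n} = {p. prime p \<and> p \<le> n - 1}"
      by (metis (lifting) Suc_pred' diff_le_self le_Suc_eq le_trans not_gr0 zero_le)
    then have "\<Prod>{p. prime p \<and> p \<le> n} \<le> 4 ^ (n - 1)" using less[of "n - 1"] 3 by simp
    also have "(4 :: nat) ^ (n - 1) \<le> 4 ^ n" by (intro power_increasing) auto
    finally show ?thesis .
  next
    case (4 m)
    let ?A = "{p. prime p \<and> p \<le> Suc m}" and ?B = "{p. prime p \<and> Suc m < p \<and> p \<le> n}"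
    have "{p. prime p \<and> p \<le> n} = ?A \<union> ?B" using 4 by auto
    then have "\<Prod>{p. prime p \<and> p \<le> n} = \<Prod>?A * \<Prod>?B"
      by (metis (no_types, lifting) prod.union_disjoint finite_nat_set_iff_bounded_le
          disjoint_iff mem_Collect_eq not_less)
    also have "\<Prod>?A \<le> 4 ^ Suc m" using less[of "Suc m"] 4 by simp
    also have "\<Prod>?B \<le> 4 ^ m"
    proof -
      have "\<Prod>?B dvd (2 * m + 1) choose m"
      proof (rule prod_primes_dvd)
        fix p assume p: "p \<in> ?B"
        then have pr: "prime p" by simp
        have "p dvd fact n" using p pr by (simp add: prime_dvd_fact_iff)
        also have "fact n = fact m * fact (Suc m) * ((2 * m + 1) choose m)"
          using binomial_fact_lemma[of m "2 * m + 1"] 4 by simp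
        finally have "p dvd fact m \<or> p dvd fact (Suc m) \<or> p dvd (2 * m + 1) choose m"
          using pr by (meson prime_dvd_multD)
        moreover have "\<not> p dvd fact m" "\<not> p dvd fact (Suc m)"
          using p pr by (auto simp: prime_dvd_fact_iff simp del: fact_Suc)
        ultimately show "p dvd (2 * m + 1) choose m" by blast
      qed auto
      then have "\<Prod>?B \<le> (2 * m + 1) choose m" by (rule dvd_imp_le) simp
      also have "\<dots> \<le> 4 ^ m" by (rule odd_central_binomial_le)
      finally show ?thesis .
    qed
    finally have "\<Prod>{p. prime p \<and> p \<le> n} \<le> 4 ^ Suc m * 4 ^ m" by simp
    also have "\<dots> = (4 :: nat) ^ (Suc m + m)" by (rule power_add[symmetric])
    also have "Suc m + m = n" using 4 by simp
    finally show ?thesis .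
  qed
qed

text \<open>Passing from n to n + 1 raises \<open>n div d\<close> by one exactly for the divisors of
  n + 1, and the von Mangoldt function summed over these is ln (n + 1).\<close>

lemma ln_fact_conv_mangoldt:
  "ln (fact n :: real) = (\<Sum>d\<in>{1..n}. mangoldt d * real (n div d))"
proof (induction n)
  case (Suc n)
  have div: "Suc n div d = n div d + of_bool (d dvd Suc n)" if "d > 0" for d
    using that by (simp add: div_Suc dvd_eq_mod_eq_0)
  have "(\<Sum>d\<in>{1..Suc n}. mangoldt d * real (Suc n div d)) =
      (\<Sum>d\<in>{1..Suc n}. mangoldt d * real (n div d)) + (\<Sum>d\<in>{1..Suc n}. mangoldt d * of_bool (d dvd Suc n))"
    unfolding sum.distrib[symmetric] by (intro sum.cong) (auto simp: div algebra_simps)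
  also have "(\<Sum>d\<in>{1..Suc n}. mangoldt d * real (n div d)) = ln (fact n)"
    using Suc.IH by simp
  also have "(\<Sum>d\<in>{1..Suc n}. mangoldt d * of_bool (d dvd Suc n)) = (\<Sum>d | d dvd Suc n. mangoldt d :: real)"
    by (intro sum.mono_neutral_cong_right) (auto simp: Suc_le_eq dvd_imp_le dvd_pos_nat[of "Suc n"])
  also have "\<dots> = ln (real (Suc n))" by (subst mangoldt_sum) auto
  finally show ?case by (simp add: ln_mult)
qed simp

text \<open>Chebyshev: in the logarithm of (2n)! / (n!)^2 each \<open>mangoldt d\<close> carries the
  coefficient floor(2n/d) - 2 floor(n/d), which is at most 1.\<close>

lemma ln_central_binomial_le:
  "ln (real ((2 * n) choose n)) \<le> (\<Sum>d\<in>{1..2 * n}. mangoldt d)"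
proof -
  have "fact (2 * n) = (fact n * fact n * real ((2 * n) choose n))"
    using arg_cong[OF binomial_fact_lemma[of n "2 * n"], of real] by simp
  then have "ln (fact (2 * n) :: real) = 2 * ln (fact n) + ln (real ((2 * n) choose n))"
    by (simp add: ln_mult)
  moreover have "ln (fact n :: real) = (\<Sum>d\<in>{1..2 * n}. mangoldt d * real (n div d))"
    unfolding ln_fact_conv_mangoldt by (intro sum.mono_neutral_left) auto
  ultimately have "ln (real ((2 * n) choose n)) =
      (\<Sum>d\<in>{1..2 * n}. mangoldt d * real (2 * n div d)) -
      2 * (\<Sum>d\<in>{1..2 * n}. mangoldt d * real (n div d))"
    using ln_fact_conv_mangoldt[of "2 * n"] by linarith
  also have "\<dots> = (\<Sum>d\<in>{1..2 * n}. mangoldt d * (real (2 * n div d) - 2 * real (n div d)))"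
    unfolding sum_distrib_left sum_subtractf[symmetric]
    by (intro sum.cong) (simp_all add: algebra_simps)
  also have "\<dots> \<le> (\<Sum>d\<in>{1..2 * n}. mangoldt d * 1)"
  proof (intro sum_mono mult_left_mono mangoldt_nonneg)
    fix d assume "d \<in> {1..2 * n}"
    then have "d > 0" by simp
    have "n < (n div d + 1) * d" by (metis \<open>d > 0\<close> dividend_less_div_times add.commute mult.commute
          Suc_eq_plus1 mult_Suc)
    then have "2 * n div d < 2 * (n div d) + 2"
      using \<open>d > 0\<close> by (simp add: div_less_iff_less_mult algebra_simps)
    then show "real (2 * n div d) - 2 * real (n div d) \<le> 1" by linarith
  qed
  finally show ?thesis by simp
qed

text \<open>A prime power p^j <= m with j >= 2 has p <= sqrt m and j <= log 2 m; this bounds the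
  number of terms, each of which is at most ln m.\<close>

lemma sum_mangoldt_proper_powers_le:
  assumes "m > 0"
  shows "(\<Sum>q | q \<in> {1..m} \<and> \<not> prime q. mangoldt q) \<le>
    sqrt m * (log 2 m + 1) * ln (real m)"
proof -
  define A where "A = {q \<in> {1..m}. \<not> prime q \<and> primepow q}"
  define s where "s = nat \<lfloor>sqrt m\<rfloor>"
  define L where "L = nat \<lfloor>log 2 m\<rfloor>"
  have fin: "finite A" by (simp add: A_def)
  have "A \<subseteq> (\<lambda>(p, k). p ^ k) ` ({1..s} \<times> {..L})"
  proof
    fix q assume q: "q \<in> A"
    then obtain p k where pk: "prime p" "k > 0" "q = p ^ k"
      by (auto simp: A_def primepow_def)
    have "k \<ge> 2" using q pk by (cases "k = 1") (auto simp: A_def)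
    have p2: "p \<ge> 2" using pk prime_ge_2_nat by blast
    have qm: "p ^ k \<le> m" using q pk by (simp add: A_def)
    have "p ^ 2 \<le> p ^ k" using \<open>k \<ge> 2\<close> p2 by (intro power_increasing) auto
    with qm have "real p ^ 2 \<le> real m" by (metis le_trans of_nat_le_iff of_nat_power)
    then have "real p \<le> sqrt m" by (simp add: real_le_rsqrt)
    then have "p \<le> s" unfolding s_def by (simp add: le_nat_floor)
    have "2 ^ k \<le> p ^ k" using p2 by (intro power_mono) auto
    with qm have "(2::real) ^ k \<le> real m"
      by (metis le_trans numeral_power_le_of_nat_cancel_iff)
    then have "real k \<le> log 2 m" using assms by (simp add: le_log_iff powr_realpow)
    then have "k \<le> L" unfolding L_def by (simp add: le_nat_floor)
    show "q \<in> (\<lambda>(p, k). p ^ k) ` ({1..s} \<times> {..L})"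
      using \<open>p \<le> s\<close> \<open>k \<le> L\<close> p2 pk(3) by (intro image_eqI[of _ _ "(p, k)"]) auto
  qed
  then have "card A \<le> card ({1..s} \<times> {..L})"
    by (meson card_image_le card_mono finite_SigmaI finite_atLeastAtMost finite_atMost
        finite_imageI le_trans)
  then have "real (card A) \<le> real s * (real L + 1)"
    by (metis (no_types) card_atLeastAtMost card_atMost card_cartesian_product diff_Suc_1
        of_nat_Suc of_nat_le_iff of_nat_mult add.commute)
  also have "\<dots> \<le> sqrt m * (log 2 m + 1)"
    using assms by (intro mult_mono) (auto simp: s_def L_def of_nat_nat)
  finally have card: "real (card A) \<le> sqrt m * (log 2 m + 1)" .
  have "(\<Sum>q | q \<in> {1..m} \<and> \<not> prime q. mangoldt q) = (\<Sum>q\<in>A. mangoldt q :: real)"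
    by (intro sum.mono_neutral_right) (auto simp: A_def mangoldt_def)
  also have "\<dots> \<le> (\<Sum>q\<in>A. ln (real m))"
  proof (intro sum_mono)
    fix q assume "q \<in> A"
    then have "q > 0" "q \<le> m" by (auto simp: A_def)
    then show "mangoldt q \<le> ln (real m)" using mangoldt_le[of q]
      by (smt (verit) ln_mono of_nat_0_less_iff of_nat_mono)
  qed
  also have "\<dots> = real (card A) * ln (real m)" by simp
  also have "\<dots> \<le> sqrt m * (log 2 m + 1) * ln (real m)"
    using card assms by (intro mult_right_mono) auto
  finally show ?thesis .
qed

text \<open>Without a prime in (d, 8d], the von Mangoldt sum up to 8d consists of primes up to d,
  worth at most d ln 4, and of proper prime powers, worth O(sqrt d (log d)^2). The central binomial
  coefficient of 8d makes the same sum at least 4 d ln 4 - ln (8 d). The factor 8 thus leaves a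
  linear gap of 3 d ln 4.\<close>

lemma eventually_prime_between:
  "\<exists>d0. \<forall>d\<ge>d0. \<exists>p::nat. prime p \<and> d < p \<and> p \<le> 8 * d"
proof -
  have "eventually (\<lambda>d::nat. 3 * real d * ln 4 > ln (8 * real d) +
      sqrt (8 * d) * (log 2 (8 * d) + 1) * ln (8 * real d)) at_top"
    by real_asymp
  then obtain d1 where d1: "\<And>d. d \<ge> d1 \<Longrightarrow> 3 * real d * ln 4 > ln (8 * real d) +
      sqrt (8 * d) * (log 2 (8 * d) + 1) * ln (8 * real d)"
    by (auto simp: eventually_at_top_linorder)
  show ?thesis
  proof (rule exI[of _ "max d1 1"], intro allI impI, rule ccontr)
    fix d assume d: "d \<ge> max d1 1" and no: "\<not> (\<exists>p. prime p \<and> d < p \<and> p \<le> 8 * d)"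
    let ?m = "8 * d"
    have "real (4 * d) * ln 4 - ln (8 * real d) = ln (4 ^ (4 * d) / (2 * real (4 * d)))"
      using d by (simp add: ln_div ln_mult ln_realpow)
    also have "\<dots> \<le> ln (real ((2 * (4 * d)) choose (4 * d)))"
      using central_binomial_lower_bound[of "4 * d"] d by (intro ln_mono) auto
    also have "\<dots> \<le> (\<Sum>q\<in>{1..?m}. mangoldt q)"
      using ln_central_binomial_le[of "4 * d"] by simp
    also have "\<dots> = (\<Sum>q | q \<in> {1..?m} \<and> prime q. mangoldt q) + (\<Sum>q | q \<in> {1..?m} \<and> \<not> prime q. mangoldt q)"
      by (subst sum.union_disjoint[symmetric]) (auto intro!: sum.cong)
    also have "(\<Sum>q | q \<in> {1..?m} \<and> prime q. mangoldt q) = (\<Sum>q | prime q \<and> q \<le> d. ln (real q))"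
      using no by (intro sum.cong) (auto simp: Suc_le_eq prime_gt_0_nat dest: leI)
    also have "\<dots> = ln (real (\<Prod>{q. prime q \<and> q \<le> d}))"
      by (subst of_nat_prod, subst ln_prod) (auto simp: prime_gt_0_nat)
    also have "\<dots> \<le> ln (4 ^ d)"
    proof -
      have "real (\<Prod>{q. prime q \<and> q \<le> d}) \<le> 4 ^ d"
        using primorial_le[of d] by (metis of_nat_le_iff of_nat_power of_nat_numeral)
      moreover have "\<Prod>{q. prime q \<and> q \<le> d} > 0"
        by (intro prod_pos) (auto simp: prime_gt_0_nat)
      ultimately show ?thesis by (metis ln_mono of_nat_0_less_iff)
    qed
    also have "ln ((4::real) ^ d) = real d * ln 4" by (simp add: ln_realpow)
    finally show False
      using sum_mangoldt_proper_powers_le[of ?m] d1[of d] d by (simp add: algebra_simps)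
  qed
qed

section \<open>Abelian Galois groups and Dickson polynomials\<close>

text \<open>This is 2 T_n(x/2) for the Chebyshev polynomial T_n. Recursion over an arbitrary
  commutative ring lets algebraic integers and their real conjugates share one definition.\<close>

fun dickson :: "nat \<Rightarrow> 'a :: comm_ring_1 \<Rightarrow> 'a" where
  "dickson 0 x = 2"
| "dickson (Suc 0) x = x"
| "dickson (Suc (Suc n)) x = x * dickson (Suc n) x - dickson n x"

lemma dickson_add_inverse:
  fixes t :: "'a :: field"
  assumes "t \<noteq> 0"
  shows "dickson n (t + inverse t) = t ^ n + inverse t ^ n"
proof (induction n rule: induct_nat_012)
  case (ge2 n)
  have e: "t * (inverse t * y) = y" for y
    using assms right_inverse[OF assms] by (simp only: mult.assoc[symmetric] mult_1)
  have e': "inverse t * (t * y) = y" for y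
    using assms left_inverse[OF assms] by (simp only: mult.assoc[symmetric] mult_1)
  show ?case using ge2 by (simp only: dickson.simps power_Suc ring_distribs e e') simp
qed simp_all

text \<open>The elements of \<open>G\<close> are functions on all complex numbers of which only the
  values on \<open>K\<close> carry meaning. Composition and inverses are therefore stated pointwise
  on \<open>K\<close>, and \<open>G_ext\<close> says that an element is determined by its
  restriction.\<close>

locale abelian_galois =
  fixes K :: "complex set" and G :: "(complex \<Rightarrow> complex) set"
  assumes finite_G: "finite G"
    and one_K: "1 \<in> K"
    and add_K: "\<And>x y. x \<in> K \<Longrightarrow> y \<in> K \<Longrightarrow> x + y \<in> K"
    and minus_K: "\<And>x. x \<in> K \<Longrightarrow> - x \<in> K"
    and mult_K: "\<And>x y. x \<in> K \<Longrightarrow> y \<in> K \<Longrightarrow> x * y \<in> K"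
    and inverse_K: "\<And>x. x \<in> K \<Longrightarrow> inverse x \<in> K"
    and G_K: "\<And>\<sigma> x. \<sigma> \<in> G \<Longrightarrow> x \<in> K \<Longrightarrow> \<sigma> x \<in> K"
    and G_one: "\<And>\<sigma>. \<sigma> \<in> G \<Longrightarrow> \<sigma> 1 = 1"
    and G_add: "\<And>\<sigma> x y. \<sigma> \<in> G \<Longrightarrow> x \<in> K \<Longrightarrow> y \<in> K \<Longrightarrow> \<sigma> (x + y) = \<sigma> x + \<sigma> y"
    and G_mult: "\<And>\<sigma> x y. \<sigma> \<in> G \<Longrightarrow> x \<in> K \<Longrightarrow> y \<in> K \<Longrightarrow> \<sigma> (x * y) = \<sigma> x * \<sigma> y"
    and G_id: "\<exists>\<sigma>\<in>G. \<forall>x\<in>K. \<sigma> x = x"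
    and G_comp: "\<And>\<sigma> \<tau>. \<sigma> \<in> G \<Longrightarrow> \<tau> \<in> G \<Longrightarrow> \<exists>\<rho>\<in>G. \<forall>x\<in>K. \<rho> x = \<sigma> (\<tau> x)"
    and G_inv: "\<And>\<sigma>. \<sigma> \<in> G \<Longrightarrow> \<exists>\<rho>\<in>G. \<forall>x\<in>K. \<rho> (\<sigma> x) = x"
    and G_ext: "\<And>\<sigma> \<tau>. \<sigma> \<in> G \<Longrightarrow> \<tau> \<in> G \<Longrightarrow> \<forall>x\<in>K. \<sigma> x = \<tau> x \<Longrightarrow> \<sigma> = \<tau>"
    and G_comm: "\<And>\<sigma> \<tau> x. \<sigma> \<in> G \<Longrightarrow> \<tau> \<in> G \<Longrightarrow> x \<in> K \<Longrightarrow> \<sigma> (\<tau> x) = \<tau> (\<sigma> x)"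
    and G_fixed: "\<And>x. x \<in> K \<Longrightarrow> \<forall>\<sigma>\<in>G. \<sigma> x = x \<Longrightarrow> x \<in> \<rat>"
begin

lemma diff_K: "x \<in> K \<Longrightarrow> y \<in> K \<Longrightarrow> x - y \<in> K"
  using add_K[of x "- y"] minus_K by simp

lemma zero_K: "0 \<in> K" using diff_K[OF one_K one_K] by simp

lemma G_zero: "\<sigma> \<in> G \<Longrightarrow> \<sigma> 0 = 0"
  using G_add[of \<sigma> 0 0] zero_K by simp

lemma G_minus: "\<sigma> \<in> G \<Longrightarrow> x \<in> K \<Longrightarrow> \<sigma> (- x) = - \<sigma> x"
  using G_add[of \<sigma> x "- x"] minus_K[of x] G_zero[of \<sigma>] by (simp add: eq_neg_iff_add_eq_0 add.commute)

lemma G_diff: "\<sigma> \<in> G \<Longrightarrow> x \<in> K \<Longrightarrow> y \<in> K \<Longrightarrow> \<sigma> (x - y) = \<sigma> x - \<sigma> y"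
  using G_add[of \<sigma> x "- y"] minus_K G_minus by simp

lemma power_K: "x \<in> K \<Longrightarrow> x ^ n \<in> K"
  by (induction n) (auto simp: one_K mult_K)

lemma G_power: "\<sigma> \<in> G \<Longrightarrow> x \<in> K \<Longrightarrow> \<sigma> (x ^ n) = \<sigma> x ^ n"
  by (induction n) (auto simp: G_one G_mult power_K)

lemma of_nat_K: "of_nat n \<in> K"
  by (induction n) (auto simp: zero_K one_K add_K)

lemma of_int_K: "of_int n \<in> K"
  by (cases n rule: int_cases2) (auto simp: of_nat_K minus_K)

lemma G_of_nat: "\<sigma> \<in> G \<Longrightarrow> \<sigma> (of_nat n) = of_nat n"
  by (induction n) (auto simp: G_zero G_add one_K of_nat_K G_one)

lemma G_of_int: "\<sigma> \<in> G \<Longrightarrow> \<sigma> (of_int n) = of_int n"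
  by (cases n rule: int_cases2) (auto simp: of_nat_K G_of_nat G_minus)

lemma sum_K: "(\<And>i. i \<in> A \<Longrightarrow> f i \<in> K) \<Longrightarrow> (\<Sum>i\<in>A. f i) \<in> K"
  by (induction A rule: infinite_finite_induct) (auto simp: zero_K add_K)

lemma prod_K: "(\<And>i. i \<in> A \<Longrightarrow> f i \<in> K) \<Longrightarrow> (\<Prod>i\<in>A. f i) \<in> K"
  by (induction A rule: infinite_finite_induct) (auto simp: one_K mult_K)

lemma G_sum: "\<sigma> \<in> G \<Longrightarrow> (\<And>i. i \<in> A \<Longrightarrow> f i \<in> K) \<Longrightarrow> \<sigma> (\<Sum>i\<in>A. f i) = (\<Sum>i\<in>A. \<sigma> (f i))"
  by (induction A rule: infinite_finite_induct) (auto simp: G_zero G_add sum_K)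

lemma G_prod: "\<sigma> \<in> G \<Longrightarrow> (\<And>i. i \<in> A \<Longrightarrow> f i \<in> K) \<Longrightarrow> \<sigma> (\<Prod>i\<in>A. f i) = (\<Prod>i\<in>A. \<sigma> (f i))"
  by (induction A rule: infinite_finite_induct) (auto simp: G_one G_mult prod_K)

lemma G_inj:
  assumes "\<sigma> \<in> G" "x \<in> K" "y \<in> K" "\<sigma> x = \<sigma> y"
  shows "x = y"
proof -
  obtain \<rho> where "\<forall>x\<in>K. \<rho> (\<sigma> x) = x" using G_inv[OF assms(1)] by blast
  then have "x = \<rho> (\<sigma> x)" "y = \<rho> (\<sigma> y)" using assms(2,3) by simp_all
  then show ?thesis using assms(4) by simp
qed

text \<open>Translation by a group element as a permutation of the finite set \<open>G\<close>:
  injectivity on \<open>K\<close> together with \<open>G_ext\<close> gives injectivity, finiteness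
  the rest. It serves to reindex sums and products over conjugates.\<close>

lemma G_translate:
  assumes "\<sigma> \<in> G"
  shows "\<exists>f. bij_betw f G G \<and> (\<forall>\<tau>\<in>G. \<forall>x\<in>K. f \<tau> x = \<sigma> (\<tau> x))"
proof -
  have "\<forall>\<tau>\<in>G. \<exists>\<rho>. \<rho> \<in> G \<and> (\<forall>x\<in>K. \<rho> x = \<sigma> (\<tau> x))"
    using G_comp[OF assms] by blast
  then obtain f where "\<forall>\<tau>\<in>G. f \<tau> \<in> G \<and> (\<forall>x\<in>K. f \<tau> x = \<sigma> (\<tau> x))"
    by (rule bchoice[THEN exE])
  then have f: "\<And>\<tau>. \<tau> \<in> G \<Longrightarrow> f \<tau> \<in> G" "\<And>\<tau> x. \<tau> \<in> G \<Longrightarrow> x \<in> K \<Longrightarrow> f \<tau> x = \<sigma> (\<tau> x)"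
    by blast+
  have "inj_on f G"
  proof (rule inj_onI)
    fix \<tau> \<tau>' assume *: "\<tau> \<in> G" "\<tau>' \<in> G" "f \<tau> = f \<tau>'"
    have "\<tau> x = \<tau>' x" if x: "x \<in> K" for x
      using G_inj[OF assms, of "\<tau> x" "\<tau>' x"] f(2)[of \<tau> x] f(2)[of \<tau>' x] * x G_K by simp
    then show "\<tau> = \<tau>'" using G_ext[of \<tau> \<tau>'] * by blast
  qed
  moreover have "f ` G \<subseteq> G" using f by blast
  ultimately have "bij_betw f G G" using endo_inj_surj[OF finite_G] by (simp add: bij_betw_def)
  then show ?thesis using f(2) by blast
qed

definition ints_K :: "complex set" ("\<O>") where "\<O> = {x \<in> K. algebraic_int x}"

lemma O_K: "x \<in> \<O> \<Longrightarrow> x \<in> K"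
  by (simp add: ints_K_def)

lemma O_add: "x \<in> \<O> \<Longrightarrow> y \<in> \<O> \<Longrightarrow> x + y \<in> \<O>"
  by (simp add: ints_K_def add_K algebraic_int_add)

lemma O_diff: "x \<in> \<O> \<Longrightarrow> y \<in> \<O> \<Longrightarrow> x - y \<in> \<O>"
  by (simp add: ints_K_def diff_K algebraic_int_diff)

lemma O_mult: "x \<in> \<O> \<Longrightarrow> y \<in> \<O> \<Longrightarrow> x * y \<in> \<O>"
  by (simp add: ints_K_def mult_K algebraic_int_mult)

lemma O_of_int: "of_int k \<in> \<O>"
  by (simp add: ints_K_def of_int_K algebraic_int_of_int)

lemma O_of_nat: "of_nat n \<in> \<O>"
  using O_of_int[of "int n"] by simp

lemma O_0: "0 \<in> \<O>" and O_1: "1 \<in> \<O>"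
  using O_of_nat[of 0] O_of_nat[of 1] by simp_all

lemma O_minus: "x \<in> \<O> \<Longrightarrow> - x \<in> \<O>"
  using O_diff[OF O_0] by simp

lemma O_power: "x \<in> \<O> \<Longrightarrow> x ^ n \<in> \<O>"
  by (induction n) (simp_all add: O_1 O_mult)

lemma O_sum: "(\<And>i. i \<in> A \<Longrightarrow> f i \<in> \<O>) \<Longrightarrow> (\<Sum>i\<in>A. f i) \<in> \<O>"
  by (induction A rule: infinite_finite_induct) (simp_all add: O_0 O_add)

lemma O_prod: "(\<And>i. i \<in> A \<Longrightarrow> f i \<in> \<O>) \<Longrightarrow> (\<Prod>i\<in>A. f i) \<in> \<O>"
  by (induction A rule: infinite_finite_induct) (simp_all add: O_1 O_mult)

lemma G_poly_of_int:
  assumes "\<sigma> \<in> G" "x \<in> K"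
  shows "\<sigma> (poly (of_int_poly p) x) = poly (of_int_poly p) (\<sigma> x)"
  using assms
  by (simp add: poly_altdef G_sum G_mult G_power G_of_int mult_K power_K of_int_K)

lemma O_G: assumes "\<sigma> \<in> G" "x \<in> \<O>" shows "\<sigma> x \<in> \<O>"
proof -
  obtain p :: "int poly" where p: "poly (of_int_poly p) x = 0" "lead_coeff p = 1"
    using assms unfolding ints_K_def algebraic_int_altdef_ipoly by blast
  have "poly (of_int_poly p) (\<sigma> x) = 0"
    using G_poly_of_int[OF assms(1) O_K[OF assms(2)], of p] p(1) G_zero[OF assms(1)] by simp
  then have "algebraic_int (\<sigma> x)" using p(2) unfolding algebraic_int_altdef_ipoly by blast
  then show ?thesis using G_K[OF assms(1) O_K[OF assms(2)]] by (simp add: ints_K_def)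
qed

lemma O_fixed:
  assumes "x \<in> \<O>" "\<And>\<sigma>. \<sigma> \<in> G \<Longrightarrow> \<sigma> x = x"
  shows "\<exists>k. x = of_int k"
proof -
  have "x \<in> \<rat>" using G_fixed[OF O_K[OF assms(1)]] assms(2) by blast
  moreover have "algebraic_int x" using assms(1) by (simp add: ints_K_def)
  ultimately have "x \<in> \<int>" using rational_algebraic_int_is_int by blast
  then show ?thesis by (auto elim: Ints_cases)
qed

section \<open>Norms, traces and congruences modulo p\<close>

definition nrm :: "complex \<Rightarrow> complex" where "nrm x = (\<Prod>\<sigma>\<in>G. \<sigma> x)"
definition tr :: "complex \<Rightarrow> complex" where "tr x = (\<Sum>\<sigma>\<in>G. \<sigma> x)"

lemma nrm_int:
  assumes "x \<in> \<O>"
  shows "\<exists>k. nrm x = of_int k"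
proof (rule O_fixed)
  show "nrm x \<in> \<O>" unfolding nrm_def by (rule O_prod) (simp add: O_G assms)
  fix \<sigma> assume s: "\<sigma> \<in> G"
  from G_translate[OF s] obtain f where
    f: "bij_betw f G G" "\<forall>\<tau>\<in>G. \<forall>x\<in>K. f \<tau> x = \<sigma> (\<tau> x)"
    by (elim exE conjE)
  have "\<sigma> (nrm x) = (\<Prod>\<tau>\<in>G. \<sigma> (\<tau> x))"
    unfolding nrm_def by (rule G_prod[OF s]) (simp add: G_K O_K[OF assms])
  also have "\<dots> = (\<Prod>\<tau>\<in>G. f \<tau> x)"
    using f(2) O_K[OF assms] by (intro prod.cong refl) metis
  also have "\<dots> = nrm x" unfolding nrm_def by (rule prod.reindex_bij_betw[OF f(1)])
  finally show "\<sigma> (nrm x) = nrm x" .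
qed

lemma tr_int:
  assumes "x \<in> \<O>"
  shows "\<exists>k. tr x = of_int k"
proof (rule O_fixed)
  show "tr x \<in> \<O>" unfolding tr_def by (rule O_sum) (simp add: O_G assms)
  fix \<sigma> assume s: "\<sigma> \<in> G"
  from G_translate[OF s] obtain f where
    f: "bij_betw f G G" "\<forall>\<tau>\<in>G. \<forall>x\<in>K. f \<tau> x = \<sigma> (\<tau> x)"
    by (elim exE conjE)
  have "\<sigma> (tr x) = (\<Sum>\<tau>\<in>G. \<sigma> (\<tau> x))"
    unfolding tr_def by (rule G_sum[OF s]) (simp add: G_K O_K[OF assms])
  also have "\<dots> = (\<Sum>\<tau>\<in>G. f \<tau> x)"
    using f(2) O_K[OF assms] by (intro sum.cong refl) metis
  also have "\<dots> = tr x" unfolding tr_def by (rule sum.reindex_bij_betw[OF f(1)])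
  finally show "\<sigma> (tr x) = tr x" .
qed

lemma nrm_mult: "x \<in> K \<Longrightarrow> y \<in> K \<Longrightarrow> nrm (x * y) = nrm x * nrm y"
  unfolding nrm_def by (simp add: G_mult prod.distrib)

lemma nrm_of_nat: "nrm (of_nat n) = of_nat n ^ card G"
  unfolding nrm_def by (simp add: G_of_nat)

text \<open>The norm is a rational integer, and it does not vanish because every automorphism is
  injective on \<open>K\<close>.\<close>

lemma nrm_ge_1:
  assumes "x \<in> \<O>" "x \<noteq> 0"
  shows "(\<Prod>\<sigma>\<in>G. cmod (\<sigma> x)) \<ge> 1"
proof -
  obtain k where k: "nrm x = of_int k" using nrm_int[OF assms(1)] by blast
  have "\<sigma> x \<noteq> 0" if "\<sigma> \<in> G" for \<sigma>
    using G_inj[OF that O_K[OF assms(1)] zero_K] G_zero[OF that] assms(2) by metis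
  then have "nrm x \<noteq> 0"
    unfolding nrm_def using finite_G by (simp add: prod_zero_iff)
  with k have "k \<noteq> 0" by auto
  then have "cmod (nrm x) \<ge> 1" unfolding k by (simp add: norm_of_int)
  then show ?thesis by (simp add: nrm_def prod_norm)
qed

lemma O_dickson: "x \<in> \<O> \<Longrightarrow> dickson n x \<in> \<O>"
  by (induction n x rule: dickson.induct)
    (use O_of_int[of 2] in \<open>auto simp: O_diff O_mult\<close>)

lemma G_dickson: "\<sigma> \<in> G \<Longrightarrow> x \<in> K \<Longrightarrow> dickson n x \<in> K \<and> \<sigma> (dickson n x) = dickson n (\<sigma> x)"
proof (induction n x rule: dickson.induct)
  case (1 x)
  then show ?case using G_of_int[of \<sigma> 2] of_int_K[of 2] by simp
qed (auto simp: G_diff G_mult diff_K mult_K)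

lemma freshman:
  assumes "prime p" "a \<in> \<O>" "b \<in> \<O>"
  shows "\<exists>c\<in>\<O>. (a + b) ^ p = a ^ p + b ^ p + of_nat p * c"
proof -
  have p: "p > 1" using assms(1) prime_gt_1_nat by blast
  have "(a + b) ^ p = (\<Sum>k\<le>p. of_nat (p choose k) * a ^ k * b ^ (p - k))" by (rule binomial_ring)
  also have "{..p} = insert 0 (insert p {1..<p})" using p by auto
  also have "(\<Sum>k\<in>\<dots>. of_nat (p choose k) * a ^ k * b ^ (p - k)) =
      a ^ p + b ^ p + (\<Sum>k\<in>{1..<p}. of_nat (p choose k) * a ^ k * b ^ (p - k))"
    using p by simp
  also have "(\<Sum>k\<in>{1..<p}. of_nat (p choose k) * a ^ k * b ^ (p - k)) =
      (\<Sum>k\<in>{1..<p}. of_nat p * (of_nat ((p choose k) div p) * a ^ k * b ^ (p - k)))"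
  proof (intro sum.cong refl)
    fix k assume "k \<in> {1..<p}"
    then have "p dvd p choose k" using assms(1) p by (intro dvd_choose_prime) auto
    then have "p choose k = p * ((p choose k) div p)" by simp
    then show "of_nat (p choose k) * a ^ k * b ^ (p - k) =
      of_nat p * (of_nat ((p choose k) div p) * a ^ k * b ^ (p - k))"
      by (metis mult.assoc of_nat_mult)
  qed
  also have "\<dots> = of_nat p * (\<Sum>k\<in>{1..<p}. of_nat ((p choose k) div p) * a ^ k * b ^ (p - k))"
    by (simp add: sum_distrib_left)
  finally show ?thesis
    using assms by (intro bexI[of _ "\<Sum>k\<in>{1..<p}. of_nat ((p choose k) div p) * a ^ k * b ^ (p - k)"])
      (auto intro!: O_sum O_mult O_of_nat O_power)
qed

lemma freshman_sum:
  assumes "prime p" "finite A" "\<And>i. i \<in> A \<Longrightarrow> f i \<in> \<O>"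
  shows "\<exists>c\<in>\<O>. (\<Sum>i\<in>A. f i) ^ p = (\<Sum>i\<in>A. f i ^ p) + of_nat p * c"
  using assms(2,3)
proof (induction A rule: finite_induct)
  case empty
  then show ?case using assms(1) prime_gt_0_nat by (intro bexI[of _ 0]) (auto simp: O_0)
next
  case (insert i A)
  then obtain c where c: "c \<in> \<O>" "(\<Sum>i\<in>A. f i) ^ p = (\<Sum>i\<in>A. f i ^ p) + of_nat p * c" by auto
  obtain e where e: "e \<in> \<O>" "(f i + (\<Sum>i\<in>A. f i)) ^ p = f i ^ p + (\<Sum>i\<in>A. f i) ^ p + of_nat p * e"
    using freshman[OF assms(1), of "f i" "\<Sum>i\<in>A. f i"] insert by (auto intro: O_sum)
  show ?case using insert c e by (intro bexI[of _ "c + e"]) (auto simp: algebra_simps O_add)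
qed

text \<open>With x = t + 1/t, the binomial expansion of x^p has inner coefficients divisible by p,
  and its two outer terms add up to the Dickson value. What must be shown is that the cofactor of p
  lies in the ring of integers of \<open>K\<close>, although t may not.\<close>

lemma dickson_cong_power:
  assumes "prime p" "odd p" "x \<in> \<O>"
  shows "\<exists>c\<in>\<O>. dickson p x = x ^ p + of_nat p * c"
proof -
  have p: "p > 1" using assms(1) prime_gt_1_nat by blast
  \<comment> \<open>A root of t^2 - x t + 1, so that x = t + 1/t.\<close>
  define t where "t = (x + csqrt (x ^ 2 - 4)) / 2"
  have t2: "t * (x - t) = 1"
  proof -
    have "t * (x - t) = (x ^ 2 - csqrt (x ^ 2 - 4) ^ 2) / 4"
      unfolding t_def by (simp add: field_simps power2_eq_square)
    then show ?thesis by (simp add: power2_csqrt)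
  qed
  then have t: "t \<noteq> 0" by auto
  have inv: "x - t = inverse t" using t2 t by (simp add: field_simps)
  then have x: "x = t + inverse t" by (metis diff_add_cancel add.commute)
  have dick: "t ^ k * inverse t ^ l + t ^ l * inverse t ^ k = dickson (if k \<le> l then l - k else k - l) x" for k l
  proof (induction k l rule: linorder_wlog)
    case (le k l)
    then obtain j where "l = k + j" by (metis le_Suc_ex)
    moreover have "t ^ k * inverse t ^ k = 1" using t by (simp flip: power_mult_distrib)
    moreover have "t ^ k * (inverse t ^ k * inverse t ^ j) + t ^ k * t ^ j * inverse t ^ k =
        (t ^ k * inverse t ^ k) * inverse t ^ j + (t ^ k * inverse t ^ k) * t ^ j"
      by (simp only: mult_ac)
    ultimately show ?case unfolding x dickson_add_inverse[OF t] by (simp add: power_add mult_ac add_ac)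
  next
    case (sym k l)
    then show ?case by (cases "k = l") (auto simp: add.commute)
  qed
  let ?D = "\<lambda>k. dickson (if k \<le> p - k then p - k - k else k - (p - k)) x"
  \<comment> \<open>Adding the expansion to its mirror image pairs t^i / t^j with t^j / t^i, and
    each pair is a Dickson value of \<open>x\<close>, hence an integer of \<open>K\<close>.\<close>
  have "x ^ p + x ^ p = (\<Sum>k\<le>p. of_nat (p choose k) * t ^ k * inverse t ^ (p - k)) +
      (\<Sum>k\<le>p. of_nat (p choose k) * inverse t ^ k * t ^ (p - k))"
    using binomial_ring[of t "inverse t" p] binomial_ring[of "inverse t" t p] x by (simp add: add.commute)
  also have "\<dots> = (\<Sum>k\<le>p. of_nat (p choose k) * ?D k)"
    unfolding sum.distrib[symmetric] by (intro sum.cong refl) (simp add: dick[symmetric] algebra_simps)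
  also have "{..p} = insert 0 (insert p {1..<p})" using p by auto
  also have "(\<Sum>k\<in>\<dots>. of_nat (p choose k) * ?D k) = 2 * dickson p x + (\<Sum>k\<in>{1..<p}. of_nat (p choose k) * ?D k)"
    using p by simp
  also have "(\<Sum>k\<in>{1..<p}. of_nat (p choose k) * ?D k) =
      (\<Sum>k\<in>{1..<p}. of_nat p * (of_nat ((p choose k) div p) * ?D k))"
  proof (intro sum.cong refl)
    fix k assume "k \<in> {1..<p}"
    then have "p dvd p choose k" using assms(1) p by (intro dvd_choose_prime) auto
    then have "p choose k = p * ((p choose k) div p)" by simp
    then show "of_nat (p choose k) * ?D k = of_nat p * (of_nat ((p choose k) div p) * ?D k)"
      by (metis mult.assoc of_nat_mult)
  qed
  also have "\<dots> = of_nat p * (\<Sum>k\<in>{1..<p}. of_nat ((p choose k) div p) * ?D k)"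
    by (simp add: sum_distrib_left)
  finally obtain c where c: "c \<in> \<O>" "2 * x ^ p = 2 * dickson p x + of_nat p * c"
    using assms by (metis (no_types, lifting) O_sum O_mult O_of_nat O_dickson mult_2)
  obtain r where r: "p = 2 * r + 1" using assms(2) by (elim oddE)
  \<comment> \<open>Removes the factor 2 caused by the doubling: as p = 2r + 1, adding r times the
    relation 2 (D_p(x) - x^p) = - p c to D_p(x) - x^p exhibits p as a factor without dividing by
    2.\<close>
  define u where "u = dickson p x - x ^ p + of_nat r * c"
  have "2 * (dickson p x - x ^ p) = - (of_nat p * c)" using c(2) by (simp add: algebra_simps)
  moreover have "of_nat p * u = of_nat r * (2 * (dickson p x - x ^ p)) + (dickson p x - x ^ p) +
      of_nat r * (of_nat p * c)"
    unfolding u_def r by (simp add: algebra_simps)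
  ultimately have "of_nat p * u = dickson p x - x ^ p" by simp
  moreover have "u \<in> \<O>" unfolding u_def using assms c by (intro O_add O_diff O_mult O_of_nat O_dickson O_power)
  ultimately show ?thesis by (intro bexI[of _ u]) auto
qed

section \<open>Prime ideals of the ring of integers above p\<close>

definition ideal_K :: "complex set \<Rightarrow> bool" where
  "ideal_K I \<longleftrightarrow> I \<subseteq> \<O> \<and> 0 \<in> I \<and> (\<forall>a\<in>I. \<forall>b\<in>I. a + b \<in> I) \<and> (\<forall>a\<in>\<O>. \<forall>b\<in>I. a * b \<in> I)"

text \<open>Otherwise the rational number 1/p would be an algebraic integer. This makes the ideal
  generated by p proper, which starts the application of Zorn's lemma.\<close>

lemma inverse_prime_notin_O:
  assumes "prime p" "x \<in> \<O>"
  shows "of_nat p * x \<noteq> 1"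
proof
  assume "of_nat p * x = 1"
  then have x: "x = 1 / of_nat p" by (metis mult.commute nonzero_eq_divide_eq mult_zero_left zero_neq_one)
  then have "x \<in> \<rat>" by simp
  moreover have "algebraic_int x" using assms(2) by (simp add: ints_K_def)
  ultimately obtain k where k: "x = of_int k" using rational_algebraic_int_is_int by (metis Ints_cases)
  have "of_int (int p * k) = (1 :: complex)" using \<open>of_nat p * x = 1\<close> k by simp
  then have "int p * k = 1" by (metis of_int_eq_1_iff)
  then have "int p dvd 1" by (metis dvd_triv_left)
  then show False using assms(1) by (simp add: not_prime_unit)
qed

text \<open>Zorn's lemma on the proper ideals containing p; the union of a chain of such ideals
  still omits 1.\<close>

lemma exists_maximal_ideal:
  assumes "prime p"
  shows "\<exists>M. ideal_K M \<and> of_nat p \<in> M \<and> 1 \<notin> M \<and>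
    (\<forall>J. ideal_K J \<longrightarrow> M \<subseteq> J \<longrightarrow> 1 \<notin> J \<longrightarrow> J = M)"
proof -
  define \<A> where "\<A> = {I. ideal_K I \<and> of_nat p \<in> I \<and> 1 \<notin> I}"
  define J where "J = (\<lambda>x. of_nat p * x) ` \<O>"
  have "ideal_K J"
    unfolding ideal_K_def
  proof (intro conjI ballI)
    show "J \<subseteq> \<O>" unfolding J_def using O_mult O_of_nat by blast
    show "0 \<in> J" unfolding J_def using O_0 by force
    fix a b assume "b \<in> J"
    then obtain y where y: "b = of_nat p * y" "y \<in> \<O>" unfolding J_def by blast
    {
      assume "a \<in> J"
      then obtain x where x: "a = of_nat p * x" "x \<in> \<O>" unfolding J_def by blast
      have "a + b = of_nat p * (x + y)" using x y by (simp add: distrib_left)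
      then show "a + b \<in> J" unfolding J_def using x y O_add by blast
    next
      assume a: "a \<in> \<O>"
      have "a * b = of_nat p * (a * y)" using y by (simp add: mult_ac)
      then show "a * b \<in> J" unfolding J_def using a y O_mult by blast
    }
  qed
  moreover have "of_nat p \<in> J" unfolding J_def using O_1 by force
  moreover have "1 \<notin> J" unfolding J_def using inverse_prime_notin_O[OF assms] by force
  ultimately have "J \<in> \<A>" unfolding \<A>_def by blast
  then have ne: "\<A> \<noteq> {}" by blast
  have "\<exists>M\<in>\<A>. \<forall>X\<in>\<A>. M \<subseteq> X \<longrightarrow> X = M"
  proof (rule subset_Zorn_nonempty[OF ne])
    fix \<C> assume C: "\<C> \<noteq> {}" "subset.chain \<A> \<C>"
    then have lin: "X \<subseteq> Y \<or> Y \<subseteq> X" if "X \<in> \<C>" "Y \<in> \<C>" for X Y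
      using that by (auto simp: subset_chain_def)
    have id: "ideal_K X" "of_nat p \<in> X" "1 \<notin> X" if "X \<in> \<C>" for X
      using C(2) that by (auto simp: subset_chain_def \<A>_def)
    obtain X0 where X0: "X0 \<in> \<C>" using C(1) by blast
    have "ideal_K (\<Union>\<C>)"
      unfolding ideal_K_def
    proof (intro conjI ballI)
      show "\<Union>\<C> \<subseteq> \<O>" using id(1) unfolding ideal_K_def by blast
      show "0 \<in> \<Union>\<C>" using id(1)[OF X0] X0 unfolding ideal_K_def by blast
      fix a b assume "b \<in> \<Union>\<C>"
      then obtain Y where Y: "b \<in> Y" "Y \<in> \<C>" by blast
      {
        assume "a \<in> \<Union>\<C>"
        then obtain X where X: "a \<in> X" "X \<in> \<C>" by blast
        consider "X \<subseteq> Y" | "Y \<subseteq> X" using lin[OF X(2) Y(2)] by blast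
        then show "a + b \<in> \<Union>\<C>"
        proof cases
          case 1
          then have "a + b \<in> Y" using id(1)[OF Y(2)] X(1) Y(1) unfolding ideal_K_def by blast
          then show ?thesis using Y(2) by blast
        next
          case 2
          then have "a + b \<in> X" using id(1)[OF X(2)] X(1) Y(1) unfolding ideal_K_def by blast
          then show ?thesis using X(2) by blast
        qed
      next
        assume "a \<in> \<O>"
        then have "a * b \<in> Y" using id(1)[OF Y(2)] Y(1) unfolding ideal_K_def by blast
        then show "a * b \<in> \<Union>\<C>" using Y(2) by blast
      }
    qed
    moreover have "of_nat p \<in> \<Union>\<C>" using id(2)[OF X0] X0 by blast
    moreover have "1 \<notin> \<Union>\<C>" using id(3) by blast
    ultimately show "\<Union>\<C> \<in> \<A>" unfolding \<A>_def by blast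
  qed
  then obtain M where M: "M \<in> \<A>" "\<And>X. X \<in> \<A> \<Longrightarrow> M \<subseteq> X \<Longrightarrow> X = M" by blast
  have "J = M" if "ideal_K J" "M \<subseteq> J" "1 \<notin> J" for J
    using M(2)[of J] that M(1) by (auto simp: \<A>_def)
  then show ?thesis using M(1) by (auto simp: \<A>_def)
qed

text \<open>A maximal ideal M is prime: if a is outside M, then M + O a contains 1 = m + c a, and
  multiplying by b puts b into M whenever a b lies in M.\<close>

lemma exists_prime_ideal:
  assumes "prime p"
  shows "\<exists>P. ideal_K P \<and> of_nat p \<in> P \<and> 1 \<notin> P \<and>
    (\<forall>a\<in>\<O>. \<forall>b\<in>\<O>. a * b \<in> P \<longrightarrow> a \<in> P \<or> b \<in> P)"
proof -
  obtain M where M: "ideal_K M" "of_nat p \<in> M" "1 \<notin> M"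
    and max: "\<And>J. ideal_K J \<Longrightarrow> M \<subseteq> J \<Longrightarrow> 1 \<notin> J \<Longrightarrow> J = M"
    using exists_maximal_ideal[OF assms] by blast
  have "b \<in> M" if ab: "a \<in> \<O>" "b \<in> \<O>" "a * b \<in> M" "a \<notin> M" for a b
  proof -
    define J where "J = {m + c * a |m c. m \<in> M \<and> c \<in> \<O>}"
    have MO: "M \<subseteq> \<O>" using M(1) by (simp add: ideal_K_def)
    have J: "ideal_K J"
      unfolding ideal_K_def
    proof (intro conjI ballI subsetI)
      fix x assume "x \<in> J"
      then show "x \<in> \<O>" unfolding J_def using MO ab O_add O_mult by blast
    next
      show "0 \<in> J" unfolding J_def using M(1) O_0 by (force simp: ideal_K_def)
    next
      fix x y assume "x \<in> J" "y \<in> J"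
      then obtain m c m' c' where *: "x = m + c * a" "y = m' + c' * a" "m \<in> M" "m' \<in> M" "c \<in> \<O>" "c' \<in> \<O>"
        unfolding J_def by blast
      then have "x + y = (m + m') + (c + c') * a" by (simp add: algebra_simps)
      moreover have "m + m' \<in> M" "c + c' \<in> \<O>" using * M(1) O_add by (auto simp: ideal_K_def)
      ultimately show "x + y \<in> J" unfolding J_def by blast
    next
      fix x y assume x: "x \<in> \<O>" and "y \<in> J"
      then obtain m c where *: "y = m + c * a" "m \<in> M" "c \<in> \<O>" unfolding J_def by blast
      then have "x * y = x * m + (x * c) * a" by (simp add: algebra_simps)
      moreover have "x * m \<in> M" "x * c \<in> \<O>" using * x M(1) O_mult by (auto simp: ideal_K_def)
      ultimately show "x * y \<in> J" unfolding J_def by blast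
    qed
    have "M \<subseteq> J"
    proof
      fix m assume "m \<in> M"
      then have "m = m + 0 * a" "m \<in> M" by simp_all
      then show "m \<in> J" unfolding J_def using O_0 by blast
    qed
    moreover have "a \<in> J"
    proof -
      have "a = 0 + 1 * a" by simp
      then show ?thesis unfolding J_def using M(1) O_1 unfolding ideal_K_def by blast
    qed
    ultimately have "1 \<in> J" using max[OF J] ab(4) by blast
    then obtain m c where mc: "1 = m + c * a" "m \<in> M" "c \<in> \<O>" unfolding J_def by blast
    have "b = b * (m + c * a)" using mc(1) by simp
    then have "b = b * m + c * (a * b)" by (simp add: algebra_simps)
    moreover have "b * m \<in> M" "c * (a * b) \<in> M" using M(1) mc ab by (simp_all add: ideal_K_def)
    ultimately show ?thesis using M(1) by (metis ideal_K_def)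
  qed
  then show ?thesis using M by blast
qed

end

section \<open>Frobenius and inertia\<close>

locale abelian_galois_prime = abelian_galois +
  fixes p :: nat and P :: "complex set"
  assumes prime_p: "prime p" and ideal_P: "ideal_K P" and p_P: "of_nat p \<in> P" and one_P: "1 \<notin> P"
    and prime_P: "\<And>a b. a \<in> \<O> \<Longrightarrow> b \<in> \<O> \<Longrightarrow> a * b \<in> P \<Longrightarrow> a \<in> P \<or> b \<in> P"
begin

lemma P_O: "a \<in> P \<Longrightarrow> a \<in> \<O>"
  and P_add: "a \<in> P \<Longrightarrow> b \<in> P \<Longrightarrow> a + b \<in> P"
  and P_mult: "a \<in> \<O> \<Longrightarrow> b \<in> P \<Longrightarrow> a * b \<in> P"
  and P_0: "0 \<in> P"
  using ideal_P by (auto simp: ideal_K_def)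

lemma P_minus: "a \<in> P \<Longrightarrow> - a \<in> P"
  using P_mult[OF O_minus[OF O_1]] by simp

lemma P_diff: "a \<in> P \<Longrightarrow> b \<in> P \<Longrightarrow> a - b \<in> P"
  using P_add[of a "- b"] P_minus by simp

lemma P_mult': "a \<in> P \<Longrightarrow> b \<in> \<O> \<Longrightarrow> a * b \<in> P"
  using P_mult[of b a] by (simp add: mult.commute)

lemma P_p: "c \<in> \<O> \<Longrightarrow> of_nat p * c \<in> P"
  using P_mult' p_P by simp

lemma P_sum: "(\<And>i. i \<in> A \<Longrightarrow> f i \<in> P) \<Longrightarrow> (\<Sum>i\<in>A. f i) \<in> P"
  by (induction A rule: infinite_finite_induct) (simp_all add: P_0 P_add)

lemma P_power: "a \<in> \<O> \<Longrightarrow> a ^ n \<in> P \<Longrightarrow> a \<in> P"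
  by (induction n) (use one_P prime_P O_power in auto)

text \<open>By Bezout, an integer in \<open>P\<close> prime to p would force 1 into
  \<open>P\<close>.\<close>

lemma P_of_int: "of_int k \<in> P \<longleftrightarrow> int p dvd k"
proof
  assume "int p dvd k"
  then obtain j where "k = int p * j" by (elim dvdE)
  then show "of_int k \<in> P" using P_p[OF O_of_int[of j]] by simp
next
  assume k: "of_int k \<in> P"
  show "int p dvd k"
  proof (rule ccontr)
    assume "\<not> int p dvd k"
    then have "coprime (int p) k" using prime_p by (simp add: prime_imp_coprime)
    then obtain u v where "u * int p + v * k = 1" by (metis bezout_int coprime_imp_gcd_eq_1)
    then have "of_int (u * int p + v * k) = (1 :: complex)" by simp
    then have "of_int u * of_nat p + of_int v * of_int k = (1 :: complex)" by simp
    moreover have "of_int u * of_nat p + of_int v * of_int k \<in> P"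
      by (intro P_add P_mult O_of_int p_P k)
    ultimately show False using one_P by simp
  qed
qed

text \<open>Invariance under \<open>G\<close> leaves only rational integers, for which lying in one
  prime above p is the same as divisibility by p itself.\<close>

lemma P_fixed:
  assumes "x \<in> P" "\<And>\<sigma>. \<sigma> \<in> G \<Longrightarrow> \<sigma> x = x"
  shows "\<exists>k. x = of_nat p * of_int k"
proof -
  obtain k where k: "x = of_int k" using O_fixed[of x] P_O[OF assms(1)] assms(2) by blast
  then have "int p dvd k" using assms(1) P_of_int by simp
  then show ?thesis using k by (auto elim!: dvdE)
qed

text \<open>Dedekind's independence of characters with values in the domain O/P. Subtracting
  \<open>h a b\<close> times the relation at \<open>y\<close> from the relation at
  \<open>b * y\<close> eliminates the character \<open>a\<close>; the factor
  \<open>h t b - h a b\<close> that appears at \<open>t\<close> is outside \<open>P\<close> for a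
  suitable \<open>b\<close> and can be cancelled.\<close>

lemma independence_of_characters:
  assumes "finite S" "\<And>s y. s \<in> S \<Longrightarrow> y \<in> \<O> \<Longrightarrow> h s y \<in> \<O>"
    and "\<And>s x y. s \<in> S \<Longrightarrow> x \<in> \<O> \<Longrightarrow> y \<in> \<O> \<Longrightarrow> h s (x * y) = h s x * h s y"
    and "\<And>s. s \<in> S \<Longrightarrow> h s 1 = 1"
    and "\<And>s t. s \<in> S \<Longrightarrow> t \<in> S \<Longrightarrow> s \<noteq> t \<Longrightarrow> \<exists>y\<in>\<O>. h s y - h t y \<notin> P"
    and "\<And>s. s \<in> S \<Longrightarrow> c s \<in> \<O>"
    and "\<And>y. y \<in> \<O> \<Longrightarrow> (\<Sum>s\<in>S. c s * h s y) \<in> P"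
    and "s \<in> S"
  shows "c s \<in> P"
  using assms
proof (induction S arbitrary: c s rule: finite_induct)
  case (insert a S)
  note hO = insert.prems(1) and hm = insert.prems(2) and h1 = insert.prems(3)
    and hd = insert.prems(4) and cO = insert.prems(5) and rel = insert.prems(6)
  have cS: "c t \<in> P" if t: "t \<in> S" for t
  proof -
    obtain b where b: "b \<in> \<O>" "h t b - h a b \<notin> P" using hd[of t a] t insert.hyps by auto
    have "c t * (h t b - h a b) \<in> P"
    proof (rule insert.IH[of "\<lambda>s. c s * (h s b - h a b)" t])
      fix y assume y: "y \<in> \<O>"
      have "(\<Sum>s\<in>S. c s * (h s b - h a b) * h s y) =
          (\<Sum>s\<in>insert a S. c s * h s (b * y)) - h a b * (\<Sum>s\<in>insert a S. c s * h s y)"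
        using insert.hyps b y
        by (simp add: hm sum_distrib_left sum_subtractf[symmetric] algebra_simps)
      also have "\<dots> \<in> P"
        using y b hO by (intro P_diff rel P_mult O_mult) auto
      finally show "(\<Sum>s\<in>S. c s * (h s b - h a b) * h s y) \<in> P" .
    qed (use t hO hm h1 hd cO b in \<open>auto intro!: O_mult O_diff\<close>)
    then show ?thesis using prime_P[of "c t" "h t b - h a b"] b t hO cO O_diff by auto
  qed
  show ?case
  proof (cases "s = a")
    case True
    have "(\<Sum>s\<in>insert a S. c s * h s 1) - (\<Sum>s\<in>S. c s * h s 1) \<in> P"
      using cS h1 O_1 by (intro P_diff rel P_sum) auto
    then show ?thesis using insert.hyps h1 True by simp
  next
    case False
    then show ?thesis using cS insert.prems by auto
  qed
qed auto

end

lemma prime_dvd_power_diff: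
  assumes "prime p"
  shows "int p dvd k ^ p - k"
proof -
  have p: "p > 0" using assms prime_gt_0_nat by blast
  define a where "a = nat (k mod int p)"
  have a: "int a = k mod int p" using p by (simp add: a_def)
  have "[a ^ p = a] (mod p)"
  proof (cases "p dvd a")
    case True
    then show ?thesis using p by (simp add: Cong.cong_def dvd_eq_mod_eq_0 power_mod [of a p p, symmetric] zero_power)
  next
    case False
    then have "[a * a ^ (p - 1) = a * 1] (mod p)" using fermat_theorem[OF assms] by (intro cong_scalar_left)
    then show ?thesis using p by (simp add: power_eq_if)
  qed
  then have "[int a ^ p = int a] (mod int p)" by (metis cong_int_iff of_nat_power)
  moreover have "[k = int a] (mod int p)" by (simp add: a cong_def)
  ultimately have "[k ^ p = k] (mod int p)" by (meson cong_pow cong_sym cong_trans)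
  then show ?thesis by (simp add: cong_iff_dvd_diff)
qed

context abelian_galois_prime begin

text \<open>The polynomial with roots the conjugates of \<open>z\<close> has lower coefficients that
  are invariant under \<open>G\<close> and lie in \<open>P\<close>, hence are multiples of p;
  evaluating it at its root \<open>z\<close> isolates the leading power.\<close>

lemma power_card_conjugates_in_P:
  assumes z: "z \<in> \<O>" and zP: "\<And>\<tau>. \<tau> \<in> G \<Longrightarrow> \<tau> z \<in> P"
  shows "\<exists>w\<in>\<O>. z ^ card G = of_nat p * w"
proof -
  \<comment> \<open>The i-th elementary symmetric function of the negated conjugates, that is, the
    coefficient of X^(d - i) in the product of all X - tau z.\<close>
  define e where "e i = (\<Sum>S | S \<subseteq> G \<and> card S = i. \<Prod>\<tau>\<in>S. - \<tau> z)" for i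
  have "\<exists>k. e i = of_nat p * of_int k" if i: "i > 0" for i
  proof (rule P_fixed)
    show "e i \<in> P"
      unfolding e_def
    proof (rule P_sum)
      fix S assume "S \<in> {S. S \<subseteq> G \<and> card S = i}"
      then have S: "S \<subseteq> G" "card S = i" by auto
      then obtain \<tau> where t: "\<tau> \<in> S" using i by fastforce
      have "finite S" using S finite_G finite_subset by blast
      then have "(\<Prod>\<tau>\<in>S. - \<tau> z) = - \<tau> z * (\<Prod>\<tau>\<in>S - {\<tau>}. - \<tau> z)"
        using t by (simp add: prod.remove)
      moreover have "(\<Prod>\<tau>\<in>S - {\<tau>}. - \<tau> z) \<in> \<O>"
        using S by (intro O_prod O_minus) (auto simp: O_G z)
      ultimately show "(\<Prod>\<tau>\<in>S. - \<tau> z) \<in> P" using t S zP P_minus P_mult' by auto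
    qed
  next
    fix \<sigma> assume s: "\<sigma> \<in> G"
    from G_translate[OF s] obtain f where
      f: "bij_betw f G G" "\<forall>\<tau>\<in>G. \<forall>x\<in>K. f \<tau> x = \<sigma> (\<tau> x)" by (elim exE conjE)
    have inj: "inj_on f S" if "S \<subseteq> G" for S
      using f(1) that by (auto simp: bij_betw_def inj_on_subset)
    have "\<sigma> (e i) = (\<Sum>S | S \<subseteq> G \<and> card S = i. \<sigma> (\<Prod>\<tau>\<in>S. - \<tau> z))"
      unfolding e_def by (rule G_sum[OF s]) (auto intro!: prod_K minus_K simp: G_K O_K[OF z] subset_iff)
    also have "\<dots> = (\<Sum>S | S \<subseteq> G \<and> card S = i. \<Prod>\<rho>\<in>f ` S. - \<rho> z)"
    proof (intro sum.cong refl)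
      fix S assume "S \<in> {S. S \<subseteq> G \<and> card S = i}"
      then have S: "S \<subseteq> G" by auto
      have "\<sigma> (\<Prod>\<tau>\<in>S. - \<tau> z) = (\<Prod>\<tau>\<in>S. \<sigma> (- \<tau> z))"
        by (rule G_prod[OF s]) (use S in \<open>auto intro!: minus_K simp: G_K O_K[OF z] subset_iff\<close>)
      also have "\<dots> = (\<Prod>\<tau>\<in>S. - f \<tau> z)"
        using S f(2) O_K[OF z] by (intro prod.cong refl) (auto simp: G_minus[OF s] G_K subset_iff)
      also have "\<dots> = (\<Prod>\<rho>\<in>f ` S. - \<rho> z)"
        using prod.reindex[OF inj[OF S], of "\<lambda>\<rho>. - \<rho> z"] by simp
      finally show "\<sigma> (\<Prod>\<tau>\<in>S. - \<tau> z) = (\<Prod>\<rho>\<in>f ` S. - \<rho> z)" .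
    qed
    also have "\<dots> = e i"
      unfolding e_def
    proof (rule sum.reindex_bij_witness[of _ "\<lambda>S. inv_into G f ` S" "\<lambda>S. f ` S"])
      fix S assume "S \<in> {S. S \<subseteq> G \<and> card S = i}"
      then have S: "S \<subseteq> G" "card S = i" by auto
      show "inv_into G f ` f ` S = S"
        using f(1) S(1) by (simp add: bij_betw_def inv_into_image_cancel)
      show "f ` S \<in> {S. S \<subseteq> G \<and> card S = i}"
        using f(1) S card_image[OF inj[OF S(1)]] by (auto simp: bij_betw_def)
      show "f ` inv_into G f ` S = S"
        using f(1) S by (simp add: bij_betw_def image_inv_into_cancel)
      have "inj_on (inv_into G f) S"
        using f(1) S(1) by (metis bij_betw_def inj_on_inv_into)
      then show "inv_into G f ` S \<in> {S. S \<subseteq> G \<and> card S = i}"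
        using f(1) S card_image[of "inv_into G f" S] by (auto simp: bij_betw_def inv_into_into subset_iff)
    qed simp
    finally show "\<sigma> (e i) = e i" .
  qed
  then obtain k where k: "\<And>i. i > 0 \<Longrightarrow> e i = of_nat p * of_int (k i)" by metis
  obtain \<iota> where i: "\<iota> \<in> G" "\<forall>x\<in>K. \<iota> x = x" using G_id by blast
  \<comment> \<open>The factor belonging to the identity vanishes.\<close>
  have "0 = (\<Prod>\<tau>\<in>G. - \<tau> z + z)"
    using i finite_G O_K[OF z] by (intro prod_zero[symmetric]) (auto intro!: bexI[of _ \<iota>])
  also have "\<dots> = (\<Sum>S\<in>Pow G. (\<Prod>\<tau>\<in>S. - \<tau> z) * (\<Prod>\<tau>\<in>G - S. z))"
    by (rule prod_add[OF finite_G])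
  also have "\<dots> = (\<Sum>S\<in>Pow G. (\<Prod>\<tau>\<in>S. - \<tau> z) * z ^ (card G - card S))"
    by (intro sum.cong refl) (auto simp: card_Diff_subset finite_subset[OF _ finite_G])
  also have "\<dots> = (\<Sum>i\<in>{..card G}. \<Sum>S\<in>{S \<in> Pow G. card S = i}. (\<Prod>\<tau>\<in>S. - \<tau> z) * z ^ (card G - card S))"
    by (rule sum.group[symmetric]) (auto simp: finite_G card_mono)
  also have "\<dots> = (\<Sum>i\<in>{..card G}. e i * z ^ (card G - i))"
    unfolding e_def sum_distrib_right by (intro sum.cong refl) auto
  also have "{..card G} = insert 0 {1..card G}" by auto
  also have "(\<Sum>i\<in>\<dots>. e i * z ^ (card G - i)) = e 0 * z ^ card G + (\<Sum>i\<in>{1..card G}. e i * z ^ (card G - i))"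
    by simp
  also have "e 0 = 1"
  proof -
    have "{S. S \<subseteq> G \<and> card S = 0} = {{}}" using finite_G finite_subset by fastforce
    then show ?thesis by (simp add: e_def)
  qed
  also have "(\<Sum>i\<in>{1..card G}. e i * z ^ (card G - i)) =
      of_nat p * (\<Sum>i\<in>{1..card G}. of_int (k i) * z ^ (card G - i))"
    unfolding sum_distrib_left by (intro sum.cong refl) (auto simp: k)
  finally have "z ^ card G = of_nat p * - (\<Sum>i\<in>{1..card G}. of_int (k i) * z ^ (card G - i))"
    by (simp add: eq_neg_iff_add_eq_0)
  moreover have "- (\<Sum>i\<in>{1..card G}. of_int (k i) * z ^ (card G - i)) \<in> \<O>"
    by (intro O_minus O_sum O_mult O_of_int O_power z)
  ultimately show ?thesis by blast
qed

text \<open>As \<open>\<sigma>\<close> commutes with \<open>G\<close>, all conjugates of z = x -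
  sigma x lie in \<open>P\<close>, not just z itself. Hence z^d is divisible by p, and so is z^p
  because d <= p; then x^p and (sigma x)^p agree modulo p, and so do the Dickson values.\<close>

lemma dickson_cong_if_inertia:
  assumes "odd p" "card G \<le> p" "\<sigma> \<in> G" "\<And>y. y \<in> \<O> \<Longrightarrow> \<sigma> y - y \<in> P" "x \<in> \<O>"
  shows "\<exists>w\<in>\<O>. dickson p x - dickson p (\<sigma> x) = of_nat p * w"
proof -
  define z where "z = x - \<sigma> x"
  have sx: "\<sigma> x \<in> \<O>" using assms O_G by blast
  have z: "z \<in> \<O>" unfolding z_def using assms sx O_diff by blast
  have "\<tau> z \<in> P" if t: "\<tau> \<in> G" for \<tau>
  proof -
    have "\<tau> z = - (\<sigma> (\<tau> x) - \<tau> x)"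
      unfolding z_def using t assms by (simp add: G_diff O_K sx G_comm)
    then show ?thesis using assms(4)[OF O_G[OF t assms(5)]] P_minus by metis
  qed
  then obtain w where w: "w \<in> \<O>" "z ^ card G = of_nat p * w"
    using power_card_conjugates_in_P[OF z] by blast
  have "z ^ p = z ^ card G * z ^ (p - card G)" using assms(2) by (simp flip: power_add)
  then have zp: "z ^ p = of_nat p * (w * z ^ (p - card G))" using w by simp
  obtain c where c: "c \<in> \<O>" "(z + \<sigma> x) ^ p = z ^ p + \<sigma> x ^ p + of_nat p * c"
    using freshman[OF prime_p z sx] by blast
  obtain c1 where c1: "c1 \<in> \<O>" "dickson p x = x ^ p + of_nat p * c1"
    using dickson_cong_power[OF prime_p assms(1,5)] by blast
  obtain c2 where c2: "c2 \<in> \<O>" "dickson p (\<sigma> x) = \<sigma> x ^ p + of_nat p * c2"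
    using dickson_cong_power[OF prime_p assms(1) sx] by blast
  have "dickson p x - dickson p (\<sigma> x) = of_nat p * (w * z ^ (p - card G) + c + c1 - c2)"
    using c c1 c2 zp by (simp add: z_def algebra_simps)
  moreover have "w * z ^ (p - card G) + c + c1 - c2 \<in> \<O>"
    by (intro O_diff O_add O_mult O_power w c c1 c2 z)
  ultimately show ?thesis by blast
qed

definition inertia_trivial :: bool where
  "inertia_trivial \<longleftrightarrow> (\<forall>\<sigma>\<in>G. (\<forall>y\<in>\<O>. \<sigma> y - y \<in> P) \<longrightarrow> (\<forall>y\<in>K. \<sigma> y = y))"

lemma G_translate_inverse:
  assumes "\<sigma> \<in> G" "\<tau> \<in> G"
  shows "\<exists>\<kappa>\<in>G. \<forall>y\<in>K. \<sigma> y = \<kappa> (\<tau> y)"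
proof -
  obtain \<rho> where r: "\<rho> \<in> G" "\<forall>x\<in>K. \<rho> (\<tau> x) = x" using G_inv[OF assms(2)] by blast
  obtain \<kappa> where k: "\<kappa> \<in> G" "\<forall>x\<in>K. \<kappa> x = \<sigma> (\<rho> x)" using G_comp[OF assms(1) r(1)] by blast
  show ?thesis using r k G_K[OF assms(2)] by (intro bexI[of _ \<kappa>]) auto
qed

lemma G_surj_O:
  assumes "\<tau> \<in> G" "y \<in> \<O>"
  shows "\<exists>y'\<in>\<O>. \<tau> y' = y"
proof -
  obtain \<rho> where r: "\<rho> \<in> G" "\<forall>x\<in>K. \<rho> (\<tau> x) = x" using G_inv[OF assms(1)] by blast
  have "\<tau> (\<rho> y) = y" using r G_comm[OF assms(1) r(1)] O_K[OF assms(2)] by auto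
  then show ?thesis using O_G[OF r(1) assms(2)] by blast
qed

text \<open>Two automorphisms congruent modulo \<open>P\<close> differ by an element of the inertia
  group.\<close>

lemma inertia_trivial_distinct:
  assumes "inertia_trivial" "\<sigma> \<in> G" "\<tau> \<in> G" "\<sigma> \<noteq> \<tau>"
  shows "\<exists>y\<in>\<O>. \<sigma> y - \<tau> y \<notin> P"
proof (rule ccontr)
  assume "\<not> ?thesis"
  then have *: "\<And>y. y \<in> \<O> \<Longrightarrow> \<sigma> y - \<tau> y \<in> P" by blast
  obtain \<kappa> where k: "\<kappa> \<in> G" "\<forall>y\<in>K. \<sigma> y = \<kappa> (\<tau> y)" using G_translate_inverse assms by blast
  have "\<kappa> y - y \<in> P" if y: "y \<in> \<O>" for y
  proof -
    obtain y' where y': "y' \<in> \<O>" "\<tau> y' = y" using G_surj_O[OF assms(3) y] by blast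
    show ?thesis using *[OF y'(1)] k(2) y' O_K by auto
  qed
  then have "\<forall>y\<in>K. \<kappa> y = y" using assms(1) k(1) unfolding inertia_trivial_def by blast
  then have "\<forall>y\<in>K. \<sigma> y = \<tau> y" using k(2) G_K[OF assms(3)] by simp
  then show False using G_ext assms by blast
qed

text \<open>Raising to the p-th power is injective on O/P, a domain of characteristic p.\<close>

lemma power_p_diff_in_P:
  assumes "a \<in> \<O>" "b \<in> \<O>" "a ^ p - b ^ p \<in> P"
  shows "a - b \<in> P"
proof -
  obtain c where c: "c \<in> \<O>" "(a - b + b) ^ p = (a - b) ^ p + b ^ p + of_nat p * c"
    using freshman[OF prime_p O_diff[OF assms(1,2)] assms(2)] by blast
  then have "(a - b) ^ p = (a ^ p - b ^ p) - of_nat p * c" by simp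
  then have "(a - b) ^ p \<in> P" using assms(3) c(1) P_diff P_p by metis
  then show ?thesis using P_power O_diff assms by blast
qed

text \<open>Without a Frobenius element the characters y -> sigma y and y -> (sigma y)^p, for all
  sigma in \<open>G\<close>, would be pairwise distinct modulo \<open>P\<close>. The trace of y is a
  rational integer, so Fermat's little theorem gives tr(y)^p = tr(y) modulo p, which is a nontrivial
  linear relation among these characters and contradicts independence. No structure theory of the
  residue field enters.\<close>

lemma exists_frobenius:
  assumes "inertia_trivial"
  shows "\<exists>\<phi>\<in>G. \<forall>y\<in>\<O>. y ^ p - \<phi> y \<in> P"
proof (rule ccontr)
  assume nofrob: "\<not> ?thesis"
  \<comment> \<open>The flag separates the two families: \<open>True\<close> stands for the p-th
    power of an automorphism, with coefficient 1 in \<open>c\<close>, and \<open>False\<close> for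
    the automorphism itself, with coefficient -1.\<close>
  define h where "h s y = (if snd s then fst s y ^ p else fst s y)"
    for s :: "(complex \<Rightarrow> complex) \<times> bool" and y
  define c :: "(complex \<Rightarrow> complex) \<times> bool \<Rightarrow> complex" where "c s = (if snd s then 1 else - 1)" for s
  have mixed: "\<exists>y\<in>\<O>. \<sigma> y ^ p - \<tau> y \<notin> P" if st: "\<sigma> \<in> G" "\<tau> \<in> G" for \<sigma> \<tau>
  proof -
    obtain \<kappa> where k: "\<kappa> \<in> G" "\<forall>y\<in>K. \<tau> y = \<kappa> (\<sigma> y)" using G_translate_inverse st by blast
    then obtain y where y: "y \<in> \<O>" "y ^ p - \<kappa> y \<notin> P" using nofrob by blast
    obtain y' where y': "y' \<in> \<O>" "\<sigma> y' = y" using G_surj_O[OF st(1) y(1)] by blast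
    show ?thesis using y k(2) y' O_K by (intro bexI[of _ y']) auto
  qed
  obtain \<iota> where i: "\<iota> \<in> G" using G_id by blast
  have "c (\<iota>, True) \<in> P"
  proof (rule independence_of_characters[of "G \<times> UNIV" h c "(\<iota>, True)"])
    fix s t :: "(complex \<Rightarrow> complex) \<times> bool"
    assume s: "s \<in> G \<times> UNIV" and t: "t \<in> G \<times> UNIV" and st: "s \<noteq> t"
    obtain \<sigma> a \<tau> b where e: "s = (\<sigma>, a)" "t = (\<tau>, b)" by (metis surj_pair)
    have g: "\<sigma> \<in> G" "\<tau> \<in> G" using s t e by auto
    consider "a = b" "\<sigma> \<noteq> \<tau>" | "a" "\<not> b" | "\<not> a" "b" using st e by auto
    then show "\<exists>y\<in>\<O>. h s y - h t y \<notin> P"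
    proof cases
      case 1
      obtain y where y: "y \<in> \<O>" "\<sigma> y - \<tau> y \<notin> P"
        using inertia_trivial_distinct[OF assms g 1(2)] by blast
      then have "\<sigma> y ^ p - \<tau> y ^ p \<notin> P" using power_p_diff_in_P O_G g by blast
      then show ?thesis using y 1 by (auto simp: h_def e)
    next
      case 2
      then show ?thesis using mixed[OF g] by (simp add: h_def e)
    next
      case 3
      obtain y where y: "y \<in> \<O>" "\<tau> y ^ p - \<sigma> y \<notin> P" using mixed[OF g(2,1)] by blast
      then have "\<sigma> y - \<tau> y ^ p \<notin> P" using P_minus by (metis minus_diff_eq)
      then show ?thesis using y 3 by (auto simp: h_def e)
    qed
  next
    fix y assume y: "y \<in> \<O>"
    have yO: "\<And>\<sigma>. \<sigma> \<in> G \<Longrightarrow> \<sigma> y \<in> \<O>" using O_G y by blast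
    obtain e where e: "e \<in> \<O>" "tr y ^ p = (\<Sum>\<sigma>\<in>G. \<sigma> y ^ p) + of_nat p * e"
      using freshman_sum[OF prime_p finite_G, of "\<lambda>\<sigma>. \<sigma> y"] yO by (auto simp: tr_def)
    obtain k where k: "tr y = of_int k" using tr_int[OF y] by blast
    have "(\<Sum>s\<in>G \<times> UNIV. c s * h s y) = (\<Sum>\<sigma>\<in>G. \<Sum>b\<in>UNIV. c (\<sigma>, b) * h (\<sigma>, b) y)"
      by (simp add: sum.cartesian_product split_def)
    also have "\<dots> = (\<Sum>\<sigma>\<in>G. \<sigma> y ^ p) - tr y"
      by (simp add: UNIV_bool c_def h_def tr_def sum_subtractf)
    also have "\<dots> = of_int (k ^ p - k) - of_nat p * e"
      using e k by (simp add: algebra_simps)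
    also have "\<dots> \<in> P"
      by (intro P_diff P_p e) (simp only: P_of_int prime_dvd_power_diff[OF prime_p])
    finally show "(\<Sum>s\<in>G \<times> UNIV. c s * h s y) \<in> P" .
  next
    fix s :: "(complex \<Rightarrow> complex) \<times> bool" assume "s \<in> G \<times> UNIV"
    then have s: "fst s \<in> G" by auto
    show "h s 1 = 1" using G_one[OF s] by (simp add: h_def)
    show "c s \<in> \<O>" using O_1 O_minus[OF O_1] by (simp add: c_def)
    fix x assume x: "x \<in> \<O>"
    show "h s x \<in> \<O>" using O_G[OF s x] O_power[OF O_G[OF s x]] by (simp add: h_def)
    fix y assume y: "y \<in> \<O>"
    show "h s (x * y) = h s x * h s y"
      using G_mult[OF s O_K[OF x] O_K[OF y]] by (simp add: h_def power_mult_distrib)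
  next
    show "(\<iota>, True) \<in> G \<times> UNIV" using i by simp
    show "finite (G \<times> (UNIV :: bool set))" using finite_G by simp
  qed
  then show False using one_P by (simp add: c_def)
qed

section \<open>The trace form and norms in the unramified case\<close>

lemma det_in_O:
  assumes "A \<in> carrier_mat n n" "\<And>i j. i < n \<Longrightarrow> j < n \<Longrightarrow> A $$ (i, j) \<in> \<O>"
  shows "det A \<in> \<O>"
  unfolding det_def'[OF assms(1)]
proof (intro O_sum O_mult O_prod)
  fix q :: "nat \<Rightarrow> nat"
  show "signof q \<in> \<O>" using O_1 O_minus[OF O_1] by (simp add: sign_def)
  fix i assume "q \<in> {q. q permutes {0..<n}}" "i \<in> {0..<n}"
  then show "A $$ (i, q i) \<in> \<O>" using assms(2) by (auto simp: permutes_in_image)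
qed

text \<open>Columns are added one at a time. Expanding along the new column gives a combination of
  characters in which the coefficient of \<open>b k\<close> is the previous determinant, outside
  \<open>P\<close>; independence of characters supplies a column entry \<open>u\<close> for which
  the combination stays outside \<open>P\<close>.\<close>

lemma exists_independent_conjugates:
  assumes triv: "inertia_trivial" and b: "inj_on b {..<n}" "\<And>i. i < n \<Longrightarrow> b i \<in> G" and "k \<le> n"
  shows "\<exists>y. (\<forall>j. y j \<in> \<O>) \<and> det (mat k k (\<lambda>(i, j). b i (y j))) \<notin> P"
  using \<open>k \<le> n\<close>
proof (induction k)
  case 0
  then show ?case using one_P by (intro exI[of _ "\<lambda>_. 0"]) (auto simp: O_0)
next
  case (Suc k)
  then obtain y where y: "\<And>j. y j \<in> \<O>" "det (mat k k (\<lambda>(i, j). b i (y j))) \<notin> P" by auto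
  \<comment> \<open>The cofactors along column \<open>k\<close> do not involve \<open>u\<close>, so
    those of \<open>A 0\<close> serve for every choice of \<open>u\<close>.\<close>
  define A where "A u = mat (Suc k) (Suc k) (\<lambda>(i, j). b i (if j = k then u else y j))" for u
  define c where "c i = cofactor (A 0) i k" for i
  have Ac: "A u \<in> carrier_mat (Suc k) (Suc k)" for u by (simp add: A_def)
  have bO: "b i (y j) \<in> \<O>" if "i < n" for i j
    using O_G[OF b(2)[OF that] y(1)] .
  have cO: "c i \<in> \<O>" if i: "i < Suc k" for i
  proof -
    have "det (mat_delete (A 0) i k) \<in> \<O>"
    proof (rule det_in_O)
      show "mat_delete (A 0) i k \<in> carrier_mat k k" using mat_delete_carrier[OF Ac] by simp
      fix r s assume "r < k" "s < k"
      then show "mat_delete (A 0) i k $$ (r, s) \<in> \<O>"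
        using bO Suc.prems by (auto simp: mat_delete_def A_def)
    qed
    moreover have "(- 1) ^ (i + k) \<in> \<O>" by (intro O_power O_minus O_1)
    ultimately show ?thesis unfolding c_def cofactor_def by (rule O_mult[rotated])
  qed
  have del: "mat_delete (A u) i k = mat_delete (A 0) i k" for u i
    by (rule eq_matI) (auto simp: mat_delete_def A_def)
  have "mat_delete (A 0) k k = mat k k (\<lambda>(i, j). b i (y j))"
    by (rule eq_matI) (auto simp: mat_delete_def A_def)
  then have "c k \<notin> P" using y(2) by (simp add: c_def cofactor_def)
  have "\<exists>u\<in>\<O>. (\<Sum>i\<in>{..<Suc k}. c i * b i u) \<notin> P"
  proof (rule ccontr)
    assume *: "\<not> ?thesis"
    have "c k \<in> P"
    proof (rule independence_of_characters[of "{..<Suc k}" b c k])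
      fix s t assume "s \<in> {..<Suc k}" "t \<in> {..<Suc k}" "s \<noteq> t"
      then have "b s \<noteq> b t" "b s \<in> G" "b t \<in> G"
        using b Suc.prems by (auto simp: inj_on_def)
      then show "\<exists>y\<in>\<O>. b s y - b t y \<notin> P" using inertia_trivial_distinct[OF triv] by blast
    next
      fix s assume "s \<in> {..<Suc k}"
      then have s: "s < Suc k" and g: "b s \<in> G" using b(2) Suc.prems by auto
      show "b s 1 = 1" using G_one[OF g] .
      show "c s \<in> \<O>" using cO[OF s] .
      fix x assume x: "x \<in> \<O>"
      show "b s x \<in> \<O>" using O_G[OF g x] .
      fix y assume y: "y \<in> \<O>"
      show "b s (x * y) = b s x * b s y" using G_mult[OF g O_K[OF x] O_K[OF y]] .
    next
      fix y assume "y \<in> \<O>"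
      then show "(\<Sum>s\<in>{..<Suc k}. c s * b s y) \<in> P" using * by blast
    qed auto
    with \<open>c k \<notin> P\<close> show False by blast
  qed
  then obtain u where u: "u \<in> \<O>" "(\<Sum>i\<in>{..<Suc k}. c i * b i u) \<notin> P" by blast
  have "det (A u) = (\<Sum>i<Suc k. A u $$ (i, k) * cofactor (A u) i k)"
    by (rule laplace_expansion_column[OF Ac]) simp
  also have "\<dots> = (\<Sum>i<Suc k. c i * b i u)"
    by (intro sum.cong refl) (simp add: c_def cofactor_def del[of u], simp add: A_def)
  finally have "det (A u) \<notin> P" using u(2) by simp
  then show ?case
    using u y by (intro exI[of _ "\<lambda>j. if j = k then u else y j"]) (auto simp: A_def)
qed

lemma det_int:
  assumes "\<And>i j. i < n \<Longrightarrow> j < n \<Longrightarrow> f i j = of_int (g i j)"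
  shows "det (mat n n (\<lambda>(i, j). f i j)) = (of_int (det (mat n n (\<lambda>(i, j). g i j))) :: complex)"
proof -
  have "mat n n (\<lambda>(i, j). f i j) = map_mat of_int (mat n n (\<lambda>(i, j). g i j))"
    using assms by (intro eq_matI) auto
  then show ?thesis by (simp add: of_int_hom.hom_det)
qed

text \<open>
  With trivial inertia the trace form is nondegenerate modulo \<open>p\<close>, and \<open>Tr (w y)\<close> is divisible
  by \<open>p\<close> for all \<open>y\<close> in \<open>\<O>\<close>.
\<close>

lemma nrm_divisible_if_inertia_trivial:
  assumes triv: "inertia_trivial" and w: "w \<in> \<O>" "\<And>\<tau>. \<tau> \<in> G \<Longrightarrow> \<tau> w \<in> P"
  shows "\<exists>k. nrm w = of_nat p ^ card G * of_int k"
proof -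
  define n where "n = card G"
  obtain b where b: "bij_betw b {..<n} G"
    using ex_bij_betw_nat_finite[OF finite_G] by (auto simp: atLeast0LessThan n_def)
  have inj: "inj_on b {..<n}" and bG: "\<And>i. i < n \<Longrightarrow> b i \<in> G"
    using b by (auto simp: bij_betw_def)
  obtain y where y: "\<And>j. y j \<in> \<O>" "det (mat n n (\<lambda>(i, j). b i (y j))) \<notin> P"
    using exists_independent_conjugates[OF triv inj bG order.refl] by blast
  \<comment> \<open>With D the diagonal matrix of the conjugates of w, the products A^T A and A^T D
    A have the integer entries tr(y_i y_j) and tr(w y_i y_j), the latter all divisible by p. Their
    determinants are det(A)^2, prime to p, and nrm(w) det(A)^2, divisible by p^n.\<close>
  define A where "A = mat n n (\<lambda>(i, j). b i (y j))"
  define D where "D = mat n n (\<lambda>(i, j). if i = j then b i w else 0)"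
  have A: "A \<in> carrier_mat n n" and D: "D \<in> carrier_mat n n" by (simp_all add: A_def D_def)
  note AT = transpose_carrier_mat[THEN iffD2, OF A]
  have dO: "det A \<in> \<O>"
    by (rule det_in_O[OF A]) (simp add: A_def O_G[OF bG y(1)])
  have sumb: "(\<Sum>i<n. b i x) = tr x" for x
    unfolding tr_def using sum.reindex_bij_betw[OF b, of "\<lambda>\<sigma>. \<sigma> x"] by simp
  have ATA: "transpose_mat A * A = mat n n (\<lambda>(i, j). tr (y i * y j))"
  proof (rule eq_matI)
    fix i j assume "i < dim_row (mat n n (\<lambda>(i, j). tr (y i * y j)))"
      "j < dim_col (mat n n (\<lambda>(i, j). tr (y i * y j)))"
    then have ij: "i < n" "j < n" by auto
    then have "(transpose_mat A * A) $$ (i, j) = (\<Sum>l<n. b l (y i) * b l (y j))"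
      by (simp add: A_def scalar_prod_def atLeast0LessThan)
    also have "\<dots> = (\<Sum>l<n. b l (y i * y j))"
      by (intro sum.cong refl) (simp add: G_mult[OF bG] O_K[OF y(1)])
    finally show "(transpose_mat A * A) $$ (i, j) = mat n n (\<lambda>(i, j). tr (y i * y j)) $$ (i, j)"
      using ij by (simp add: sumb)
  qed (auto simp: A_def)
  have DA: "D * A = mat n n (\<lambda>(i, j). b i w * b i (y j))"
  proof (rule eq_matI)
    fix i j assume "i < dim_row (mat n n (\<lambda>(i, j). b i w * b i (y j)))"
      "j < dim_col (mat n n (\<lambda>(i, j). b i w * b i (y j)))"
    then have ij: "i < n" "j < n" by auto
    then have "(D * A) $$ (i, j) = (\<Sum>l<n. (if i = l then b i w else 0) * b l (y j))"
      by (simp add: A_def D_def scalar_prod_def atLeast0LessThan)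
    also have "\<dots> = (\<Sum>l<n. if l = i then b i w * b i (y j) else 0)"
      by (intro sum.cong refl) auto
    finally show "(D * A) $$ (i, j) = mat n n (\<lambda>(i, j). b i w * b i (y j)) $$ (i, j)"
      using ij by simp
  qed (auto simp: A_def D_def)
  have ATDA: "transpose_mat A * (D * A) = mat n n (\<lambda>(i, j). tr (w * (y i * y j)))"
    unfolding DA
  proof (rule eq_matI)
    fix i j assume "i < dim_row (mat n n (\<lambda>(i, j). tr (w * (y i * y j))))"
      "j < dim_col (mat n n (\<lambda>(i, j). tr (w * (y i * y j))))"
    then have ij: "i < n" "j < n" by auto
    then have "(transpose_mat A * mat n n (\<lambda>(i, j). b i w * b i (y j))) $$ (i, j) =
        (\<Sum>l<n. b l (y i) * (b l w * b l (y j)))"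
      by (simp add: A_def scalar_prod_def atLeast0LessThan)
    also have "\<dots> = (\<Sum>l<n. b l (w * (y i * y j)))"
      by (intro sum.cong refl) (simp add: G_mult[OF bG] O_K[OF y(1)] O_K[OF w(1)] mult_K)
    finally show "(transpose_mat A * mat n n (\<lambda>(i, j). b i w * b i (y j))) $$ (i, j) =
        mat n n (\<lambda>(i, j). tr (w * (y i * y j))) $$ (i, j)"
      using ij by (simp add: sumb)
  qed (auto simp: A_def)
  have "upper_triangular D" by (auto simp: upper_triangular_def D_def)
  then have "det D = prod_list (diag_mat D)" using det_upper_triangular D by blast
  also have "\<dots> = (\<Prod>i<n. b i w)"
    by (simp add: prod_list_diag_prod D_def atLeast0LessThan)
  also have "\<dots> = nrm w" unfolding nrm_def using prod.reindex_bij_betw[OF b, of "\<lambda>\<sigma>. \<sigma> w"] by simp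
  finally have detD: "det D = nrm w" .
  have "\<exists>k. tr (y i * y j) = of_int k" for i j using tr_int O_mult y(1) by blast
  then obtain s where s: "\<And>i j. tr (y i * y j) = of_int (s i j)" by metis
  have "\<exists>k. tr (w * (y i * y j)) = of_int (int p * k)" for i j
  proof -
    have x: "w * (y i * y j) \<in> \<O>" using w(1) y(1) O_mult by blast
    then obtain k where k: "tr (w * (y i * y j)) = of_int k" using tr_int by blast
    have "tr (w * (y i * y j)) \<in> P"
      unfolding tr_def
    proof (rule P_sum)
      fix \<sigma> assume "\<sigma> \<in> G"
      then show "\<sigma> (w * (y i * y j)) \<in> P"
        using G_mult[of \<sigma> w "y i * y j"] w O_K y(1) O_mult P_mult' O_G by simp
    qed
    then have "int p dvd k" using k P_of_int by simp
    then show ?thesis using k by (auto elim!: dvdE)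
  qed
  then obtain t where t: "\<And>i j. tr (w * (y i * y j)) = of_int (int p * t i j)" by metis
  let ?s = "det (mat n n (\<lambda>(i, j). s i j))" and ?t = "det (mat n n (\<lambda>(i, j). t i j))"
  have 1: "det A * det A = of_int ?s"
    using det_mult[OF AT A] det_transpose[OF A] det_int[of n "\<lambda>i j. tr (y i * y j)" s] s
    unfolding ATA by simp
  have "mat n n (\<lambda>(i, j). int p * t i j) = int p \<cdot>\<^sub>m mat n n (\<lambda>(i, j). t i j)"
    by (rule eq_matI) auto
  then have "det (mat n n (\<lambda>(i, j). int p * t i j)) = int p ^ n * ?t" by simp
  then have 2: "det A * (nrm w * det A) = of_int (int p ^ n * ?t)"
    using det_mult[OF AT mult_carrier_mat[OF D A]] det_transpose[OF A] det_mult[OF D A] detD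
      det_int[of n "\<lambda>i j. tr (w * (y i * y j))" "\<lambda>i j. int p * t i j"] t
    unfolding ATDA by simp
  have "det A * det A \<notin> P" using prime_P[OF dO dO] y(2) by (auto simp: A_def)
  then have "\<not> int p dvd ?s" using 1 P_of_int by simp
  then have cop: "coprime (int p ^ n) ?s" using prime_p by (simp add: prime_imp_coprime)
  obtain k where k: "nrm w = of_int k" using nrm_int[OF w(1)] by blast
  have "of_int (k * ?s) = (of_int (int p ^ n * ?t) :: complex)"
    unfolding of_int_mult 1[symmetric] k[symmetric] using 2 by (simp add: mult_ac)
  then have "k * ?s = int p ^ n * ?t" by (simp only: of_int_eq_iff)
  then have "int p ^ n dvd k * ?s" by simp
  then have "int p ^ n dvd k" using cop by (simp add: coprime_dvd_mult_left_iff)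
  then obtain j where "k = int p ^ n * j" by (elim dvdE)
  then show ?thesis using k by (auto simp: n_def)
qed

text \<open>In the unramified case the Frobenius congruence applied to tau x, together with the
  commutation of phi and tau, places every conjugate of D_p(x) - phi x in \<open>P\<close>. In the
  ramified case the difference is p times an algebraic integer, whose norm carries p^d
  outright.\<close>

lemma nrm_divisible_cases:
  assumes "odd p" "card G \<le> p" "x \<in> \<O>"
  shows "(\<exists>\<phi>\<in>G. \<exists>k. nrm (dickson p x - \<phi> x) = of_nat p ^ card G * of_int k) \<or>
    (\<exists>\<sigma>\<in>G. (\<exists>y\<in>K. \<sigma> y \<noteq> y) \<and>
      (\<exists>k. nrm (dickson p x - dickson p (\<sigma> x)) = of_nat p ^ card G * of_int k))"
proof (cases inertia_trivial)
  case True
  obtain \<phi> where f: "\<phi> \<in> G" "\<forall>y\<in>\<O>. y ^ p - \<phi> y \<in> P" using exists_frobenius[OF True] by blast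
  have "\<exists>k. nrm (dickson p x - \<phi> x) = of_nat p ^ card G * of_int k"
  proof (rule nrm_divisible_if_inertia_trivial[OF True])
    show "dickson p x - \<phi> x \<in> \<O>" using O_diff O_dickson assms(3) O_G[OF f(1)] by blast
    fix \<tau> assume t: "\<tau> \<in> G"
    have tx: "\<tau> x \<in> \<O>" using O_G[OF t assms(3)] .
    obtain c where c: "c \<in> \<O>" "dickson p (\<tau> x) = \<tau> x ^ p + of_nat p * c"
      using dickson_cong_power[OF prime_p assms(1) tx] by blast
    have "\<tau> (dickson p x - \<phi> x) = dickson p (\<tau> x) - \<phi> (\<tau> x)"
      using G_diff[OF t, of "dickson p x" "\<phi> x"] G_dickson[OF t O_K[OF assms(3)]]
        G_K[OF f(1) O_K[OF assms(3)]] G_comm[OF t f(1) O_K[OF assms(3)]] by simp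
    also have "\<dots> = (\<tau> x ^ p - \<phi> (\<tau> x)) + of_nat p * c" using c by simp
    also have "\<dots> \<in> P" using f(2) tx P_add P_p[OF c(1)] by blast
    finally show "\<tau> (dickson p x - \<phi> x) \<in> P" .
  qed
  then show ?thesis using f(1) by blast
next
  case False
  then obtain \<sigma> where s: "\<sigma> \<in> G" "\<forall>y\<in>\<O>. \<sigma> y - y \<in> P" "\<exists>y\<in>K. \<sigma> y \<noteq> y"
    unfolding inertia_trivial_def by blast
  obtain w where w: "w \<in> \<O>" "dickson p x - dickson p (\<sigma> x) = of_nat p * w"
    using dickson_cong_if_inertia[OF assms(1,2) s(1) _ assms(3)] s(2) by blast
  obtain k where "nrm w = of_int k" using nrm_int[OF w(1)] by blast
  then have "nrm (dickson p x - dickson p (\<sigma> x)) = of_nat p ^ card G * of_int k"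
    using w nrm_mult[OF of_nat_K O_K[OF w(1)]] by (simp add: nrm_of_nat)
  then show ?thesis using s by blast
qed

end

theorem (in abelian_galois) frobenius_or_inertia:
  assumes "prime p" "odd p" "card G \<le> p" "x \<in> \<O>"
  shows "(\<exists>\<phi>\<in>G. \<exists>k. nrm (dickson p x - \<phi> x) = of_nat p ^ card G * of_int k) \<or>
    (\<exists>\<sigma>\<in>G. (\<exists>y\<in>K. \<sigma> y \<noteq> y) \<and>
      (\<exists>k. nrm (dickson p x - dickson p (\<sigma> x)) = of_nat p ^ card G * of_int k))"
proof -
  obtain P where P: "ideal_K P" "of_nat p \<in> P" "1 \<notin> P"
    "\<forall>a\<in>\<O>. \<forall>b\<in>\<O>. a * b \<in> P \<longrightarrow> a \<in> P \<or> b \<in> P"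
    using exists_prime_ideal[OF assms(1)] by blast
  interpret abelian_galois_prime K G p P
    using P assms(1) by unfold_locales blast+
  show ?thesis using nrm_divisible_cases assms by blast
qed

section \<open>Bounding the Galois group\<close>

lemma dickson_of_real: "dickson n (of_real r :: complex) = of_real (dickson n r)"
  by (induction n r rule: dickson.induct) simp_all

lemma dickson_cos: "dickson n (2 * cos \<theta> :: real) = 2 * cos (real n * \<theta>)"
proof (induction n rule: induct_nat_012)
  case (ge2 n)
  have "cos (real (Suc (Suc n)) * \<theta>) + cos (real n * \<theta>) = 2 * cos \<theta> * cos (real (Suc n) * \<theta>)"
    using cos_add[of "real (Suc n) * \<theta>" \<theta>] cos_diff[of "real (Suc n) * \<theta>" \<theta>]
    by (simp add: algebra_simps)
  then show ?case using ge2 by (simp add: algebra_simps)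
qed simp_all

lemma abs_dickson_le_2:
  assumes "\<bar>r\<bar> \<le> (2 :: real)"
  shows "\<bar>dickson n r\<bar> \<le> 2"
proof -
  have "r = 2 * cos (arccos (r / 2))" using assms by (subst cos_arccos) auto
  then have "dickson n r = 2 * cos (real n * arccos (r / 2))" using dickson_cos by metis
  then show ?thesis using abs_cos_le_one[of "real n * arccos (r / 2)"] by (simp add: abs_mult)
qed

text \<open>The shift by 2 fits arguments of the form beta - 2 with beta at most \<open>C\<close>;
  each step of the recursion then costs a factor (C - 2) + 1, which is below
  \<open>C\<close>.\<close>

lemma abs_dickson_le:
  assumes "\<bar>r\<bar> \<le> C - 2" "C \<ge> (2 :: real)"
  shows "\<bar>dickson n r\<bar> \<le> 2 * C ^ n"
proof (induction n rule: induct_nat_012)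
  case (ge2 n)
  have "\<bar>dickson (Suc (Suc n)) r\<bar> \<le> \<bar>r\<bar> * \<bar>dickson (Suc n) r\<bar> + \<bar>dickson n r\<bar>"
    using abs_triangle_ineq4[of "r * dickson (Suc n) r" "dickson n r"] by (simp add: abs_mult)
  also have "\<dots> \<le> (C - 2) * (2 * C ^ Suc n) + 2 * C ^ n"
    using ge2 assms by (intro add_mono mult_mono) auto
  also have "\<dots> \<le> (C - 2) * (2 * C ^ Suc n) + 2 * C ^ Suc n"
    using assms by (intro add_left_mono mult_left_mono power_increasing) auto
  also have "\<dots> = (C - 1) * (2 * C ^ Suc n)" by (simp add: algebra_simps)
  also have "\<dots> \<le> C * (2 * C ^ Suc n)" using assms by (intro mult_right_mono) auto
  finally show ?case by simp
qed (use assms in auto)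

lemma add_inverse_strict_mono:
  assumes "1 \<le> u" "u < (v :: real)"
  shows "u + inverse u < v + inverse v"
proof -
  have "1 * v \<le> u * v" using assms by (intro mult_right_mono) auto
  then have uv: "u * v > 1" using assms by linarith
  have nz: "u \<noteq> 0" "v \<noteq> 0" using assms by auto
  have "(v + inverse v) - (u + inverse u) = (v - u) * (u * v - 1) / (u * v)"
    using nz by (simp add: divide_simps) (simp add: algebra_simps)
  also have "\<dots> > 0" using assms uv by (intro divide_pos_pos mult_pos_pos) auto
  finally show ?thesis by simp
qed

lemma eq_add_inverse:
  assumes "(r :: real) \<ge> 2"
  obtains t where "t \<ge> 1" "r = t + inverse t"
proof
  define s where "s = sqrt (r ^ 2 - 4)"
  have s0: "s \<ge> 0" and s: "s ^ 2 = r ^ 2 - 4"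
    using assms power_mono[of 2 r 2] by (auto simp: s_def)
  show t: "(r + s) / 2 \<ge> 1" using assms s0 by simp
  have "(r + s) / 2 * ((r - s) / 2) = 1" using s by (simp add: field_simps power2_eq_square)
  then have "inverse ((r + s) / 2) = (r - s) / 2" by (rule inverse_unique)
  then show "r = (r + s) / 2 + inverse ((r + s) / 2)" by (simp add: field_simps)
qed

text \<open>Under the substitution t + 1/t with t >= 1 the claim reduces to the monotonicity of t^n
  and of t + 1/t.\<close>

lemma dickson_strict_mono:
  assumes "2 \<le> s" "s < (r :: real)" "n > 0"
  shows "dickson n s < dickson n r"
proof -
  obtain u where u: "u \<ge> 1" "s = u + inverse u" using eq_add_inverse[OF assms(1)] by blast
  obtain v where v: "v \<ge> 1" "r = v + inverse v" using eq_add_inverse[of r] assms by auto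
  have "u < v"
  proof (rule ccontr)
    assume "\<not> u < v"
    then consider "u = v" | "v < u" by linarith
    then show False using add_inverse_strict_mono[of v u] u v assms by cases auto
  qed
  then have "u ^ n < v ^ n" using u assms(3) by (intro power_strict_mono) auto
  then have "u ^ n + inverse (u ^ n) < v ^ n + inverse (v ^ n)"
    using u by (intro add_inverse_strict_mono) auto
  then show ?thesis
    using dickson_add_inverse[of u n] dickson_add_inverse[of v n] u v by (simp add: power_inverse)
qed

lemma dickson_two: "dickson n (2 :: real) = 2"
  by (induction n rule: induct_nat_012) auto

lemma dickson_gt_2: "2 < (r :: real) \<Longrightarrow> n > 0 \<Longrightarrow> dickson n r > 2"
  using dickson_strict_mono[of 2 r n] by (simp add: dickson_two)

text \<open>Ensures that D_p(x) - phi x is nonzero in the Frobenius case, as no conjugate of x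
  exceeds x.\<close>

lemma dickson_gt_self:
  assumes "2 < (r :: real)" "n \<ge> 2"
  shows "dickson n r > r"
proof -
  obtain t where t: "t \<ge> 1" "r = t + inverse t" using eq_add_inverse[of r] assms by auto
  have "t > 1" using t assms by (cases "t = 1") auto
  then have "t ^ 1 < t ^ n" using assms by (intro power_strict_increasing) auto
  then have "t + inverse t < t ^ n + inverse (t ^ n)"
    using t by (intro add_inverse_strict_mono) auto
  then show ?thesis using dickson_add_inverse[of t n] t by (simp add: power_inverse)
qed

text \<open>Ensures that D_p(x) - D_p(sigma x) is nonzero in the inertia case, where sigma moves x
  to a smaller conjugate.\<close>

lemma abs_dickson_less:
  assumes "- 2 \<le> s" "s < (r :: real)" "2 < r" "n > 0"
  shows "\<bar>dickson n s\<bar> < dickson n r"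
proof (cases "s \<le> 2")
  case True
  then have "\<bar>dickson n s\<bar> \<le> 2" using assms by (intro abs_dickson_le_2) auto
  then show ?thesis using dickson_gt_2[of r n] assms by linarith
next
  case False
  then show ?thesis using dickson_gt_2[of s n] dickson_strict_mono[of s r n] assms by auto
qed

context abelian_galois begin

text \<open>For all but at most 2k automorphisms both terms of the conjugate difference have
  absolute value at most 2, giving a factor 4; the others give at most 4 C^p each. The resulting
  bound on the norm is compared with p^d, which divides this nonzero integer.\<close>

lemma prime_power_bound:
  assumes p: "prime p" "odd p" "card G \<le> p"
    and b: "b \<in> \<O>" "b = of_real \<beta>" "\<beta> > 4"
    and real: "\<And>\<sigma>. \<sigma> \<in> G \<Longrightarrow> \<exists>r. \<sigma> b = of_real r \<and> 0 \<le> r \<and> r \<le> \<beta>"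
    and faithful: "\<And>\<sigma>. \<sigma> \<in> G \<Longrightarrow> \<sigma> b = b \<Longrightarrow> \<forall>y\<in>K. \<sigma> y = y"
    and card: "card {\<sigma> \<in> G. Re (\<sigma> b) > 4} \<le> k"
    and C: "\<beta> \<le> C"
  shows "real p ^ card G \<le> 4 ^ card G * C ^ (2 * k * p)"
proof -
  define x where "x = b - 2"
  define r where "r \<sigma> = Re (\<sigma> b) - 2" for \<sigma>
  have two: "2 \<in> \<O>" using O_of_int[of 2] by simp
  have x: "x \<in> \<O>" unfolding x_def using b two O_diff by blast
  have C4: "C > 4" using b C by linarith
  have r: "\<sigma> x = of_real (r \<sigma>)" "- 2 \<le> r \<sigma>" "r \<sigma> \<le> \<beta> - 2" if s: "\<sigma> \<in> G" for \<sigma>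
  proof -
    obtain q where q: "\<sigma> b = of_real q" "0 \<le> q" "q \<le> \<beta>" using real[OF s] by blast
    have "\<sigma> 2 = 2" using G_of_int[OF s, of 2] by simp
    then show "\<sigma> x = of_real (r \<sigma>)" "- 2 \<le> r \<sigma>" "r \<sigma> \<le> \<beta> - 2"
      unfolding x_def r_def using G_diff[OF s O_K[OF b(1)] O_K[OF two]] q by simp_all
  qed
  obtain \<iota> where i: "\<iota> \<in> G" "\<forall>y\<in>K. \<iota> y = y" using G_id by blast
  have xr: "x = of_real (\<beta> - 2)" using b by (simp add: x_def)
  have comp: "\<exists>f. bij_betw f G G \<and> (\<forall>\<tau>\<in>G. \<tau> (\<phi> x) = of_real (r (f \<tau>)))" if f: "\<phi> \<in> G" for \<phi>
  proof -
    from G_translate[OF f] obtain f where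
      "bij_betw f G G" "\<forall>\<tau>\<in>G. \<forall>x\<in>K. f \<tau> x = \<phi> (\<tau> x)" by (elim exE conjE)
    then have "\<tau> (\<phi> x) = of_real (r (f \<tau>))" if t: "\<tau> \<in> G" for \<tau>
      using r(1)[OF bij_betw_apply[OF \<open>bij_betw f G G\<close> t]] O_K[OF x] G_comm[OF t f O_K[OF x]] t by metis
    then show ?thesis using \<open>bij_betw f G G\<close> by blast
  qed
  \<comment> \<open>Common to both alternatives: the conjugate of \<open>w\<close> is D_p(r tau) -
    s, where s is r (f tau) in the Frobenius case and D_p(r (f tau)) in the inertia case,
    \<open>f\<close> being translation by phi or sigma.\<close>
  have main: "real p ^ card G \<le> 4 ^ card G * C ^ (2 * k * p)"
    if f: "bij_betw f G G" and w: "w \<in> \<O>" "w \<noteq> 0" "nrm w = of_nat p ^ card G * of_int j"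
      and wr: "\<And>\<tau>. \<tau> \<in> G \<Longrightarrow> \<exists>s. \<tau> w = of_real (dickson p (r \<tau>) - s) \<and>
        (r (f \<tau>) \<le> 2 \<longrightarrow> \<bar>s\<bar> \<le> 2) \<and> \<bar>s\<bar> \<le> 2 * C ^ p" for f w j
  proof -
    define A where "A = {\<tau> \<in> G. r \<tau> > 2}"
    \<comment> \<open>Either term can be large: the first when tau gives a conjugate above 4, the
      second when its translate does. Each happens at most \<open>k\<close> times.\<close>
    define bad where "bad = A \<union> {\<tau> \<in> G. f \<tau> \<in> A}"
    have fin: "finite A" "finite bad" using finite_G by (auto simp: A_def bad_def)
    have cA: "card A \<le> k"
    proof -
      have "A = {\<sigma> \<in> G. Re (\<sigma> b) > 4}" unfolding A_def r_def by auto
      then show ?thesis using card by simp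
    qed
    have "card {\<tau> \<in> G. f \<tau> \<in> A} \<le> card A"
      by (rule card_inj_on_le[of f]) (use f fin in \<open>auto simp: bij_betw_def inj_on_def\<close>)
    then have cbad: "card bad \<le> 2 * k" using card_Un_le[of A "{\<tau> \<in> G. f \<tau> \<in> A}"] cA by (simp add: bad_def)
    have Cp: "C ^ p \<ge> 1" using C4 by (intro one_le_power) auto
    have bound: "cmod (\<tau> w) \<le> 4 * (if \<tau> \<in> bad then C ^ p else 1)" if t: "\<tau> \<in> G" for \<tau>
    proof -
      obtain s where s: "\<tau> w = of_real (dickson p (r \<tau>) - s)"
        "r (f \<tau>) \<le> 2 \<Longrightarrow> \<bar>s\<bar> \<le> 2" "\<bar>s\<bar> \<le> 2 * C ^ p" using wr[OF t] by blast
      have *: "cmod (\<tau> w) \<le> \<bar>dickson p (r \<tau>)\<bar> + \<bar>s\<bar>" unfolding s(1) norm_of_real by linarith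
      show ?thesis
      proof (cases "\<tau> \<in> bad")
        case True
        have "\<bar>dickson p (r \<tau>)\<bar> \<le> 2 * C ^ p" using r[OF t] C C4 by (intro abs_dickson_le) auto
        then show ?thesis using True * s(3) by simp
      next
        case False
        then have "r \<tau> \<le> 2" "r (f \<tau>) \<le> 2"
          using t f by (auto simp: bad_def A_def bij_betw_def)
        then have "\<bar>dickson p (r \<tau>)\<bar> \<le> 2" "\<bar>s\<bar> \<le> 2"
          using r(2)[OF t] s(2) by (auto intro!: abs_dickson_le_2)
        then show ?thesis using False * by simp
      qed
    qed
    have "(\<Prod>\<sigma>\<in>G. cmod (\<sigma> w)) \<le> (\<Prod>\<tau>\<in>G. 4 * (if \<tau> \<in> bad then C ^ p else 1))"
      by (intro prod_mono) (use bound in auto)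
    also have "\<dots> = 4 ^ card G * (\<Prod>\<tau>\<in>G. if \<tau> \<in> bad then C ^ p else 1)"
      by (simp add: prod.distrib)
    also have "(\<Prod>\<tau>\<in>G. if \<tau> \<in> bad then C ^ p else 1) = (C ^ p) ^ card bad"
    proof -
      have "G \<inter> {\<tau>. \<tau> \<in> bad} = bad" by (auto simp: bad_def A_def)
      then show ?thesis using finite_G by (simp add: prod.If_cases)
    qed
    also have "(C ^ p) ^ card bad \<le> (C ^ p) ^ (2 * k)" using cbad Cp by (intro power_increasing) auto
    also have "\<dots> = C ^ (2 * k * p)" by (simp add: power_mult mult.commute flip: power_mult)
    finally have up: "(\<Prod>\<sigma>\<in>G. cmod (\<sigma> w)) \<le> 4 ^ card G * C ^ (2 * k * p)" by simp
    have eq: "(\<Prod>\<sigma>\<in>G. cmod (\<sigma> w)) = real p ^ card G * \<bar>of_int j\<bar>"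
      using arg_cong[OF w(3), of cmod] unfolding nrm_def by (simp add: prod_norm norm_mult norm_power)
    have "(\<Prod>\<sigma>\<in>G. cmod (\<sigma> w)) \<ge> 1" using nrm_ge_1 w by blast
    then have "j \<noteq> 0" using eq by auto
    then have "\<bar>real_of_int j\<bar> \<ge> 1" by linarith
    then have "real p ^ card G * 1 \<le> real p ^ card G * \<bar>of_int j\<bar>" by (intro mult_left_mono) auto
    then show ?thesis using up eq by linarith
  qed
  have p2: "p \<ge> 2" using p prime_ge_2_nat by blast
  have Dx: "dickson p x = of_real (dickson p (\<beta> - 2))" by (simp add: xr dickson_of_real flip: of_real_diff)
  have Dt: "\<tau> (dickson p x) = of_real (dickson p (r \<tau>))" if "\<tau> \<in> G" for \<tau>
    using G_dickson[OF that O_K[OF x]] r(1)[OF that] by (simp add: dickson_of_real)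
  have Dc: "\<bar>dickson n (r \<tau>)\<bar> \<le> 2 * C ^ n" if "\<tau> \<in> G" for \<tau> n
    using r[OF that] C C4 by (intro abs_dickson_le) auto
  have C1: "2 * C ^ 1 \<le> 2 * C ^ p" using C4 p2 by (intro mult_left_mono power_increasing) auto
  from frobenius_or_inertia[OF p x] show ?thesis
  proof (elim disjE bexE conjE exE)
    fix \<phi> j assume f: "\<phi> \<in> G" and N: "nrm (dickson p x - \<phi> x) = of_nat p ^ card G * of_int j"
    obtain f where g: "bij_betw f G G" "\<forall>\<tau>\<in>G. \<tau> (\<phi> x) = of_real (r (f \<tau>))" using comp[OF f] by blast
    show ?thesis
    proof (rule main[OF g(1) _ _ N])
      show "dickson p x - \<phi> x \<in> \<O>" using O_diff O_dickson x O_G[OF f x] by blast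
      have "dickson p (\<beta> - 2) > \<beta> - 2" using b p2 by (intro dickson_gt_self) auto
      then have "dickson p (\<beta> - 2) \<noteq> r \<phi>" using r(3)[OF f] by linarith
      then show "dickson p x - \<phi> x \<noteq> 0"
        unfolding Dx r(1)[OF f] by (simp flip: of_real_diff)
      fix \<tau> assume t: "\<tau> \<in> G"
      have ft: "f \<tau> \<in> G" using g t by (auto simp: bij_betw_def)
      have "\<tau> (dickson p x - \<phi> x) = of_real (dickson p (r \<tau>) - r (f \<tau>))"
        using G_diff[OF t, of "dickson p x" "\<phi> x"] G_dickson[OF f O_K[OF x]] G_K[OF f O_K[OF x]] Dt[OF t] g(2) t
        by simp
      moreover have "\<bar>r (f \<tau>)\<bar> \<le> 2 * C ^ p" using Dc[OF ft, of 1] C1 by simp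
      ultimately show "\<exists>s. \<tau> (dickson p x - \<phi> x) = of_real (dickson p (r \<tau>) - s) \<and>
          (r (f \<tau>) \<le> 2 \<longrightarrow> \<bar>s\<bar> \<le> 2) \<and> \<bar>s\<bar> \<le> 2 * C ^ p"
        using r(2)[OF ft] by (intro exI[of _ "r (f \<tau>)"]) auto
    qed
  next
    fix \<sigma> y j assume f: "\<sigma> \<in> G" and y: "y \<in> K" "\<sigma> y \<noteq> y"
      and N: "nrm (dickson p x - dickson p (\<sigma> x)) = of_nat p ^ card G * of_int j"
    obtain f where g: "bij_betw f G G" "\<forall>\<tau>\<in>G. \<tau> (\<sigma> x) = of_real (r (f \<tau>))" using comp[OF f] by blast
    have sx: "\<sigma> x \<in> \<O>" using O_G[OF f x] .
    have Ds: "dickson p (\<sigma> x) = of_real (dickson p (r \<sigma>))" using r(1)[OF f] by (simp add: dickson_of_real)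
    show ?thesis
    proof (rule main[OF g(1) _ _ N])
      show "dickson p x - dickson p (\<sigma> x) \<in> \<O>" using O_diff O_dickson x sx by blast
      have "\<sigma> b \<noteq> b" using faithful[OF f] y by blast
      then have "Re (\<sigma> b) \<noteq> \<beta>" using real[OF f] b by auto
      then have "r \<sigma> < \<beta> - 2" using r(3)[OF f] by (simp add: r_def)
      then have "\<bar>dickson p (r \<sigma>)\<bar> < dickson p (\<beta> - 2)"
        using r(2)[OF f] b p2 by (intro abs_dickson_less) auto
      then show "dickson p x - dickson p (\<sigma> x) \<noteq> 0"
        unfolding Dx Ds by (simp flip: of_real_diff)
      fix \<tau> assume t: "\<tau> \<in> G"
      have ft: "f \<tau> \<in> G" using g t by (auto simp: bij_betw_def)
      have "\<tau> (dickson p (\<sigma> x)) = of_real (dickson p (r (f \<tau>)))"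
        using G_dickson[OF t O_K[OF sx]] bspec[OF g(2) t] by (simp add: dickson_of_real)
      then have "\<tau> (dickson p x - dickson p (\<sigma> x)) = of_real (dickson p (r \<tau>) - dickson p (r (f \<tau>)))"
        using G_diff[OF t, of "dickson p x" "dickson p (\<sigma> x)"] O_K[OF O_dickson[OF x]] O_K[OF O_dickson[OF sx]] Dt[OF t]
        by simp
      then show "\<exists>s. \<tau> (dickson p x - dickson p (\<sigma> x)) = of_real (dickson p (r \<tau>) - s) \<and>
          (r (f \<tau>) \<le> 2 \<longrightarrow> \<bar>s\<bar> \<le> 2) \<and> \<bar>s\<bar> \<le> 2 * C ^ p"
        using r(2)[OF ft] Dc[OF ft, of p] by (intro exI[of _ "dickson p (r (f \<tau>))"]) (auto intro!: abs_dickson_le_2)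
    qed
  qed
qed

text \<open>Since p <= 8 d, the exponent 2 k p is at most (16 k) d, so taking d-th roots of d^d <
  p^d bounds d. The summand \<open>d0\<close> guarantees the prime, and \<open>2\<close> makes it
  larger than 2, hence odd.\<close>

lemma card_G_bound:
  assumes d0: "\<And>d. d \<ge> d0 \<Longrightarrow> \<exists>p::nat. prime p \<and> d < p \<and> p \<le> 8 * d"
    and b: "b \<in> \<O>" "b = of_real \<beta>" "\<beta> > 4"
    and real: "\<And>\<sigma>. \<sigma> \<in> G \<Longrightarrow> \<exists>r. \<sigma> b = of_real r \<and> 0 \<le> r \<and> r \<le> \<beta>"
    and faithful: "\<And>\<sigma>. \<sigma> \<in> G \<Longrightarrow> \<sigma> b = b \<Longrightarrow> \<forall>y\<in>K. \<sigma> y = y"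
    and card: "card {\<sigma> \<in> G. Re (\<sigma> b) > 4} \<le> k"
    and C: "\<beta> \<le> real C"
  shows "card G \<le> d0 + 2 + 4 * C ^ (16 * k)"
proof (rule ccontr)
  define d where "d = card G"
  assume "\<not> ?thesis"
  then have d: "d \<ge> d0" "d \<ge> 2" "d > 4 * C ^ (16 * k)" by (auto simp: d_def)
  obtain p where p: "prime p" "d < p" "p \<le> 8 * d" using d0[OF d(1)] by blast
  have "odd p" using p d prime_odd_nat by auto
  have C1: "real C > 4" using b C by linarith
  have "real d ^ d \<le> real p ^ d" using p by (intro power_mono) auto
  also have "\<dots> \<le> 4 ^ d * real C ^ (2 * k * p)"
    unfolding d_def
  proof (rule prime_power_bound[OF p(1) \<open>odd p\<close> _ b _ _ card C])
    fix \<sigma> assume s: "\<sigma> \<in> G"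
    show "\<exists>r. \<sigma> b = of_real r \<and> 0 \<le> r \<and> r \<le> \<beta>" by (rule real[OF s])
    show "\<sigma> b = b \<Longrightarrow> \<forall>y\<in>K. \<sigma> y = y" by (rule faithful[OF s])
  qed (use p(2) in \<open>simp add: d_def\<close>)
  also have "\<dots> \<le> 4 ^ d * real C ^ (2 * k * (8 * d))"
    using C1 p(3) by (intro mult_left_mono power_increasing mult_le_mono) auto
  also have "\<dots> = (4 * real C ^ (16 * k)) ^ d" by (simp add: power_mult_distrib mult.assoc flip: power_mult)
  finally have "real d ^ d \<le> (4 * real C ^ (16 * k)) ^ d" .
  moreover have "(4 * real C ^ (16 * k)) ^ d < real d ^ d"
  proof (rule power_strict_mono)
    show "4 * real C ^ (16 * k) < real d" using d(3) by (metis of_nat_less_iff of_nat_mult of_nat_numeral of_nat_power)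
  qed (use d in auto)
  ultimately show False by linarith
qed

end

section \<open>Simple abelian number fields\<close>

lemma class_ring_a_inv: "\<ominus>\<^bsub>complex_ring\<^esub> x = - x"
  unfolding a_inv_def m_inv_def
proof (rule the_equality, goal_cases)
  case (2 y)
  then have "y + x = 0" by simp
  then show ?case by (simp only: eq_neg_iff_add_eq_0)
qed simp

lemma class_ring_m_inv:
  assumes "x \<noteq> 0"
  shows "inv\<^bsub>complex_ring\<^esub> x = inverse x"
  unfolding m_inv_def
proof (rule the_equality, goal_cases)
  case (2 y)
  then have "x * y = 1" by simp
  then show ?case by (rule inverse_unique[symmetric])
qed (use assms in simp)

lemma rat_adjoin_closed:
  shows "b \<in> rat_adjoin b" and "1 \<in> rat_adjoin b"
    and "x \<in> rat_adjoin b \<Longrightarrow> y \<in> rat_adjoin b \<Longrightarrow> x + y \<in> rat_adjoin b"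
    and "x \<in> rat_adjoin b \<Longrightarrow> y \<in> rat_adjoin b \<Longrightarrow> x * y \<in> rat_adjoin b"
    and "x \<in> rat_adjoin b \<Longrightarrow> - x \<in> rat_adjoin b"
  using generate_field.one[of complex_ring "{b}"] generate_field.incl[of b "{b}" complex_ring]
    generate_field.eng_add[of x complex_ring "{b}" y] generate_field.eng_mult[of x complex_ring "{b}" y]
    generate_field.a_inv[of x complex_ring "{b}"]
  by (simp_all add: rat_adjoin_def class_ring_a_inv)

lemma rat_adjoin_inverse:
  assumes "x \<in> rat_adjoin b"
  shows "inverse x \<in> rat_adjoin b"
proof (cases "x = 0")
  case False
  then show ?thesis
    using generate_field.m_inv[of x complex_ring "{b}"] assms by (simp add: rat_adjoin_def class_ring_m_inv)
qed (use assms in simp)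

lemma rat_adjoin_induct [consumes 1, case_names one gen minus inverse add mult]:
  assumes "x \<in> rat_adjoin b" "Q 1" "Q b"
    and "\<And>x. x \<in> rat_adjoin b \<Longrightarrow> Q x \<Longrightarrow> Q (- x)"
    and "\<And>x. x \<in> rat_adjoin b \<Longrightarrow> Q x \<Longrightarrow> x \<noteq> 0 \<Longrightarrow> Q (inverse x)"
    and "\<And>x y. x \<in> rat_adjoin b \<Longrightarrow> y \<in> rat_adjoin b \<Longrightarrow> Q x \<Longrightarrow> Q y \<Longrightarrow> Q (x + y)"
    and "\<And>x y. x \<in> rat_adjoin b \<Longrightarrow> y \<in> rat_adjoin b \<Longrightarrow> Q x \<Longrightarrow> Q y \<Longrightarrow> Q (x * y)"
  shows "Q x"
  using assms(1) unfolding rat_adjoin_def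
proof (induction rule: generate_field.induct)
  case one
  then show ?case using assms(2) by simp
next
  case (incl h)
  then show ?case using assms(3) by simp
next
  case (a_inv h)
  then show ?case using assms(4)[of h] by (simp add: rat_adjoin_def class_ring_a_inv)
next
  case (m_inv h)
  then show ?case using assms(5)[of h] by (simp add: rat_adjoin_def class_ring_m_inv)
next
  case (eng_add h1 h2)
  then show ?case using assms(6)[of h1 h2] by (simp add: rat_adjoin_def)
next
  case (eng_mult h1 h2)
  then show ?case using assms(7)[of h1 h2] by (simp add: rat_adjoin_def)
qed

lemma galois_group_carrier:
  assumes "\<sigma> \<in> carrier (galois_group L)"
  shows "\<sigma> \<in> Bij L" "\<And>x y. x \<in> L \<Longrightarrow> y \<in> L \<Longrightarrow> \<sigma> (x + y) = \<sigma> x + \<sigma> y"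
    "\<And>x y. x \<in> L \<Longrightarrow> y \<in> L \<Longrightarrow> \<sigma> (x * y) = \<sigma> x * \<sigma> y" "\<sigma> 1 = 1"
  using assms by (auto simp: galois_group_def Ring.ring_hom_def)

lemma automorphism_eq_if_eq_on_generator:
  assumes s: "\<sigma> \<in> carrier (galois_group (rat_adjoin b))"
    and t: "\<tau> \<in> carrier (galois_group (rat_adjoin b))" and eq: "\<sigma> b = \<tau> b"
  shows "\<sigma> = \<tau>"
proof -
  let ?L = "rat_adjoin b"
  note cl = rat_adjoin_closed
  have zero: "\<rho> 0 = 0" and uminus: "\<And>x. x \<in> ?L \<Longrightarrow> \<rho> (- x) = - \<rho> x"
    if r: "\<rho> \<in> carrier (galois_group ?L)" for \<rho>
  proof -
    have z: "0 \<in> ?L" using cl(3)[OF cl(2) cl(5)[OF cl(2)]] by simp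
    show 0: "\<rho> 0 = 0" using galois_group_carrier(2)[OF r z z] by simp
    fix x assume x: "x \<in> ?L"
    have "\<rho> x + \<rho> (- x) = \<rho> (x + - x)" by (rule galois_group_carrier(2)[OF r x cl(5)[OF x], symmetric])
    then show "\<rho> (- x) = - \<rho> x" using 0 by (simp add: add_eq_0_iff)
  qed
  have "\<sigma> x = \<tau> x" if "x \<in> ?L" for x
    using that
  proof (induction rule: rat_adjoin_induct)
    case one
    then show ?case using galois_group_carrier(4)[OF s] galois_group_carrier(4)[OF t] by simp
  next
    case gen
    then show ?case by (rule eq)
  next
    case (minus x)
    then show ?case using uminus[OF s] uminus[OF t] by simp
  next
    case (inverse x)
    have "\<rho> x * \<rho> (inverse x) = 1" if r: "\<rho> \<in> carrier (galois_group ?L)" for \<rho>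
      using galois_group_carrier(3)[OF r inverse(1) rat_adjoin_inverse[OF inverse(1)]]
        galois_group_carrier(4)[OF r] inverse(2) by simp
    from this[OF s] this[OF t] show ?case using inverse(3) by (metis inverse_unique)
  next
    case (add x y)
    then show ?case using galois_group_carrier(2)[OF s] galois_group_carrier(2)[OF t] by simp
  next
    case (mult x y)
    then show ?case using galois_group_carrier(3)[OF s] galois_group_carrier(3)[OF t] by simp
  qed
  \<comment> \<open>Members of \<open>Bij\<close> take the value \<open>undefined\<close> outside
    the field, so agreement on the field is equality of functions.\<close>
  moreover have "\<sigma> \<in> extensional ?L" "\<tau> \<in> extensional ?L"
    using galois_group_carrier(1) s t by (auto simp: Bij_def)
  ultimately show ?thesis by (intro extensionalityI)
qed

lemma galois_group_mult:
  assumes "\<sigma> \<in> carrier (galois_group L)" "\<tau> \<in> carrier (galois_group L)" "x \<in> L"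
  shows "(\<sigma> \<otimes>\<^bsub>galois_group L\<^esub> \<tau>) x = \<sigma> (\<tau> x)"
  using galois_group_carrier(1)[OF assms(1)] galois_group_carrier(1)[OF assms(2)] assms(3)
  by (simp add: galois_group_def BijGroup_def compose_def)

lemma galois_group_one: "x \<in> L \<Longrightarrow> \<one>\<^bsub>galois_group L\<^esub> x = x"
  by (simp add: galois_group_def BijGroup_def)

text \<open>The integral polynomial \<open>q\<close> makes the automorphism group finite.\<close>

lemma abelian_galois_rat_adjoin:
  fixes q :: "int poly"
  assumes ab: "abelian_number_field (rat_adjoin b)" and q: "q \<noteq> 0" "poly (of_int_poly q) b = 0"
  shows "abelian_galois (rat_adjoin b) (carrier (galois_group (rat_adjoin b)))"
proof -
  let ?L = "rat_adjoin b"
  let ?G = "galois_group ?L"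
  note cl = rat_adjoin_closed
  interpret comm_group ?G using ab by (simp add: abelian_number_field_def)
  have fixed: "{x \<in> ?L. \<forall>\<sigma>\<in>carrier ?G. \<sigma> x = x} = \<rat>"
    using ab by (simp add: abelian_number_field_def galois_over_rat_def)
  have into: "\<sigma> x \<in> ?L" if "\<sigma> \<in> carrier ?G" "x \<in> ?L" for \<sigma> x
    using galois_group_carrier(1)[OF that(1)] that(2) by (auto simp: Bij_def bij_betw_def)
  show ?thesis
  proof
    fix \<sigma> \<tau> assume s: "\<sigma> \<in> carrier ?G" and t: "\<tau> \<in> carrier ?G"
    show "\<exists>\<rho>\<in>carrier ?G. \<forall>x\<in>?L. \<rho> x = \<sigma> (\<tau> x)"
      using galois_group_mult[OF s t] s t by (intro bexI[of _ "\<sigma> \<otimes>\<^bsub>?G\<^esub> \<tau>"]) auto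
    show "\<forall>x\<in>?L. \<sigma> x = \<tau> x \<Longrightarrow> \<sigma> = \<tau>"
      using automorphism_eq_if_eq_on_generator[OF s t] cl(1) by blast
    fix x assume x: "x \<in> ?L"
    show "\<sigma> (\<tau> x) = \<tau> (\<sigma> x)"
      using galois_group_mult[OF s t x] galois_group_mult[OF t s x] m_comm[OF s t] by simp
  next
    fix \<sigma> assume s: "\<sigma> \<in> carrier ?G"
    show "\<exists>\<rho>\<in>carrier ?G. \<forall>x\<in>?L. \<rho> (\<sigma> x) = x"
    proof (intro bexI[of _ "inv\<^bsub>?G\<^esub> \<sigma>"] ballI)
      fix x assume x: "x \<in> ?L"
      have "(inv\<^bsub>?G\<^esub> \<sigma>) (\<sigma> x) = (inv\<^bsub>?G\<^esub> \<sigma> \<otimes>\<^bsub>?G\<^esub> \<sigma>) x"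
        using galois_group_mult[OF inv_closed[OF s] s x] by simp
      then show "(inv\<^bsub>?G\<^esub> \<sigma>) (\<sigma> x) = x" using s galois_group_one[OF x] by simp
    qed (use s in simp)
    show "\<sigma> 1 = 1" by (rule galois_group_carrier(4)[OF s])
    fix x y assume x: "x \<in> ?L" and y: "y \<in> ?L"
    show "\<sigma> (x + y) = \<sigma> x + \<sigma> y" by (rule galois_group_carrier(2)[OF s x y])
    show "\<sigma> (x * y) = \<sigma> x * \<sigma> y" by (rule galois_group_carrier(3)[OF s x y])
  next
    show "\<exists>\<sigma>\<in>carrier ?G. \<forall>x\<in>?L. \<sigma> x = x"
      using galois_group_one one_closed by blast
    show "x \<in> \<rat>" if "x \<in> ?L" "\<forall>\<sigma>\<in>carrier ?G. \<sigma> x = x" for x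
      using fixed that by blast
    show "finite (carrier ?G)"
    proof (rule finite_imageD)
      \<comment> \<open>An automorphism is determined by the image of \<open>b\<close>, and this
        image is again one of the finitely many roots of \<open>q\<close>.\<close>
      show "inj_on (\<lambda>\<sigma>. \<sigma> b) (carrier ?G)"
        using automorphism_eq_if_eq_on_generator by (auto intro: inj_onI)
      have "(of_int_poly q :: complex poly) \<noteq> 0" using q(1) by simp
      then have "finite {z. poly (of_int_poly q) z = (0 :: complex)}" by (rule poly_roots_finite)
      moreover have "(\<lambda>\<sigma>. \<sigma> b) ` carrier ?G \<subseteq> {z. poly (of_int_poly q) z = 0}"
      proof safe
        fix \<sigma> assume s: "\<sigma> \<in> carrier ?G"
        have z: "0 \<in> ?L" using cl(3)[OF cl(2) cl(5)[OF cl(2)]] by simp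
        have s0: "\<sigma> 0 = 0" using galois_group_carrier(2)[OF s z z] by simp
        have nat: "of_nat k \<in> ?L \<and> \<sigma> (of_nat k) = of_nat k" for k
          by (induction k) (use z s0 cl(2,3) galois_group_carrier(2,4)[OF s] in auto)
        have int: "of_int k \<in> ?L \<and> \<sigma> (of_int k) = of_int k" for k
        proof (cases k rule: int_cases2)
          case (nonneg m)
          then show ?thesis using nat[of m] by simp
        next
          case (nonpos m)
          have "\<sigma> (of_nat m + - of_nat m) = \<sigma> (of_nat m) + \<sigma> (- of_nat m)"
            using galois_group_carrier(2)[OF s] nat[of m] cl(5) by blast
          then have "\<sigma> (- of_nat m) = - of_nat m" using nat[of m] s0 by (simp add: add_eq_0_iff)
          then show ?thesis using nonpos nat[of m] cl(5) by simp
        qed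
        have "poly (of_int_poly p) b \<in> ?L \<and> \<sigma> (poly (of_int_poly p) b) = poly (of_int_poly p) (\<sigma> b)"
          for p :: "int poly"
        proof (induction p)
          case (pCons a p)
          then show ?case
            using int[of a] cl galois_group_carrier(2,3)[OF s] by (simp add: map_poly_pCons)
        qed (use z s0 in auto)
        then show "poly (of_int_poly q) (\<sigma> b) = 0" using q(2) s0 by metis
      qed
      ultimately show "finite ((\<lambda>\<sigma>. \<sigma> b) ` carrier ?G)" using finite_subset by blast
    qed
  next
    show "1 \<in> ?L" by (rule cl(2))
    fix x assume x: "x \<in> ?L"
    show "- x \<in> ?L" by (rule cl(5)[OF x])
    show "inverse x \<in> ?L" by (rule rat_adjoin_inverse[OF x])
    show "\<sigma> x \<in> ?L" if "\<sigma> \<in> carrier ?G" for \<sigma> by (rule into[OF that x])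
    fix y assume y: "y \<in> ?L"
    show "x + y \<in> ?L" by (rule cl(3)[OF x y])
    show "x * y \<in> ?L" by (rule cl(4)[OF x y])
  qed
qed

section \<open>Spectra of graphs\<close>

text \<open>Vectors are functions on all natural numbers that are read only below \<open>n\<close>;
  this avoids dependent dimensions in the variational arguments.\<close>

locale graph_matrix =
  fixes n :: nat and E :: "nat \<Rightarrow> nat \<Rightarrow> bool"
  assumes sym: "E i j \<Longrightarrow> E j i" and irrefl: "\<not> E i i" and bound: "E i j \<Longrightarrow> i < n"
    and n_pos: "n > 0"
begin

text \<open>The adjacency matrix applied to the vector \<open>x\<close>.\<close>

definition nb :: "(nat \<Rightarrow> real) \<Rightarrow> nat \<Rightarrow> real" where
  "nb x i = (\<Sum>j<n. if E i j then x j else 0)"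

definition ip :: "(nat \<Rightarrow> real) \<Rightarrow> (nat \<Rightarrow> real) \<Rightarrow> real" where
  "ip x y = (\<Sum>i<n. x i * y i)"

lemma sym_iff: "E i j \<longleftrightarrow> E j i" using sym by blast

lemma ip_commute: "ip x y = ip y x"
  by (simp add: ip_def mult.commute)

lemma ip_add: "ip x (\<lambda>i. y i + z i) = ip x y + ip x z"
  by (simp add: ip_def algebra_simps sum.distrib)

lemma ip_scale: "ip x (\<lambda>i. c * y i) = c * ip x y"
  by (simp add: ip_def algebra_simps sum_distrib_left)

lemma ip_add_left: "ip (\<lambda>i. y i + z i) x = ip y x + ip z x"
  by (simp add: ip_def algebra_simps sum.distrib)

lemma ip_scale_left: "ip (\<lambda>i. c * y i) x = c * ip y x"
  by (simp add: ip_def algebra_simps sum_distrib_left)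

lemma nb_add: "nb (\<lambda>i. y i + z i) i = nb y i + nb z i"
  unfolding nb_def sum.distrib[symmetric] by (intro sum.cong) auto

lemma nb_scale: "nb (\<lambda>i. c * y i) i = c * nb y i"
  unfolding nb_def sum_distrib_left by (intro sum.cong) auto

lemma ip_nb: "ip x (nb y) = ip (nb x) y"
proof -
  have "ip x (nb y) = (\<Sum>i<n. \<Sum>j<n. if E i j then x i * y j else 0)"
    unfolding ip_def nb_def sum_distrib_left by (intro sum.cong refl) auto
  also have "\<dots> = (\<Sum>j<n. \<Sum>i<n. if E i j then x i * y j else 0)"
    by (rule sum.swap)
  also have "\<dots> = ip (nb x) y"
    unfolding ip_def nb_def sum_distrib_right by (intro sum.cong refl) (auto simp: sym_iff)
  finally show ?thesis .
qed

lemma ip_self_nonneg: "ip x x \<ge> 0"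
  by (simp add: ip_def sum_nonneg)

lemma ip_self_pos: "i < n \<Longrightarrow> x i \<noteq> 0 \<Longrightarrow> ip x x > 0"
  unfolding ip_def by (rule sum_pos2[of _ i]) (auto simp: zero_less_mult_iff linorder_neq_iff)

lemma ip_self_zero: "ip x x = 0 \<Longrightarrow> i < n \<Longrightarrow> x i = 0"
  using ip_self_pos[of i x] by fastforce

lemma nb_cong: "(\<And>j. j < n \<Longrightarrow> x j = y j) \<Longrightarrow> nb x i = nb y i"
  unfolding nb_def by (intro sum.cong) auto

lemma ip_cong: "(\<And>i. i < n \<Longrightarrow> x i = x' i) \<Longrightarrow> (\<And>i. i < n \<Longrightarrow> y i = y' i) \<Longrightarrow> ip x y = ip x' y'"
  unfolding ip_def by (intro sum.cong) auto

lemma rayleigh_abs: "\<bar>ip x (nb x)\<bar> \<le> ip (\<lambda>i. \<bar>x i\<bar>) (nb (\<lambda>i. \<bar>x i\<bar>))"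
proof -
  have "\<bar>ip x (nb x)\<bar> \<le> (\<Sum>i<n. \<bar>x i\<bar> * \<bar>nb x i\<bar>)"
    unfolding ip_def abs_mult[symmetric] by (rule sum_abs)
  also have "\<dots> \<le> (\<Sum>i<n. \<bar>x i\<bar> * nb (\<lambda>i. \<bar>x i\<bar>) i)"
  proof (intro sum_mono mult_left_mono)
    fix i
    have "\<bar>nb x i\<bar> \<le> (\<Sum>j<n. \<bar>if E i j then x j else 0\<bar>)" unfolding nb_def by (rule sum_abs)
    also have "\<dots> = nb (\<lambda>i. \<bar>x i\<bar>) i" unfolding nb_def by (intro sum.cong) auto
    finally show "\<bar>nb x i\<bar> \<le> nb (\<lambda>i. \<bar>x i\<bar>) i" .
  qed auto
  finally show ?thesis by (simp add: ip_def)
qed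

text \<open>Equivalently, no eigenvalue of the symmetric adjacency matrix exceeds
  \<open>r\<close>.\<close>

definition rayleigh_bound :: "real \<Rightarrow> bool" where
  "rayleigh_bound r \<longleftrightarrow> (\<forall>y. ip y (nb y) \<le> r * ip y y)"

text \<open>First variation in the direction of the i-th unit vector: a quadratic in t without
  constant term that is nonnegative for all t has zero linear coefficient.\<close>

lemma maximiser_is_eigenvector:
  assumes "rayleigh_bound r" "ip x (nb x) = r * ip x x" "i < n"
  shows "nb x i = r * x i"
proof -
  define e where "e j = (if j = i then 1 else 0 :: real)" for j
  have xe: "ip y e = y i" for y
    unfolding ip_def e_def using assms(3) by (simp add: if_distrib[of "\<lambda>c. _ * c"] cong: if_cong)
  have ex: "ip e y = y i" for y
    unfolding ip_def e_def using assms(3) by (simp add: if_distrib[of "\<lambda>c. c * _"] cong: if_cong)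
  have nbe: "nb e i = 0" unfolding nb_def e_def by (rule sum.neutral) (use irrefl in auto)
  define a where "a = r * x i - nb x i"
  have ineq: "0 \<le> 2 * t * a + t\<^sup>2 * r" for t
  proof -
    let ?y = "\<lambda>j. x j + t * e j"
    have nby: "nb ?y = (\<lambda>j. nb x j + t * nb e j)"
      by (rule ext) (simp only: nb_add nb_scale)
    have "ip x (nb e) = nb x i" unfolding ip_nb xe ..
    then have "ip ?y (nb ?y) = ip x (nb x) + 2 * t * nb x i"
      unfolding nby ip_add ip_scale ip_add_left ip_scale_left ex nbe by simp
    moreover have "ip ?y ?y = ip x x + 2 * t * x i + t\<^sup>2"
      unfolding ip_add ip_scale ip_add_left ip_scale_left ex xe
      by (simp add: e_def power2_eq_square algebra_simps)
    moreover have "ip ?y (nb ?y) \<le> r * ip ?y ?y" using assms(1) by (simp add: rayleigh_bound_def)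
    ultimately have "ip x (nb x) + 2 * t * nb x i \<le> r * (ip x x + 2 * t * x i + t\<^sup>2)" by simp
    then show ?thesis unfolding assms(2) a_def by (simp add: algebra_simps)
  qed
  have "a = 0"
  proof (rule ccontr)
    assume a: "a \<noteq> 0"
    \<comment> \<open>Chosen above \<open>r\<close>, so that t = - a / L makes the quadratic
      negative whatever the sign of \<open>r\<close>.\<close>
    define L where "L = \<bar>r\<bar> + 1"
    define c where "c = a / L"
    have L: "L > 0" "r < L" by (auto simp: L_def)
    then have ac: "a = c * L" and "c \<noteq> 0" using a by (auto simp: c_def)
    have "2 * (- c) * a + (- c)\<^sup>2 * r = c\<^sup>2 * (r - 2 * L)"
      unfolding ac by (simp add: power2_eq_square algebra_simps)
    moreover have "c\<^sup>2 * (r - 2 * L) < 0"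
      using \<open>c \<noteq> 0\<close> L by (intro mult_pos_neg) auto
    ultimately show False using ineq[of "- c"] by linarith
  qed
  then show ?thesis by (simp add: a_def)
qed

lemma exists_maximiser: "\<exists>r x. rayleigh_bound r \<and> ip x x = 1 \<and> ip x (nb x) = r"
proof -
  \<comment> \<open>Coordinates from \<open>n\<close> on do not affect \<open>ip\<close>; confining
    all of them to [-1, 1] makes the unit sphere compact in the product topology.\<close>
  define S where "S = {x :: nat \<Rightarrow> real. x \<in> (\<Pi>\<^sub>E i\<in>UNIV. {-1..1}) \<and> ip x x \<in> {1}}"
  have coord: "continuous_on UNIV (\<lambda>x :: nat \<Rightarrow> real. x i)" for i
    by (rule continuous_on_product_coordinates)
  have cont_ip: "continuous_on UNIV (\<lambda>x. ip x x)"
    unfolding ip_def by (intro continuous_intros coord)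
  have "continuous_on UNIV (\<lambda>x :: nat \<Rightarrow> real. if E i j then x j else 0)" for i j
    by (cases "E i j") (simp_all add: coord)
  then have cont_q: "continuous_on UNIV (\<lambda>x. ip x (nb x))"
    unfolding ip_def nb_def by (intro continuous_intros coord)
  have "compactin (product_topology (\<lambda>i :: nat. euclidean :: real topology) UNIV) (\<Pi>\<^sub>E i\<in>UNIV. {-1..1})"
    by (subst compactin_PiE) (simp add: compact_Icc)
  then have "compact (\<Pi>\<^sub>E i\<in>(UNIV :: nat set). {-1..1 :: real})"
    by (simp add: euclidean_product_topology)
  moreover have "closed {x. ip x x \<in> {1}}"
    using continuous_closed_preimage[OF cont_ip closed_UNIV, of "{1}"] by (simp add: vimage_def)
  ultimately have "compact S"
    unfolding S_def Collect_conj_eq by (simp add: compact_Int_closed)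
  moreover have "(\<lambda>i. if i = 0 then 1 else 0) \<in> S"
    using n_pos by (auto simp: S_def ip_def PiE_def if_distrib cong: if_cong)
  then have "S \<noteq> {}" by blast
  ultimately obtain x where x: "x \<in> S" "\<And>y. y \<in> S \<Longrightarrow> ip y (nb y) \<le> ip x (nb x)"
    using continuous_attains_sup[of S "\<lambda>x. ip x (nb x)"] continuous_on_subset[OF cont_q subset_UNIV] by blast
  have "rayleigh_bound (ip x (nb x))"
    unfolding rayleigh_bound_def
  proof
    fix y
    show "ip y (nb y) \<le> ip x (nb x) * ip y y"
    proof (cases "ip y y = 0")
      case True
      have "ip y (nb y) = 0" unfolding ip_def using ip_self_zero[OF True] by (intro sum.neutral) auto
      then show ?thesis using True by simp
    next
      case False
      then have pos: "ip y y > 0" using ip_self_nonneg[of y] by linarith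
      define s where "s = sqrt (ip y y)"
      have s: "s > 0" "s * s = ip y y" using pos by (auto simp: s_def)
      have "inverse s * (inverse s * (s * s)) = (inverse s * s) * (inverse s * s)" by (simp only: mult_ac)
      then have ss: "inverse s * (inverse s * (s * s)) = 1" using s(1) by simp
      \<comment> \<open>Normalised, and set to zero from \<open>n\<close> on so as to lie in the
        cube.\<close>
      define z where "z i = (if i < n then inverse s * y i else 0)" for i
      have zz: "ip z z = 1"
      proof -
        have "ip z z = ip (\<lambda>i. inverse s * y i) (\<lambda>i. inverse s * y i)" by (rule ip_cong) (auto simp: z_def)
        also have "\<dots> = inverse s * (inverse s * ip y y)" by (simp only: ip_scale ip_scale_left)
        finally show ?thesis using s(1) ss by (simp add: s(2)[symmetric])
      qed
      have "z i \<in> {-1..1}" for i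
      proof (cases "i < n")
        case True
        have "(z i)\<^sup>2 \<le> (\<Sum>i<n. z i * z i)"
          using True member_le_sum[of i "{..<n}" "\<lambda>i. z i * z i"] by (simp add: power2_eq_square)
        then have "(z i)\<^sup>2 \<le> 1" using zz by (simp add: ip_def)
        then have "\<bar>z i\<bar> \<le> 1" by (simp add: abs_square_le_1)
        then show ?thesis by auto
      qed (simp add: z_def)
      then have "z \<in> S" using zz by (auto simp: S_def PiE_def extensional_def)
      then have "ip z (nb z) \<le> ip x (nb x)" by (rule x(2))
      moreover have "ip z (nb z) = ip (\<lambda>i. inverse s * y i) (nb (\<lambda>i. inverse s * y i))"
        by (rule ip_cong) (auto simp: z_def intro!: nb_cong)
      then have "ip z (nb z) = inverse s * (inverse s * ip y (nb y))"
        by (simp only: nb_scale[abs_def] ip_scale ip_scale_left)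
      then have "ip y (nb y) = ip z (nb z) * ip y y" using s(1) ss by (simp add: s(2)[symmetric])
      ultimately show ?thesis using pos by (simp add: mult_right_mono)
    qed
  qed
  then show ?thesis using x(1) by (auto simp: S_def)
qed

text \<open>Replacing a maximiser by its absolute values does not lower the Rayleigh quotient, so
  the result is again a maximiser and hence a nonnegative eigenvector.\<close>

lemma exists_perron:
  "\<exists>r x. rayleigh_bound r \<and> (\<exists>i<n. x i \<noteq> 0) \<and> (\<forall>i. x i \<ge> 0) \<and> (\<forall>i<n. nb x i = r * x i)"
proof -
  obtain r x where x: "rayleigh_bound r" "ip x x = 1" "ip x (nb x) = r" using exists_maximiser by blast
  define y where "y i = \<bar>x i\<bar>" for i
  have yy: "ip y y = 1" using x(2) by (simp add: ip_def y_def)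
  have "r \<le> ip y (nb y)" using rayleigh_abs[of x] x(3) unfolding y_def by linarith
  moreover have "ip y (nb y) \<le> r" using x(1) yy by (metis mult.right_neutral rayleigh_bound_def)
  ultimately have q: "ip y (nb y) = r * ip y y" using yy by simp
  have "\<exists>i<n. y i \<noteq> 0"
  proof (rule ccontr)
    assume "\<not> ?thesis"
    then have "ip y y = 0" unfolding ip_def by (intro sum.neutral) auto
    then show False using yy by simp
  qed
  moreover have "\<forall>i. y i \<ge> 0" by (simp add: y_def)
  ultimately show ?thesis
    using x(1) maximiser_is_eigenvector[OF x(1) q] by (intro exI[of _ r] exI[of _ y]) auto
qed

text \<open>The neighbour sum at \<open>i\<close> is zero with nonnegative summands.\<close>

lemma zero_propagates:
  assumes "\<forall>i. x i \<ge> 0" "nb x i = r * x i" "x i = 0" "E i j"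
  shows "x j = 0"
proof -
  have j: "j < n" using assms(4) sym bound by blast
  have "(\<Sum>l<n. if E i l then x l else 0) = 0" using assms(2,3) by (simp add: nb_def)
  then have "(if E i j then x j else 0) = 0"
    using j assms(1) by (subst (asm) sum_nonneg_eq_0_iff) auto
  then show ?thesis using assms(4) by simp
qed

lemma eigenvalue_abs_le:
  assumes "rayleigh_bound r" "i < n" "u i \<noteq> 0" "\<And>j. j < n \<Longrightarrow> nb u j = \<mu> * u j"
  shows "\<bar>\<mu>\<bar> \<le> r"
proof -
  have "ip u (nb u) = \<mu> * ip u u"
    using ip_cong[of u u "nb u" "\<lambda>j. \<mu> * u j"] assms(4) by (simp add: ip_scale)
  then have "\<bar>\<mu>\<bar> * ip u u = \<bar>ip u (nb u)\<bar>" using ip_self_nonneg[of u] by (simp add: abs_mult)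
  also have "\<dots> \<le> ip (\<lambda>i. \<bar>u i\<bar>) (nb (\<lambda>i. \<bar>u i\<bar>))" by (rule rayleigh_abs)
  also have "\<dots> \<le> r * ip (\<lambda>i. \<bar>u i\<bar>) (\<lambda>i. \<bar>u i\<bar>)" using assms(1) by (simp add: rayleigh_bound_def)
  also have "\<dots> = r * ip u u" by (simp add: ip_def)
  finally show ?thesis using ip_self_pos[of i u] assms(2,3) by simp
qed

end

section \<open>Eigenvalues of the matrix and of its square\<close>

lemma eigenvalue_adjacency_iff:
  fixes \<mu> :: "'a :: field"
  shows "eigenvalue (mat n n (\<lambda>(i, j). if E i j then 1 else 0)) \<mu> \<longleftrightarrow>
    (\<exists>u. (\<exists>i<n. u i \<noteq> 0) \<and> (\<forall>i<n. (\<Sum>j<n. if E i j then u j else 0) = \<mu> * u i))"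
    (is "eigenvalue ?A \<mu> \<longleftrightarrow> ?R")
proof -
  have mv: "(?A *\<^sub>v vec n u) $ i = (\<Sum>j<n. if E i j then u j else 0)" if "i < n" for u i
    using that by (auto simp: scalar_prod_def atLeast0LessThan intro!: sum.cong)
  show ?thesis
  proof
    assume "eigenvalue ?A \<mu>"
    then obtain w where w: "w \<in> carrier_vec n" "w \<noteq> 0\<^sub>v n" "?A *\<^sub>v w = \<mu> \<cdot>\<^sub>v w"
      by (auto simp: eigenvalue_def eigenvector_def)
    have vw: "vec n (\<lambda>i. w $ i) = w" using w(1) by auto
    have "\<exists>i<n. w $ i \<noteq> 0"
    proof (rule ccontr)
      assume "\<not> ?thesis"
      then have "w = 0\<^sub>v n" using w(1) by (intro eq_vecI) auto
      then show False using w(2) by blast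
    qed
    moreover have "(\<Sum>j<n. if E i j then w $ j else 0) = \<mu> * w $ i" if "i < n" for i
      using mv[OF that, of "\<lambda>i. w $ i"] w(1,3) that unfolding vw by simp
    ultimately show ?R by (intro exI[of _ "\<lambda>i. w $ i"]) auto
  next
    assume ?R
    then obtain u where u: "\<exists>i<n. u i \<noteq> 0" "\<And>i. i < n \<Longrightarrow> (\<Sum>j<n. if E i j then u j else 0) = \<mu> * u i"
      by blast
    have "?A *\<^sub>v vec n u = \<mu> \<cdot>\<^sub>v vec n u"
    proof (rule eq_vecI)
      fix i assume "i < dim_vec (\<mu> \<cdot>\<^sub>v vec n u)"
      then have i: "i < n" by simp
      show "(?A *\<^sub>v vec n u) $ i = (\<mu> \<cdot>\<^sub>v vec n u) $ i" unfolding mv[OF i] using u(2)[OF i] i by simp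
    qed simp
    moreover have "vec n u \<noteq> 0\<^sub>v n" using u(1) by (metis index_vec index_zero_vec(1))
    ultimately show "eigenvalue ?A \<mu>" unfolding eigenvalue_def eigenvector_def
      by (intro exI[of _ "vec n u"]) simp
  qed
qed

text \<open>Completing the \<open>k\<close> equations by a zero row gives a singular square matrix
  of size k + 1.\<close>

lemma exists_linear_dependence:
  fixes f :: "nat \<Rightarrow> nat \<Rightarrow> 'a :: field"
  shows "\<exists>c. (\<exists>j\<le>k. c j \<noteq> 0) \<and> (\<forall>i<k. (\<Sum>j\<le>k. c j * f i j) = 0)"
proof -
  define A where "A = mat (Suc k) (Suc k) (\<lambda>(i, j). if i < k then f i j else 0)"
  have A: "A \<in> carrier_mat (Suc k) (Suc k)" by (simp add: A_def)
  have "det A = (\<Sum>j<Suc k. A $$ (k, j) * cofactor A k j)"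
    by (rule laplace_expansion_row[OF A]) simp
  also have "\<dots> = 0" by (intro sum.neutral) (simp add: A_def)
  finally obtain v where v: "v \<in> carrier_vec (Suc k)" "v \<noteq> 0\<^sub>v (Suc k)" "A *\<^sub>v v = 0\<^sub>v (Suc k)"
    using det_0_iff_vec_prod_zero_field[OF A] by blast
  have "\<exists>j\<le>k. v $ j \<noteq> 0"
  proof (rule ccontr)
    assume "\<not> ?thesis"
    then have "v = 0\<^sub>v (Suc k)" using v(1) by (intro eq_vecI) auto
    then show False using v(2) by blast
  qed
  moreover have "(\<Sum>j\<le>k. v $ j * f i j) = 0" if i: "i < k" for i
  proof -
    have "0 = (A *\<^sub>v v) $ i" using v(3) i by simp
    also have "\<dots> = (\<Sum>j<Suc k. f i j * v $ j)"
      using v(1) i by (simp add: A_def scalar_prod_def atLeast0LessThan)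
    finally show ?thesis by (simp add: lessThan_Suc_atMost mult.commute)
  qed
  ultimately show ?thesis by (intro exI[of _ "\<lambda>j. v $ j"]) auto
qed

context graph_matrix begin

lemma spectrum_real_Max:
  assumes r: "rayleigh_bound r" and x: "\<exists>i<n. x i \<noteq> 0" "\<forall>i<n. nb x i = r * x i"
  shows "Max (spectrum (mat n n (\<lambda>(i, j). if E i j then 1 else 0) :: real mat)) = r"
proof (rule Max_eqI)
  let ?A = "mat n n (\<lambda>(i, j). if E i j then 1 else 0) :: real mat"
  show "finite (spectrum ?A)" by (rule card_finite_spectrum(1)[of _ n]) simp
  show "r \<in> spectrum ?A"
    unfolding spectrum_def mem_Collect_eq eigenvalue_adjacency_iff using x by (auto simp: nb_def)
  fix \<mu> assume "\<mu> \<in> spectrum ?A"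
  then obtain u where u: "\<exists>i<n. u i \<noteq> 0" "\<forall>i<n. nb u i = \<mu> * u i"
    unfolding spectrum_def mem_Collect_eq eigenvalue_adjacency_iff by (auto simp: nb_def)
  then obtain i where "i < n" "u i \<noteq> 0" by blast
  then have "\<bar>\<mu>\<bar> \<le> r" using eigenvalue_abs_le[OF r] u(2) by blast
  then show "\<mu> \<le> r" by linarith
qed

text \<open>Pairing the equation M^2 u = c u with u gives |M u|^2 = c |u|^2, so c is real and
  nonnegative; the real or the imaginary part of u is then a nonzero real eigenvector.\<close>

lemma square_eigenvalue_real:
  fixes u :: "nat \<Rightarrow> complex"
  assumes i: "i < n" "u i \<noteq> 0"
    and eig: "\<And>i. i < n \<Longrightarrow> (\<Sum>l<n. if E i l then (\<Sum>j<n. if E l j then u j else 0) else 0) = c * u i"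
  shows "\<exists>r x. c = of_real r \<and> r \<ge> 0 \<and> (\<exists>i<n. x i \<noteq> 0) \<and> (\<forall>i<n. nb (nb x) i = r * x i)"
proof -
  define w where "w i = (\<Sum>j<n. if E i j then u j else 0)" for i
  have eig': "(\<Sum>l<n. if E i l then w l else 0) = c * u i" if "i < n" for i
    unfolding w_def by (rule eig[OF that])
  have "(\<Sum>i<n. cnj (u i) * (\<Sum>l<n. if E i l then w l else 0)) = (\<Sum>l<n. cnj (w l) * w l)"
  proof -
    have "(\<Sum>i<n. cnj (u i) * (\<Sum>l<n. if E i l then w l else 0)) =
        (\<Sum>i<n. \<Sum>l<n. if E i l then cnj (u i) * w l else 0)"
      unfolding sum_distrib_left by (intro sum.cong refl) auto
    also have "\<dots> = (\<Sum>l<n. \<Sum>i<n. if E i l then cnj (u i) * w l else 0)" by (rule sum.swap)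
    also have "\<dots> = (\<Sum>l<n. cnj (w l) * w l)"
      unfolding w_def cnj_sum sum_distrib_right by (intro sum.cong refl) (auto simp: sym_iff)
    finally show ?thesis .
  qed
  moreover have "(\<Sum>i<n. cnj (u i) * (\<Sum>l<n. if E i l then w l else 0)) = c * (\<Sum>i<n. cnj (u i) * u i)"
  proof -
    have "(\<Sum>i<n. cnj (u i) * (\<Sum>l<n. if E i l then w l else 0)) = (\<Sum>i<n. cnj (u i) * (c * u i))"
      by (intro sum.cong refl) (simp add: eig')
    then show ?thesis by (simp add: sum_distrib_left mult_ac)
  qed
  moreover have norm: "(\<Sum>i<n. cnj (f i) * f i) = of_real (\<Sum>i<n. (cmod (f i))\<^sup>2)" for f
    unfolding of_real_sum by (intro sum.cong refl) (simp add: complex_norm_square mult.commute del: of_real_power)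
  moreover define U W where "U = (\<Sum>i<n. (cmod (u i))\<^sup>2)" and "W = (\<Sum>i<n. (cmod (w i))\<^sup>2)"
  ultimately have e: "c * of_real U = of_real W" by (simp only:)
  have pos: "U > 0" unfolding U_def by (rule sum_pos2[of _ i]) (use i in auto)
  define r where "r = W / U"
  have c: "c = of_real r" using e pos by (simp add: r_def nonzero_eq_divide_eq)
  have r0: "r \<ge> 0" unfolding r_def U_def W_def by (intro divide_nonneg_nonneg sum_nonneg) auto
  have Re: "nb (nb (\<lambda>j. Re (u j))) i = r * Re (u i)" if "i < n" for i
  proof -
    have "nb (nb (\<lambda>j. Re (u j))) i = Re (\<Sum>l<n. if E i l then w l else 0)"
      unfolding nb_def w_def Re_sum by (intro sum.cong refl) (auto intro!: sum.cong)
    then show ?thesis using eig'[OF that] c by simp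
  qed
  have Im: "nb (nb (\<lambda>j. Im (u j))) i = r * Im (u i)" if "i < n" for i
  proof -
    have "nb (nb (\<lambda>j. Im (u j))) i = Im (\<Sum>l<n. if E i l then w l else 0)"
      unfolding nb_def w_def Im_sum by (intro sum.cong refl) (auto intro!: sum.cong)
    then show ?thesis using eig'[OF that] c by simp
  qed
  consider "Re (u i) \<noteq> 0" | "Im (u i) \<noteq> 0" using i(2) complex_eqI[of "u i" 0] by auto
  then show ?thesis
  proof cases
    case 1
    then show ?thesis using c r0 i(1) Re by (intro exI[of _ r] exI[of _ "\<lambda>j. Re (u j)"]) auto
  next
    case 2
    then show ?thesis using c r0 i(1) Im by (intro exI[of _ r] exI[of _ "\<lambda>j. Im (u j)"]) auto
  qed
qed

text \<open>With s the square root of r, (M - s)(M + s) x = 0: either (M + s) x is an eigenvector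
  for s, or x is one for -s.\<close>

lemma square_eigenvalue_le:
  assumes "rayleigh_bound q" "r \<ge> 0" "i < n" "x i \<noteq> 0" "\<And>i. i < n \<Longrightarrow> nb (nb x) i = r * x i"
  shows "r \<le> q\<^sup>2"
proof -
  define s where "s = sqrt r"
  have s: "s \<ge> 0" "s * s = r" using assms(2) by (auto simp: s_def)
  define y where "y j = nb x j + s * x j" for j
  have "s \<le> q"
  proof (cases "\<exists>j<n. y j \<noteq> 0")
    case True
    then obtain j where j: "j < n" "y j \<noteq> 0" by blast
    have "nb y l = s * y l" if "l < n" for l
    proof -
      have "nb y l = nb (nb x) l + s * nb x l" unfolding y_def nb_add nb_scale ..
      then show ?thesis using assms(5)[OF that] by (simp add: y_def algebra_simps s(2)[symmetric])
    qed
    from eigenvalue_abs_le[of q j y s, OF assms(1) j this] show ?thesis by simp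
  next
    case False
    then have "nb x l = (- s) * x l" if "l < n" for l using that by (auto simp: y_def)
    from eigenvalue_abs_le[of q i x "- s", OF assms(1,3,4) this] show ?thesis by simp
  qed
  then have "s * s \<le> q * q" using s(1) by (intro mult_mono) auto
  then show ?thesis using s(2) by (simp add: power2_eq_square)
qed

text \<open>Cauchy-Schwarz over at most two summands per row costs one factor 2, and each (x j)^2
  occurs in at most two rows, which costs the other.\<close>

lemma square_norm_le_on_sparse_part:
  assumes "\<And>i. i < n \<Longrightarrow> card {j. k \<le> j \<and> j < n \<and> E i j} \<le> 2"
    and "\<And>j. k \<le> j \<Longrightarrow> j < n \<Longrightarrow> card {i. i < n \<and> E i j} \<le> 2"
    and x: "\<And>i. i < k \<Longrightarrow> x i = 0"
  shows "ip (nb x) (nb x) \<le> 4 * ip x x"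
proof -
  have "(nb x i)\<^sup>2 \<le> 2 * (\<Sum>j<n. if E i j then (x j)\<^sup>2 else 0)" if i: "i < n" for i
  proof -
    let ?N = "{j. k \<le> j \<and> j < n \<and> E i j}"
    have N: "?N \<subseteq> {..<n}" by auto
    have xk: "k \<le> j" if "x j \<noteq> 0" for j using x that by (meson not_less)
    have "nb x i = (\<Sum>j\<in>?N. x j)"
      unfolding nb_def by (intro sum.mono_neutral_cong_right) (auto dest: xk)
    then have "(nb x i)\<^sup>2 \<le> real (card ?N) * (\<Sum>j\<in>?N. (x j)\<^sup>2)"
      using sum_squared_le_sum_of_squares[of x ?N] finite_subset[OF N] by (simp add: mult.commute)
    also have "\<dots> \<le> 2 * (\<Sum>j\<in>?N. (x j)\<^sup>2)"
      using assms(1)[OF i] by (intro mult_right_mono sum_nonneg) auto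
    also have "(\<Sum>j\<in>?N. (x j)\<^sup>2) = (\<Sum>j<n. if E i j then (x j)\<^sup>2 else 0)"
      by (intro sum.mono_neutral_cong_left) (auto dest: xk)
    finally show ?thesis .
  qed
  then have "ip (nb x) (nb x) \<le> (\<Sum>i<n. 2 * (\<Sum>j<n. if E i j then (x j)\<^sup>2 else 0))"
    unfolding ip_def power2_eq_square by (intro sum_mono) auto
  also have "\<dots> = 2 * (\<Sum>j<n. \<Sum>i<n. if E i j then (x j)\<^sup>2 else 0)"
    unfolding sum_distrib_left[symmetric] by (subst sum.swap) simp
  also have "\<dots> \<le> 2 * (\<Sum>j<n. 2 * (x j)\<^sup>2)"
  proof (intro mult_left_mono sum_mono)
    fix j assume "j \<in> {..<n}"
    have "(\<Sum>i<n. if E i j then (x j)\<^sup>2 else 0) = (\<Sum>i\<in>{i. i < n \<and> E i j}. (x j)\<^sup>2)"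
      by (intro sum.mono_neutral_cong_right) auto
    also have "\<dots> = real (card {i. i < n \<and> E i j}) * (x j)\<^sup>2" by simp
    also have "\<dots> \<le> 2 * (x j)\<^sup>2"
    proof (cases "k \<le> j")
      case True
      then show ?thesis using assms(2)[of j] \<open>j \<in> {..<n}\<close> by (intro mult_right_mono) auto
    qed (simp add: x)
    finally show "(\<Sum>i<n. if E i j then (x j)\<^sup>2 else 0) \<le> 2 * (x j)\<^sup>2" .
  qed simp
  also have "\<dots> = 4 * ip x x" by (simp add: ip_def sum_distrib_left power2_eq_square)
  finally show ?thesis .
qed

lemma ip_sum: "ip y (\<lambda>i. \<Sum>j\<in>A. c j * X j i) = (\<Sum>j\<in>A. c j * ip y (X j))"
proof -
  have "ip y (\<lambda>i. \<Sum>j\<in>A. c j * X j i) = (\<Sum>i<n. \<Sum>j\<in>A. c j * (y i * X j i))"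
    unfolding ip_def sum_distrib_left by (intro sum.cong refl) (simp add: mult_ac)
  also have "\<dots> = (\<Sum>j\<in>A. c j * ip y (X j))"
    unfolding ip_def sum_distrib_left by (rule sum.swap)
  finally show ?thesis .
qed

lemma nb_sum: "nb (\<lambda>i. \<Sum>j\<in>A. c j * X j i) i = (\<Sum>j\<in>A. c j * nb (X j) i)"
proof -
  have "nb (\<lambda>i. \<Sum>j\<in>A. c j * X j i) i = (\<Sum>l<n. \<Sum>j\<in>A. c j * (if E i l then X j l else 0))"
    unfolding nb_def by (intro sum.cong refl) auto
  also have "\<dots> = (\<Sum>j\<in>A. c j * nb (X j) i)"
    unfolding nb_def sum_distrib_left by (rule sum.swap)
  finally show ?thesis .
qed

text \<open>
  Among \<open>k + 1\<close> eigenvectors some combination vanishes on the first \<open>k\<close> vertices, and on the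
  remaining ones the operator norm is at most \<open>2\<close>.
\<close>

lemma card_large_square_eigenvalues:
  assumes s1: "\<And>i. i < n \<Longrightarrow> card {j. k \<le> j \<and> j < n \<and> E i j} \<le> 2"
    and s2: "\<And>j. k \<le> j \<Longrightarrow> j < n \<Longrightarrow> card {i. i < n \<and> E i j} \<le> 2"
    and fin: "finite R" and R4: "\<And>r. r \<in> R \<Longrightarrow> r > 4"
    and X: "\<And>r. r \<in> R \<Longrightarrow> \<exists>i<n. X r i \<noteq> 0" "\<And>r i. r \<in> R \<Longrightarrow> i < n \<Longrightarrow> nb (nb (X r)) i = r * X r i"
  shows "card R \<le> k"
proof (rule ccontr)
  assume "\<not> card R \<le> k"
  then have "Suc k \<le> card R" by simp
  then obtain R' where R': "R' \<subseteq> R" "card R' = Suc k" by (metis obtain_subset_with_card_n)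
  obtain b where b: "bij_betw b {..k} R'"
    using ex_bij_betw_nat_finite[of R'] R' finite_subset[OF R'(1) fin]
    by (auto simp: atLeast0LessThan lessThan_Suc_atMost)
  have bR: "b j \<in> R" if "j \<le> k" for j using b R'(1) that by (auto simp: bij_betw_def)
  define Y where "Y j = X (b j)" for j
  obtain c where c: "\<exists>j\<le>k. c j \<noteq> 0" "\<forall>i<k. (\<Sum>j\<le>k. c j * Y j i) = 0"
    using exists_linear_dependence[of k "\<lambda>i j. Y j i"] by blast
  define x where "x i = (\<Sum>j\<le>k. c j * Y j i)" for i
  have nbY: "ip y (nb (nb (Y j))) = b j * ip y (Y j)" if "j \<le> k" for y j
  proof -
    have "ip y (nb (nb (Y j))) = ip y (\<lambda>i. b j * Y j i)"
      by (rule ip_cong) (auto simp: Y_def X(2)[OF bR[OF that]])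
    then show ?thesis by (simp add: ip_scale)
  qed
  have orth: "ip (Y i) (Y j) = 0" if ij: "i \<le> k" "j \<le> k" "i \<noteq> j" for i j
  proof -
    have "b j * ip (Y i) (Y j) = ip (Y i) (nb (nb (Y j)))" using nbY[OF ij(2)] by simp
    also have "\<dots> = ip (nb (nb (Y i))) (Y j)" by (simp add: ip_nb)
    also have "\<dots> = b i * ip (Y i) (Y j)" using nbY[OF ij(1), of "Y j"] by (simp add: ip_commute)
    finally have "(b j - b i) * ip (Y i) (Y j) = 0" by (simp add: algebra_simps)
    moreover have "b j \<noteq> b i" using b ij by (auto simp: bij_betw_def inj_on_def)
    ultimately show ?thesis by simp
  qed
  have ipY: "ip x (Y j) = c j * ip (Y j) (Y j)" if j: "j \<le> k" for j
  proof -
    have "ip x (Y j) = (\<Sum>i\<le>k. c i * ip (Y j) (Y i))"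
      using ip_sum[of "Y j" c Y "{..k}"] unfolding x_def by (simp add: ip_commute)
    also have "\<dots> = (\<Sum>i\<le>k. if i = j then c j * ip (Y j) (Y j) else 0)"
      by (intro sum.cong refl) (use orth[OF j] in auto)
    finally show ?thesis using j by simp
  qed
  have xx: "ip x x = (\<Sum>j\<le>k. (c j)\<^sup>2 * ip (Y j) (Y j))"
  proof -
    have "ip x x = (\<Sum>j\<le>k. c j * ip x (Y j))" using ip_sum[of x c Y "{..k}"] unfolding x_def[abs_def, symmetric] .
    also have "\<dots> = (\<Sum>j\<le>k. (c j)\<^sup>2 * ip (Y j) (Y j))"
      by (intro sum.cong refl) (simp add: ipY power2_eq_square)
    finally show ?thesis .
  qed
  \<comment> \<open>Both forms are diagonal in the orthogonal family \<open>Y\<close>, so they can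
    be compared term by term, each \<open>b j\<close> being above 4.\<close>
  have "ip (nb x) (nb x) = ip x (nb (nb x))" by (simp add: ip_nb)
  also have "\<dots> = ip x (\<lambda>i. \<Sum>j\<le>k. c j * nb (nb (Y j)) i)"
    unfolding x_def[abs_def] nb_sum[abs_def] ..
  also have "\<dots> = (\<Sum>j\<le>k. c j * ip x (nb (nb (Y j))))" by (rule ip_sum)
  also have "\<dots> = (\<Sum>j\<le>k. b j * ((c j)\<^sup>2 * ip (Y j) (Y j)))"
    by (intro sum.cong refl) (simp add: nbY ipY power2_eq_square)
  finally have nbx: "ip (nb x) (nb x) = (\<Sum>j\<le>k. b j * ((c j)\<^sup>2 * ip (Y j) (Y j)))" .
  have "ip (nb x) (nb x) \<le> 4 * ip x x"
    by (rule square_norm_le_on_sparse_part[OF s1 s2]) (use c(2) in \<open>auto simp: x_def\<close>)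
  moreover have "4 * ip x x < ip (nb x) (nb x)"
    unfolding nbx xx sum_distrib_left
  proof (rule sum_strict_mono_ex1)
    show "\<forall>j\<in>{..k}. 4 * ((c j)\<^sup>2 * ip (Y j) (Y j)) \<le> b j * ((c j)\<^sup>2 * ip (Y j) (Y j))"
      using R4[OF bR] ip_self_nonneg by (auto intro!: mult_right_mono intro: less_imp_le)
    obtain j where j: "j \<le> k" "c j \<noteq> 0" using c(1) by blast
    obtain i where i: "i < n" "Y j i \<noteq> 0" using X(1)[OF bR[OF j(1)]] by (auto simp: Y_def)
    have "4 * ((c j)\<^sup>2 * ip (Y j) (Y j)) < b j * ((c j)\<^sup>2 * ip (Y j) (Y j))"
      using R4[OF bR[OF j(1)]] j(2) ip_self_pos[of i "Y j"] i by (intro mult_strict_right_mono) auto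
    then show "\<exists>a\<in>{..k}. 4 * ((c a)\<^sup>2 * ip (Y a) (Y a)) < b a * ((c a)\<^sup>2 * ip (Y a) (Y a))"
      using j(1) by blast
  qed simp
  ultimately show False by linarith
qed

end

section \<open>Characteristic determinants\<close>

lemma poly_char_poly_eq_det:
  fixes x :: "'a :: field" and f :: "nat \<Rightarrow> nat \<Rightarrow> int"
  shows "poly (of_int_poly (char_poly (mat k k (\<lambda>(i, j). f i j)))) x =
    det (mat k k (\<lambda>(i, j). (if i = j then x else 0) - of_int (f i j)))"
proof -
  let ?A = "mat k k (\<lambda>(i, j). f i j)"
  have A: "?A \<in> carrier_mat k k" by simp
  have "of_int_poly (char_poly ?A) = (char_poly (map_mat of_int ?A) :: 'a poly)"
    using of_int_hom.char_poly_hom[OF A, where ?'a = 'a] by simp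
  then have "poly (of_int_poly (char_poly ?A)) x = det (- char_matrix (map_mat of_int ?A) x)"
    using char_poly_matrix[of "map_mat of_int ?A :: 'a mat" k x] by simp
  also have "- char_matrix (map_mat of_int ?A) x =
      mat k k (\<lambda>(i, j). (if i = j then x else 0) - of_int (f i j))"
    by (rule eq_matI) (auto simp: char_matrix_def)
  finally show ?thesis .
qed

text \<open>By expansion along row \<open>v\<close> the determinant is affine in
  \<open>\<theta>\<close>, with the (v, v) cofactor as slope. Writing the cofactor as the difference
  of the values at 0 and 1 keeps everything in terms of determinants of the same size.\<close>

lemma det_diagonal_entry_affine:
  fixes f :: "nat \<Rightarrow> nat \<Rightarrow> 'a :: comm_ring_1"
  assumes v: "v < k"
  shows "det (mat k k (\<lambda>(i, j). f i j - \<theta> * of_bool (i = v \<and> j = v))) =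
    det (mat k k (\<lambda>(i, j). f i j)) -
    \<theta> * (det (mat k k (\<lambda>(i, j). f i j)) - det (mat k k (\<lambda>(i, j). f i j - of_bool (i = v \<and> j = v))))"
proof -
  define B where "B t = mat k k (\<lambda>(i, j). f i j - t * of_bool (i = v \<and> j = v))" for t
  have B: "B t \<in> carrier_mat k k" for t by (simp add: B_def)
  have cof: "cofactor (B t) v j = cofactor (B 0) v j" for t j
  proof -
    have "mat_delete (B t) v j = mat_delete (B 0) v j"
      by (rule eq_matI) (auto simp: mat_delete_def B_def)
    then show ?thesis by (simp add: cofactor_def)
  qed
  have det: "det (B t) = det (B 0) - t * cofactor (B 0) v v" for t
  proof -
    have "det (B t) = (\<Sum>j<k. B t $$ (v, j) * cofactor (B t) v j)"
      by (rule laplace_expansion_row[OF B v])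
    also have "\<dots> = (\<Sum>j<k. B 0 $$ (v, j) * cofactor (B 0) v j - (if j = v then t * cofactor (B 0) v v else 0))"
      by (intro sum.cong refl, simp only: cof[of t]) (use v in \<open>auto simp: B_def algebra_simps\<close>)
    also have "\<dots> = (\<Sum>j<k. B 0 $$ (v, j) * cofactor (B 0) v j) - t * cofactor (B 0) v v"
      using v by (simp add: sum_subtractf)
    also have "(\<Sum>j<k. B 0 $$ (v, j) * cofactor (B 0) v j) = det (B 0)"
      by (rule laplace_expansion_row[OF B v, symmetric])
    finally show ?thesis .
  qed
  have "B 0 = mat k k (\<lambda>(i, j). f i j)" "B 1 = mat k k (\<lambda>(i, j). f i j - of_bool (i = v \<and> j = v))"
    by (auto simp: B_def)
  then show ?thesis using det[of \<theta>] det[of 1] by (simp add: B_def)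
qed

lemma abs_det_le:
  fixes f :: "nat \<Rightarrow> nat \<Rightarrow> real"
  assumes "\<And>i j. i < k \<Longrightarrow> j < k \<Longrightarrow> \<bar>f i j\<bar> \<le> c"
  shows "\<bar>det (mat k k (\<lambda>(i, j). f i j))\<bar> \<le> fact k * c ^ k"
proof -
  have "\<bar>det (mat k k (\<lambda>(i, j). f i j))\<bar> \<le>
      (\<Sum>p | p permutes {0..<k}. \<bar>signof p * (\<Prod>i = 0..<k. mat k k (\<lambda>(i, j). f i j) $$ (i, p i))\<bar>)"
    by (subst det_def'[of _ k]) auto
  also have "\<dots> \<le> (\<Sum>p | p permutes {0..<k}. c ^ k)"
  proof (intro sum_mono)
    fix p assume "p \<in> {p. p permutes {0..<k}}"
    then have p: "i < k \<Longrightarrow> p i < k" for i using permutes_in_image[of p "{0..<k}" i] by auto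
    have "\<bar>signof p * (\<Prod>i = 0..<k. mat k k (\<lambda>(i, j). f i j) $$ (i, p i))\<bar> = (\<Prod>i = 0..<k. \<bar>f i (p i)\<bar>)"
    proof -
      have "(\<Prod>i = 0..<k. mat k k (\<lambda>(i, j). f i j) $$ (i, p i)) = (\<Prod>i = 0..<k. f i (p i))"
        by (intro prod.cong refl) (use p in auto)
      then show ?thesis by (simp add: abs_mult abs_prod sign_def)
    qed
    also have "\<dots> \<le> (\<Prod>i = 0..<k. c)" by (intro prod_mono) (use assms p in auto)
    finally show "\<bar>signof p * (\<Prod>i = 0..<k. mat k k (\<lambda>(i, j). f i j) $$ (i, p i))\<bar> \<le> c ^ k" by simp
  qed
  also have "\<dots> = fact k * c ^ k" by (simp add: card_permutations)
  finally show ?thesis .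
qed

section \<open>Graphs with a long tail\<close>

text \<open>Vertices below \<open>k\<close> are the base and the tail is k, ..., n - 1, attached at
  \<open>v\<close>. Connectedness of the base is assumed in the form in which it is used: a nonempty
  vertex set closed under adjacency is everything.\<close>

locale tailed_graph = graph_matrix n E for n :: nat and E +
  fixes k m v :: nat
  assumes n_eq: "n = k + m" and m_pos: "m > 0" and v_less: "v < k"
    and tail_edge: "\<And>i j. k \<le> i \<Longrightarrow> k \<le> j \<Longrightarrow> E i j \<longleftrightarrow> i < n \<and> j < n \<and> (j = Suc i \<or> i = Suc j)"
    and link_edge: "\<And>i j. i < k \<Longrightarrow> k \<le> j \<Longrightarrow> E i j \<longleftrightarrow> i = v \<and> j = k"
    and base_connected: "\<And>S. S \<subseteq> {..<k} \<Longrightarrow> S \<noteq> {} \<Longrightarrow> (\<And>i j. i \<in> S \<Longrightarrow> j < k \<Longrightarrow> E i j \<Longrightarrow> j \<in> S) \<Longrightarrow> S = {..<k}"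
begin

lemma nb_tail:
  assumes "k \<le> i" "i < n"
  shows "nb x i = (if i = k then x v else x (i - 1)) + (if Suc i < n then x (Suc i) else 0)"
proof -
  let ?a = "if i = k then v else i - 1"
  have E: "E i j \<longleftrightarrow> j = ?a \<or> (j = Suc i \<and> Suc i < n)" if "j < n" for j
  proof (cases "j < k")
    case True
    then have "E i j \<longleftrightarrow> j = v \<and> i = k" using link_edge[of j i] assms sym_iff[of i j] by simp
    then show ?thesis using True assms by auto
  next
    case False
    then show ?thesis using tail_edge[of i j] assms that v_less by auto
  qed
  have a: "?a < n" using assms v_less n_eq by auto
  have ne: "?a \<noteq> Suc i" using assms v_less by auto
  have "nb x i = (\<Sum>j<n. (if j = ?a then x j else 0) + (if j = Suc i then x j else 0))"
    unfolding nb_def by (intro sum.cong refl) (use E ne in auto)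
  also have "\<dots> = x ?a + (if Suc i < n then x (Suc i) else 0)"
    unfolding sum.distrib using a by simp
  finally show ?thesis by simp
qed

lemma tail_degree_1:
  assumes "i < n"
  shows "card {j. k \<le> j \<and> j < n \<and> E i j} \<le> 2"
proof (cases "i < k")
  case True
  then have "{j. k \<le> j \<and> j < n \<and> E i j} \<subseteq> {k}" using link_edge by auto
  then have "card {j. k \<le> j \<and> j < n \<and> E i j} \<le> card {k}" by (intro card_mono) auto
  then show ?thesis by simp
next
  case False
  then have "{j. k \<le> j \<and> j < n \<and> E i j} \<subseteq> {i - 1, Suc i}" using tail_edge[of i] by auto
  then have "card {j. k \<le> j \<and> j < n \<and> E i j} \<le> card {i - 1, Suc i}" by (intro card_mono) auto
  also have "\<dots> \<le> 2" by (simp add: card_insert_if)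
  finally show ?thesis .
qed

lemma tail_degree_2:
  assumes "k \<le> j" "j < n"
  shows "card {i. i < n \<and> E i j} \<le> 2"
proof -
  have "{i. i < n \<and> E i j} \<subseteq> {if j = k then v else j - 1, Suc j}"
  proof
    fix i assume "i \<in> {i. i < n \<and> E i j}"
    then have i: "i < n" "E i j" by auto
    show "i \<in> {if j = k then v else j - 1, Suc j}"
    proof (cases "i < k")
      case True
      then show ?thesis using link_edge[of i j] i assms by auto
    next
      case False
      then show ?thesis using tail_edge[of i j] i assms by auto
    qed
  qed
  then have "card {i. i < n \<and> E i j} \<le> card {if j = k then v else j - 1, Suc j}" by (intro card_mono) auto
  also have "\<dots> \<le> 2" by (simp add: card_insert_if)
  finally show ?thesis .
qed

lemma degree_le:
  assumes "i < n"
  shows "card {j. j < n \<and> E i j} \<le> Suc k"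
proof (cases "i < k")
  case True
  then have "j \<le> k" if "E i j" for j using link_edge[of i j] that by (cases "k \<le> j") auto
  then have "{j. j < n \<and> E i j} \<subseteq> {..k}" by auto
  then have "card {j. j < n \<and> E i j} \<le> card {..k}" by (intro card_mono) auto
  then show ?thesis by simp
next
  case False
  have "{j. j < n \<and> E i j} = {j. j < n \<and> E j i}" by (auto dest: sym)
  then show ?thesis using tail_degree_2[of i] False assms v_less by auto
qed

context
  fixes r :: real and y :: "nat \<Rightarrow> real"
  assumes rb: "rayleigh_bound r" and y_nz: "\<exists>i<n. y i \<noteq> 0" and y_nonneg: "\<forall>i. y i \<ge> 0"
    and y_eig: "\<forall>i<n. nb y i = r * y i" and r2: "r > 2"
begin

text \<open>At a vertex where \<open>y\<close> is largest the eigenvalue is at most the degree,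
  which is at most k + 1.\<close>

lemma perron_le: "r \<le> real k + 1"
proof -
  obtain i where i: "i < n" "\<And>j. j < n \<Longrightarrow> y j \<le> y i"
  proof -
    have "Max (y ` {..<n}) \<in> y ` {..<n}" using n_pos by (intro Max_in) auto
    then obtain i where "i < n" "y i = Max (y ` {..<n})" by auto
    then show thesis using that[of i] by auto
  qed
  obtain l where "l < n" "y l \<noteq> 0" using y_nz by blast
  then have "y i > 0" using y_nonneg[rule_format, of l] i(2)[of l] by linarith
  have "r * y i = nb y i" using y_eig i by simp
  also have "\<dots> = (\<Sum>j\<in>{j. j < n \<and> E i j}. y j)"
    unfolding nb_def by (intro sum.mono_neutral_cong_right) auto
  also have "\<dots> \<le> (\<Sum>j\<in>{j. j < n \<and> E i j}. y i)" using i by (intro sum_mono) auto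
  also have "\<dots> = real (card {j. j < n \<and> E i j}) * y i" by simp
  also have "\<dots> \<le> (real k + 1) * y i"
    using degree_le[OF i(1)] \<open>y i > 0\<close> by (intro mult_right_mono) auto
  finally show ?thesis using \<open>y i > 0\<close> by simp
qed

lemma vanishes_on_base:
  assumes x: "\<forall>i. x i \<ge> 0" "\<forall>i<n. nb x i = r * x i" "x v = 0" "i < k"
  shows "x i = 0"
proof -
  have "{i. i < k \<and> x i = 0} = {..<k}"
  proof (rule base_connected)
    fix i j assume "i \<in> {i. i < k \<and> x i = 0}" "j < k" "E i j"
    then show "j \<in> {i. i < k \<and> x i = 0}" using zero_propagates[OF x(1), of i r j] x(2) n_eq by auto
  qed (use v_less x(3) in auto)
  then show ?thesis using x(4) by blast
qed

text \<open>The eigenvector read from the free end of the tail towards the base: \<open>g 0\<close>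
  is a virtual zero beyond the end, \<open>g m\<close> belongs to vertex \<open>k\<close> and
  \<open>g (Suc m)\<close> to \<open>v\<close>.\<close>

definition g :: "nat \<Rightarrow> real" where
  "g j = (if j = 0 then 0 else if j = Suc m then y v else y (n - j))"

lemma g_rec: "1 \<le> j \<Longrightarrow> j \<le> m \<Longrightarrow> g (Suc j) = r * g j - g (j - 1)"
proof -
  assume j: "1 \<le> j" "j \<le> m"
  have i: "k \<le> n - j" "n - j < n" using j n_eq by auto
  have a: "(if n - j = k then y v else y (n - j - 1)) = g (Suc j)"
    unfolding g_def using j n_eq by auto
  have b: "(if Suc (n - j) < n then y (Suc (n - j)) else 0) = g (j - 1)"
    unfolding g_def using j n_eq by (auto simp: Suc_diff_le)
  have "r * y (n - j) = g (Suc j) + g (j - 1)"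
    using nb_tail[OF i, of y] y_eig i unfolding a b by simp
  moreover have "g j = y (n - j)" using j by (simp add: g_def)
  ultimately show ?thesis by simp
qed

text \<open>The form X^2 - r X Y + Y^2 is preserved by the recursion, which exchanges the two roots
  of a quadratic with product fixed by the remaining data; its value is read off at the free end,
  where \<open>g 0 = 0\<close>.\<close>

lemma g_invariant: "j \<le> m \<Longrightarrow> (g (Suc j))\<^sup>2 - r * g j * g (Suc j) + (g j)\<^sup>2 = (g 1)\<^sup>2"
proof (induction j)
  case 0
  then show ?case by (simp add: g_def)
next
  case (Suc j)
  have "g (Suc (Suc j)) = r * g (Suc j) - g j" using g_rec[of "Suc j"] Suc.prems by simp
  then have "(g (Suc (Suc j)))\<^sup>2 - r * g (Suc j) * g (Suc (Suc j)) + (g (Suc j))\<^sup>2 =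
      (g (Suc j))\<^sup>2 - r * g j * g (Suc j) + (g j)\<^sup>2"
    by (simp only:) (simp add: power2_eq_square algebra_simps)
  then show ?case using Suc by simp
qed

lemma g_nonneg: "g j \<ge> 0" using y_nonneg by (simp add: g_def)

text \<open>For r > 2 the recursion is convex on nonnegative values: increments never fall below the
  first one.\<close>

lemma g_growth: "j \<le> m \<Longrightarrow> g (Suc j) - g j \<ge> g 1 \<and> g (Suc j) \<ge> (real j + 1) * g 1"
proof (induction j)
  case 0
  then show ?case by (simp add: g_def)
next
  case (Suc j)
  have "g (Suc (Suc j)) = r * g (Suc j) - g j" using g_rec[of "Suc j"] Suc.prems by simp
  moreover have "r * g (Suc j) \<ge> 2 * g (Suc j)" using r2 g_nonneg by (intro mult_right_mono) auto
  ultimately have "g (Suc (Suc j)) - g (Suc j) \<ge> g 1" using Suc by simp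
  moreover have "g (Suc j) \<ge> (real j + 1) * g 1" using Suc by simp
  ultimately show ?case by (simp add: algebra_simps)
qed

text \<open>If \<open>g 1\<close> vanished, the recursion would annihilate the tail and
  \<open>y v\<close>, and zeros would then spread over the connected base.\<close>

lemma g1_pos: "g 1 > 0"
proof (rule ccontr)
  assume "\<not> g 1 > 0"
  then have g1: "g 1 = 0" using g_nonneg[of 1] by simp
  have "g j = 0 \<and> g (Suc j) = 0" if "j \<le> m" for j
    using that
  proof (induction j)
    case 0
    then show ?case using g1 by (simp add: g_def)
  next
    case (Suc j)
    then show ?case using g_rec[of "Suc j"] by simp
  qed
  then have g0: "g j = 0" if "j \<le> Suc m" for j using that by (cases j) auto
  have yv: "y v = 0" using g0[of "Suc m"] by (simp add: g_def)
  have "y i = 0" if i: "i < n" for i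
  proof (cases "i < k")
    case True
    then show ?thesis using vanishes_on_base[OF y_nonneg y_eig yv] by blast
  next
    case False
    then have "g (n - i) = y i" unfolding g_def using i n_eq by auto
    then show ?thesis using g0[of "n - i"] False n_eq by simp
  qed
  then show False using y_nz by blast
qed

lemma yv_pos: "y v > 0"
proof -
  have "g (Suc m) \<ge> (real m + 1) * g 1" using g_growth[of m] by simp
  moreover have "(real m + 1) * g 1 > 0" using g1_pos by simp
  ultimately show ?thesis by (simp add: g_def)
qed

text \<open>The largest eigenvalue is not an eigenvalue of the proper connected subgraph \<open>\<Gamma>\<close>.\<close>

lemma base_det_nonzero: "det (mat k k (\<lambda>(i, j). (if i = j then r else 0) - of_bool (E i j))) \<noteq> 0"
proof
  let ?B = "mat k k (\<lambda>(i, j). (if i = j then r else 0) - of_bool (E i j))"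
  assume "det ?B = 0"
  then obtain w where w: "w \<in> carrier_vec k" "w \<noteq> 0\<^sub>v k" "?B *\<^sub>v w = 0\<^sub>v k"
    using det_0_iff_vec_prod_zero_field[of ?B k] by auto
  \<comment> \<open>A null vector for \<open>r\<close> on the base, made nonnegative and padded by
    zeros, attains the Rayleigh bound of the whole graph and is therefore an eigenvector there. It
    vanishes at \<open>k\<close>, hence at the neighbour \<open>v\<close>, hence on the
    base.\<close>
  define x where "x i = (if i < k then \<bar>w $ i\<bar> else 0)" for i
  define x0 where "x0 i = (if i < k then w $ i else 0)" for i
  have eq: "nb x0 i = r * x0 i" if i: "i < k" for i
  proof -
    have "0 = (?B *\<^sub>v w) $ i" using w(3) i by simp
    also have "\<dots> = (\<Sum>j<k. ((if i = j then r else 0) - of_bool (E i j)) * w $ j)"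
      using i w(1) by (simp add: scalar_prod_def atLeast0LessThan)
    also have "\<dots> = (\<Sum>j<k. (if j = i then r * w $ j else 0) - (if E i j then w $ j else 0))"
      by (intro sum.cong refl) (auto simp: irrefl)
    also have "\<dots> = r * w $ i - (\<Sum>j<k. if E i j then w $ j else 0)"
      using i by (simp add: sum_subtractf)
    also have "(\<Sum>j<k. if E i j then w $ j else 0) = nb x0 i"
      unfolding nb_def by (intro sum.mono_neutral_cong_left) (auto simp: x0_def n_eq)
    finally show ?thesis using i by (simp add: x0_def)
  qed
  have "ip x0 (nb x0) = r * ip x0 x0"
  proof -
    have "ip x0 (nb x0) = (\<Sum>i<n. r * (x0 i * x0 i))"
      unfolding ip_def by (intro sum.cong refl) (use eq in \<open>auto simp: x0_def\<close>)
    then show ?thesis by (simp add: ip_def sum_distrib_left)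
  qed
  moreover have "x = (\<lambda>i. \<bar>x0 i\<bar>)" by (auto simp: x_def x0_def)
  ultimately have "ip x (nb x) \<ge> r * ip x0 x0" using rayleigh_abs[of x0] by simp
  moreover have "ip x x = ip x0 x0" unfolding ip_def by (intro sum.cong refl) (simp add: x_def x0_def)
  ultimately have "ip x (nb x) = r * ip x x" using rb unfolding rayleigh_bound_def by (metis antisym)
  then have eig: "\<forall>i<n. nb x i = r * x i" using maximiser_is_eigenvector[OF rb] by blast
  have x0: "\<forall>i. x i \<ge> 0" by (simp add: x_def)
  have "x k = 0" by (simp add: x_def)
  moreover have "E k v" using link_edge[of v k] v_less sym_iff[of k v] by simp
  moreover have "k < n" using n_eq m_pos by simp
  ultimately have "x v = 0" using zero_propagates[OF x0, of k r v] eig by blast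
  then have "x i = 0" if "i < k" for i using vanishes_on_base[OF x0 eig] that by blast
  then have "w $ i = 0" if "i < k" for i using that by (simp add: x_def)
  then have "w = 0\<^sub>v k" using w(1) by (intro eq_vecI) auto
  then show False using w(2) by blast
qed

text \<open>The tail enters the eigenvalue equations of the base only through y k = theta y v at
  \<open>v\<close>. So \<open>y\<close> restricted to the base is a null vector of the base matrix
  with \<open>\<theta>\<close> subtracted at (v, v), and the vanishing determinant is affine in
  \<open>\<theta>\<close>. The difference P - P1 is the cofactor at (v, v), that is, the value for
  the base with \<open>v\<close> deleted.\<close>

lemma base_relation:
  defines "P \<equiv> det (mat k k (\<lambda>(i, j). (if i = j then r else 0) - of_bool (E i j)))"
    and "P1 \<equiv> det (mat k k (\<lambda>(i, j). (if i = j then r else 0) - of_bool (E i j) - of_bool (i = v \<and> j = v)))"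
  shows "P * g (Suc m) = (P - P1) * g m" "P - P1 \<noteq> 0"
proof -
  define \<theta> where "\<theta> = g m / g (Suc m)"
  have gm: "g (Suc m) = y v" by (simp add: g_def)
  have gk: "g m = y k" unfolding g_def using m_pos n_eq by auto
  let ?B = "mat k k (\<lambda>(i, j). ((if i = j then r else 0) - of_bool (E i j)) - \<theta> * of_bool (i = v \<and> j = v))"
  have "?B *\<^sub>v vec k y = 0\<^sub>v k"
  proof (rule eq_vecI)
    fix i assume "i < dim_vec (0\<^sub>v k :: real vec)"
    then have i: "i < k" by simp
    have "(?B *\<^sub>v vec k y) $ i =
        (\<Sum>j<k. (((if i = j then r else 0) - of_bool (E i j)) - \<theta> * of_bool (i = v \<and> j = v)) * y j)"
      using i by (simp add: scalar_prod_def atLeast0LessThan)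
    also have "\<dots> = (\<Sum>j<k. (if j = i then r * y j else 0) - (if E i j then y j else 0) -
        (if j = v then of_bool (i = v) * (\<theta> * y j) else 0))"
      by (intro sum.cong refl) (auto simp: irrefl left_diff_distrib)
    also have "\<dots> = r * y i - (\<Sum>j<k. if E i j then y j else 0) - of_bool (i = v) * (\<theta> * y v)"
      using i v_less by (simp add: sum_subtractf)
    also have "r * y i = nb y i" using y_eig i n_eq by simp
    also have "nb y i = (\<Sum>j<k. if E i j then y j else 0) + of_bool (i = v) * y k"
    proof -
      have "nb y i = (\<Sum>j\<in>{..<k} \<union> {k..<n}. if E i j then y j else 0)"
        unfolding nb_def using n_eq by (intro sum.cong) auto
      also have "\<dots> = (\<Sum>j<k. if E i j then y j else 0) + (\<Sum>j\<in>{k..<n}. if E i j then y j else 0)"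
        by (intro sum.union_disjoint) auto
      also have "(\<Sum>j\<in>{k..<n}. if E i j then y j else 0) = (\<Sum>j\<in>{k..<n}. if j = k then of_bool (i = v) * y k else 0)"
        by (intro sum.cong refl) (use link_edge[OF i] in auto)
      also have "\<dots> = of_bool (i = v) * y k" using m_pos n_eq by simp
      finally show ?thesis .
    qed
    also have "\<theta> * y v = y k" using yv_pos by (simp add: \<theta>_def gm gk)
    finally show "(?B *\<^sub>v vec k y) $ i = 0\<^sub>v k $ i" using i by simp
  qed simp
  moreover have "vec k y \<noteq> 0\<^sub>v k" using yv_pos v_less by (metis index_vec index_zero_vec(1) less_irrefl)
  moreover have B: "?B \<in> carrier_mat k k" by simp
  ultimately have "det ?B = 0"
    unfolding det_0_iff_vec_prod_zero_field[OF B] using vec_carrier[of k y] by blast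
  then have "P - \<theta> * (P - P1) = 0"
    using det_diagonal_entry_affine[OF v_less, of "\<lambda>i j. (if i = j then r else 0) - of_bool (E i j)" \<theta>]
    unfolding P_def P1_def by simp
  then have P: "P = \<theta> * (P - P1)" by (simp only: right_minus_eq)
  have "P * g (Suc m) = (\<theta> * (P - P1)) * g (Suc m)" by (rule arg_cong[OF P])
  also have "\<dots> = (P - P1) * (\<theta> * g (Suc m))" by (simp only: mult_ac)
  also have "\<theta> * g (Suc m) = g m" using yv_pos by (simp add: \<theta>_def gm)
  finally show "P * g (Suc m) = (P - P1) * g m" .
  have "P \<noteq> 0" unfolding P_def by (rule base_det_nonzero)
  then show "P - P1 \<noteq> 0" using P by (metis mult_zero_right)
qed

text \<open>Put Q = P - P1. The pairs (P, Q) and (g m, g (m + 1)) are proportional, so the conserved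
  form at (P, Q) equals Q^2 (g 1 / g (m + 1))^2; this is positive, and linear growth bounds the
  quotient by 1 / (m + 1).\<close>

lemma small_value:
  defines "P \<equiv> det (mat k k (\<lambda>(i, j). (if i = j then r else 0) - of_bool (E i j)))"
    and "P1 \<equiv> det (mat k k (\<lambda>(i, j). (if i = j then r else 0) - of_bool (E i j) - of_bool (i = v \<and> j = v)))"
  shows "P\<^sup>2 - r * P * (P - P1) + (P - P1)\<^sup>2 > 0"
    "(P\<^sup>2 - r * P * (P - P1) + (P - P1)\<^sup>2) * (real m + 1)\<^sup>2 \<le> (P - P1)\<^sup>2"
proof -
  note rel = base_relation[folded P_def P1_def]
  define Q where "Q = P - P1"
  have PQ: "P * g (Suc m) = Q * g m" "Q \<noteq> 0" using rel by (simp_all add: Q_def)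
  have "(P\<^sup>2 - r * P * Q + Q\<^sup>2) * (g (Suc m))\<^sup>2 =
      (P * g (Suc m))\<^sup>2 - r * (P * g (Suc m)) * (Q * g (Suc m)) + (Q * g (Suc m))\<^sup>2"
    by (simp add: power2_eq_square algebra_simps)
  also have "\<dots> = Q\<^sup>2 * ((g (Suc m))\<^sup>2 - r * g m * g (Suc m) + (g m)\<^sup>2)"
    unfolding PQ(1) by (simp add: power2_eq_square algebra_simps)
  also have "\<dots> = Q\<^sup>2 * (g 1)\<^sup>2" using g_invariant[of m] by simp
  finally have eq: "(P\<^sup>2 - r * P * Q + Q\<^sup>2) * (g (Suc m))\<^sup>2 = Q\<^sup>2 * (g 1)\<^sup>2" .
  have gm: "(g (Suc m))\<^sup>2 > 0" using yv_pos by (simp add: g_def)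
  have rhs: "Q\<^sup>2 * (g 1)\<^sup>2 > 0" using PQ(2) g1_pos by simp
  then have pos: "P\<^sup>2 - r * P * Q + Q\<^sup>2 > 0"
    using eq gm by (metis zero_less_mult_pos2)
  then show "P\<^sup>2 - r * P * (P - P1) + (P - P1)\<^sup>2 > 0" by (simp add: Q_def)
  have "((real m + 1) * g 1)\<^sup>2 \<le> (g (Suc m))\<^sup>2"
    using g_growth[of m] g1_pos by (intro power_mono) auto
  then have "(P\<^sup>2 - r * P * Q + Q\<^sup>2) * ((real m + 1) * g 1)\<^sup>2 \<le> Q\<^sup>2 * (g 1)\<^sup>2"
    using pos eq by (metis less_imp_le mult_left_mono)
  then have "((P\<^sup>2 - r * P * Q + Q\<^sup>2) * (real m + 1)\<^sup>2) * (g 1)\<^sup>2 \<le> Q\<^sup>2 * (g 1)\<^sup>2"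
    by (simp add: power_mult_distrib mult.assoc)
  then have "(P\<^sup>2 - r * P * Q + Q\<^sup>2) * (real m + 1)\<^sup>2 \<le> Q\<^sup>2" using g1_pos by simp
  then show "(P\<^sup>2 - r * P * (P - P1) + (P - P1)\<^sup>2) * (real m + 1)\<^sup>2 \<le> (P - P1)\<^sup>2" by (simp add: Q_def)
qed

end

end

section \<open>Eigenvalues of Dynkin diagrams\<close>

lemma exists_add_inverse_complex:
  obtains \<zeta> :: complex where "\<zeta> \<noteq> 0" "\<mu> = \<zeta> + inverse \<zeta>"
proof
  define t where "t = (\<mu> + csqrt (\<mu>\<^sup>2 - 4)) / 2"
  have "t * (\<mu> - t) = (\<mu>\<^sup>2 - (csqrt (\<mu>\<^sup>2 - 4))\<^sup>2) / 4"
    unfolding t_def by (simp add: field_simps power2_eq_square)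
  then have e: "t * (\<mu> - t) = 1" by (simp add: power2_csqrt)
  then show "t \<noteq> 0" by auto
  have "inverse t = \<mu> - t" by (rule inverse_unique[OF e])
  then show "\<mu> = t + inverse t" by simp
qed

text \<open>The usual closed form, multiplied out by \<open>\<zeta> - inverse \<zeta>\<close> so
  that it remains valid when this difference is zero.\<close>

lemma linear_recurrence_solution:
  fixes \<zeta> :: complex
  assumes "\<zeta> \<noteq> 0" "U 0 = 0" "\<And>j. 1 \<le> j \<Longrightarrow> j < N \<Longrightarrow> U (Suc j) = (\<zeta> + inverse \<zeta>) * U j - U (j - 1)" "j \<le> N"
  shows "U j * (\<zeta> - inverse \<zeta>) = U 1 * (\<zeta> ^ j - inverse \<zeta> ^ j)"
  using assms(4)
proof (induction j rule: less_induct)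
  case (less j)
  consider "j = 0" | "j = 1" | i where "j = Suc (Suc i)"
    by (metis One_nat_def not0_implies_Suc)
  then show ?case
  proof cases
    case (3 i)
    have rec: "U (Suc (Suc i)) = (\<zeta> + inverse \<zeta>) * U (Suc i) - U i"
      using assms(3)[of "Suc i"] less.prems 3 by simp
    have e: "\<zeta> * (inverse \<zeta> * y) = y" "inverse \<zeta> * (\<zeta> * y) = y" for y
      using assms(1) by (metis mult.assoc mult_1 right_inverse left_inverse)+
    have "U j * (\<zeta> - inverse \<zeta>) =
        (\<zeta> + inverse \<zeta>) * (U (Suc i) * (\<zeta> - inverse \<zeta>)) - U i * (\<zeta> - inverse \<zeta>)"
      unfolding 3 rec by (simp add: algebra_simps)
    also have "\<dots> = (\<zeta> + inverse \<zeta>) * (U 1 * (\<zeta> ^ Suc i - inverse \<zeta> ^ Suc i)) - U 1 * (\<zeta> ^ i - inverse \<zeta> ^ i)"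
      using less 3 by simp
    also have "\<dots> = U 1 * ((\<zeta> + inverse \<zeta>) * (\<zeta> ^ Suc i - inverse \<zeta> ^ Suc i) - (\<zeta> ^ i - inverse \<zeta> ^ i))"
      by (simp only: right_diff_distrib mult_ac)
    also have "(\<zeta> + inverse \<zeta>) * (\<zeta> ^ Suc i - inverse \<zeta> ^ Suc i) - (\<zeta> ^ i - inverse \<zeta> ^ i) =
        \<zeta> ^ j - inverse \<zeta> ^ j"
      unfolding 3 power_Suc distrib_right right_diff_distrib e by simp
    finally show ?thesis .
  qed (use assms(2) in auto)
qed

lemma recurrence_zero:
  fixes U :: "nat \<Rightarrow> complex"
  assumes "U 0 = 0" "U 1 = 0" "\<And>j. 1 \<le> j \<Longrightarrow> j < N \<Longrightarrow> U (Suc j) = \<mu> * U j - U (j - 1)" "j \<le> N"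
  shows "U j = 0"
  using assms(4)
proof (induction j rule: less_induct)
  case (less j)
  consider "j = 0" | "j = 1" | i where "j = Suc (Suc i)"
    by (metis One_nat_def not0_implies_Suc)
  then show ?case
  proof cases
    case (3 i)
    then show ?thesis using assms(3)[of "Suc i"] less by simp
  qed (use assms in auto)
qed

lemma root_of_unity_if_inverse_eq:
  assumes "\<zeta> \<noteq> 0" "\<zeta> - inverse \<zeta> = 0"
  shows "root_of_unity \<zeta>"
proof -
  have "\<zeta> * \<zeta> = \<zeta> * inverse \<zeta>" using assms(2) by simp
  then have "\<zeta> ^ 2 = 1" using assms(1) by (simp add: power2_eq_square)
  then show ?thesis unfolding root_of_unity_def by (intro exI[of _ 2]) simp
qed

definition path_adj :: "nat \<Rightarrow> nat \<Rightarrow> bool" where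
  "path_adj i j \<longleftrightarrow> j = Suc i \<or> i = Suc j"

definition fork_adj :: "nat \<Rightarrow> nat \<Rightarrow> nat \<Rightarrow> bool" where
  "fork_adj n i j \<longleftrightarrow> (j = Suc i \<and> Suc i < n - 1) \<or> (i = Suc j \<and> Suc j < n - 1) \<or>
    (i = n - 3 \<and> j = n - 1) \<or> (i = n - 1 \<and> j = n - 3)"

lemma path_eigenvalue:
  fixes u :: "nat \<Rightarrow> complex"
  assumes nz: "\<exists>i<n. u i \<noteq> 0"
    and eig: "\<And>i. i < n \<Longrightarrow> (\<Sum>j<n. if path_adj i j then u j else 0) = \<mu> * u i"
  shows "\<exists>\<zeta>. root_of_unity \<zeta> \<and> \<mu> = \<zeta> + inverse \<zeta>"
proof -
  obtain \<zeta> where z: "\<zeta> \<noteq> 0" "\<mu> = \<zeta> + inverse \<zeta>" using exists_add_inverse_complex by blast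
  \<comment> \<open>Indices are shifted by one and padded by zeros at 0 and n + 1, so that the
    equations at both ends become instances of the recursion; the zero at n + 1 then makes zeta^(2 n
    + 2) equal to 1.\<close>
  define U where "U j = (if j = 0 \<or> j > n then 0 else u (j - 1))" for j
  have rec: "U (Suc j) = \<mu> * U j - U (j - 1)" if j: "1 \<le> j" "j < Suc n" for j
  proof -
    have "\<mu> * u (j - 1) = (\<Sum>l<n. if path_adj (j - 1) l then u l else 0)"
      using eig[of "j - 1"] j by simp
    also have "\<dots> = (\<Sum>l<n. (if l = j then u l else 0) + (if Suc l = j - 1 then u l else 0))"
      by (intro sum.cong refl) (use j in \<open>auto simp: path_adj_def\<close>)
    also have "\<dots> = U (Suc j) + U (j - 1)"
    proof -
      have "(\<Sum>l<n. if l = j then u l else 0) = U (Suc j)" using j by (auto simp: U_def)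
      moreover have "(\<Sum>l<n. if Suc l = j - 1 then u l else 0) = U (j - 1)"
      proof (cases "j = 1")
        case False
        then have "(\<Sum>l<n. if Suc l = j - 1 then u l else 0) = (\<Sum>l<n. if l = j - 2 then u l else 0)"
          using j by (intro sum.cong) auto
        then show ?thesis using False j by (auto simp: U_def numeral_2_eq_2)
      qed (simp add: U_def)
      ultimately show ?thesis by (simp add: sum.distrib)
    qed
    finally show ?thesis using j by (simp add: U_def)
  qed
  have "U 1 \<noteq> 0"
  proof
    assume U1: "U 1 = 0"
    obtain i where i: "i < n" "u i \<noteq> 0" using nz by blast
    have "U (Suc i) = 0"
      by (rule recurrence_zero[of U "Suc n" \<mu>]) (use U1 rec i in \<open>auto simp: U_def[of 0]\<close>)
    then show False using i by (simp add: U_def)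
  qed
  moreover have "U (Suc n) * (\<zeta> - inverse \<zeta>) = U 1 * (\<zeta> ^ Suc n - inverse \<zeta> ^ Suc n)"
    by (rule linear_recurrence_solution[OF z(1), of U "Suc n"]) (use rec z(2) in \<open>auto simp: U_def[of 0]\<close>)
  moreover have "U (Suc n) = 0" by (simp add: U_def)
  ultimately have e: "\<zeta> ^ Suc n = inverse \<zeta> ^ Suc n" by simp
  have "\<zeta> ^ (Suc n + Suc n) = inverse \<zeta> ^ Suc n * \<zeta> ^ Suc n" unfolding power_add e ..
  also have "\<dots> = 1" by (simp only: power_mult_distrib[symmetric] left_inverse[OF z(1)] power_one)
  finally have "root_of_unity \<zeta>" unfolding root_of_unity_def by (intro exI[of _ "Suc n + Suc n"]) simp
  then show ?thesis using z(2) by blast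
qed

text \<open>Adding the two leaf entries folds the fork into a path whose last equation is mu U(s +
  2) = 2 U(s + 1); in terms of zeta it factors as (zeta - 1/zeta)(zeta^(s+2) + zeta^-(s+2)) = 0. For
  mu = 0 an eigenvector may live on the two leaves alone with opposite signs, so that case is
  settled directly by zeta = i.\<close>

lemma fork_eigenvalue:
  fixes u :: "nat \<Rightarrow> complex"
  assumes n: "n \<ge> 4" and nz: "\<exists>i<n. u i \<noteq> 0"
    and eig: "\<And>i. i < n \<Longrightarrow> (\<Sum>j<n. if fork_adj n i j then u j else 0) = \<mu> * u i"
  shows "\<exists>\<zeta>. root_of_unity \<zeta> \<and> \<mu> = \<zeta> + inverse \<zeta>"
proof (cases "\<mu> = 0")
  case True
  have "root_of_unity \<i>" unfolding root_of_unity_def by (intro exI[of _ 4]) simp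
  moreover have "\<mu> = \<i> + inverse \<i>" using True by simp
  ultimately show ?thesis by blast
next
  case False
  obtain \<zeta> where z: "\<zeta> \<noteq> 0" "\<mu> = \<zeta> + inverse \<zeta>" using exists_add_inverse_complex by blast
  define s where "s = n - 3"
  have ns: "n = s + 3" "s \<ge> 1" using n by (auto simp: s_def)
  have F: "fork_adj n i j \<longleftrightarrow> (j = Suc i \<and> i \<le> s) \<or> (i = Suc j \<and> j \<le> s) \<or>
      (i = s \<and> j = s + 2) \<or> (i = s + 2 \<and> j = s)" for i j
    unfolding fork_adj_def ns by auto
  have sum: "(\<Sum>j<n. if fork_adj n i j then u j else 0) = (\<Sum>j\<in>A. u j)"
    if "A = {j. j < n \<and> fork_adj n i j}" for i A
    unfolding that by (intro sum.mono_neutral_cong_right) auto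
  have a: "\<mu> * u (s + 1) = u s"
  proof -
    have A: "{s} = {j. j < n \<and> fork_adj n (s + 1) j}" unfolding F using ns by auto
    show ?thesis using sum[OF A] eig[of "s + 1"] ns by simp
  qed
  have b: "\<mu> * u (s + 2) = u s"
  proof -
    have A: "{s} = {j. j < n \<and> fork_adj n (s + 2) j}" unfolding F using ns by auto
    show ?thesis using sum[OF A] eig[of "s + 2"] ns by simp
  qed
  have c: "\<mu> * u s = u (s - 1) + (u (s + 1) + u (s + 2))"
  proof -
    have A: "{s - 1, s + 1, s + 2} = {j. j < n \<and> fork_adj n s j}" unfolding F using ns by auto
    have "s - Suc 0 \<noteq> Suc s" "s - Suc 0 \<noteq> Suc (Suc s)" by linarith+
    then show ?thesis using sum[OF A] eig[of s] ns by simp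
  qed
  have 0: "\<mu> * u 0 = u 1"
  proof -
    have A: "{1} = {j. j < n \<and> fork_adj n 0 j}" unfolding F using ns by auto
    show ?thesis using sum[OF A] eig[of 0] ns by simp
  qed
  have inner: "\<mu> * u i = u (i - 1) + u (i + 1)" if i: "1 \<le> i" "i < s" for i
  proof -
    have A: "{i - 1, i + 1} = {j. j < n \<and> fork_adj n i j}" unfolding F using ns i by auto
    show ?thesis using sum[OF A] eig[of i] ns i by simp
  qed
  \<comment> \<open>The last entry is the sum over both leaves, which is what the equation at the
    branch vertex \<open>s\<close> sees.\<close>
  define U where "U j = (if j = 0 then 0 else if j = s + 2 then u (s + 1) + u (s + 2) else u (j - 1))" for j
  have rec: "U (Suc j) = \<mu> * U j - U (j - 1)" if j: "1 \<le> j" "j < s + 2" for j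
  proof -
    consider "j = 1" | "j = s + 1" | "1 < j" "j < s + 1" using j by linarith
    then show ?thesis
    proof cases
      case 1
      then show ?thesis using 0 ns by (simp add: U_def)
    next
      case 2
      then show ?thesis using c ns by (simp add: U_def)
    next
      case 3
      then have "\<mu> * u (j - 1) = u (j - 2) + u j" using inner[of "j - 1"] by (simp add: numeral_2_eq_2)
      then show ?thesis using 3 by (auto simp: U_def numeral_2_eq_2)
    qed
  qed
  have U1: "U 1 \<noteq> 0"
  proof
    assume U1: "U 1 = 0"
    have U0: "U j = 0" if "j \<le> s + 2" for j
      by (rule recurrence_zero[of U "s + 2" \<mu>]) (use U1 rec that in \<open>auto simp: U_def[of 0]\<close>)
    have us: "u i = 0" if "i \<le> s" for i using U0[of "Suc i"] that by (simp add: U_def)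
    have "u (s + 1) = 0" "u (s + 2) = 0" using a b us[of s] False by simp_all
    then have "u i = 0" if "i < n" for i
    proof (cases "i \<le> s")
      case False
      then have "i = s + 1 \<or> i = s + 2" using that ns by linarith
      then show ?thesis using \<open>u (s + 1) = 0\<close> \<open>u (s + 2) = 0\<close> by blast
    qed (rule us)
    then show False using nz by blast
  qed
  have sol: "U j * (\<zeta> - inverse \<zeta>) = U 1 * (\<zeta> ^ j - inverse \<zeta> ^ j)" if "j \<le> s + 2" for j
    by (rule linear_recurrence_solution[OF z(1), of U "s + 2"]) (use rec z(2) that in \<open>auto simp: U_def[of 0]\<close>)
  have "\<mu> * U (s + 2) = 2 * U (s + 1)" using a b ns by (simp add: U_def distrib_left)
  have s1: "s + 1 \<le> s + 2" by simp
  from \<open>\<mu> * U (s + 2) = 2 * U (s + 1)\<close>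
  have "\<mu> * (U (s + 2) * (\<zeta> - inverse \<zeta>)) = 2 * (U (s + 1) * (\<zeta> - inverse \<zeta>))"
    by (simp only: mult.assoc[symmetric])
  then have "\<mu> * (U 1 * (\<zeta> ^ (s + 2) - inverse \<zeta> ^ (s + 2))) = 2 * (U 1 * (\<zeta> ^ (s + 1) - inverse \<zeta> ^ (s + 1)))"
    unfolding sol[OF order.refl] sol[OF s1] .
  then have "U 1 * (\<mu> * (\<zeta> ^ (s + 2) - inverse \<zeta> ^ (s + 2))) = U 1 * (2 * (\<zeta> ^ (s + 1) - inverse \<zeta> ^ (s + 1)))"
    by (simp only: mult.left_commute)
  then have e: "\<mu> * (\<zeta> ^ (s + 2) - inverse \<zeta> ^ (s + 2)) - 2 * (\<zeta> ^ (s + 1) - inverse \<zeta> ^ (s + 1)) = 0"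
    using U1 by simp
  have c: "\<zeta> * (inverse \<zeta> * y) = y" "inverse \<zeta> * (\<zeta> * y) = y" for y
    using z(1) by (metis mult.assoc mult_1 right_inverse left_inverse)+
  have "\<mu> * (\<zeta> ^ (s + 2) - inverse \<zeta> ^ (s + 2)) - 2 * (\<zeta> ^ (s + 1) - inverse \<zeta> ^ (s + 1)) =
      (\<zeta> - inverse \<zeta>) * (\<zeta> ^ (s + 2) + inverse \<zeta> ^ (s + 2))"
    unfolding z(2) by (simp add: algebra_simps c)
  then have "(\<zeta> - inverse \<zeta>) * (\<zeta> ^ (s + 2) + inverse \<zeta> ^ (s + 2)) = 0" using e by simp
  then consider "\<zeta> - inverse \<zeta> = 0" | "\<zeta> ^ (s + 2) = - (inverse \<zeta> ^ (s + 2))"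
    by (auto simp: eq_neg_iff_add_eq_0)
  then have "root_of_unity \<zeta>"
  proof cases
    case 1
    then show ?thesis using root_of_unity_if_inverse_eq z(1) by blast
  next
    case 2
    have "\<zeta> ^ (s + 2) * \<zeta> ^ (s + 2) = - (inverse \<zeta> ^ (s + 2) * \<zeta> ^ (s + 2))" unfolding 2 by simp
    also have "\<dots> = - 1" by (simp only: power_mult_distrib[symmetric] left_inverse[OF z(1)] power_one)
    finally have "(\<zeta> ^ (s + 2) * \<zeta> ^ (s + 2)) ^ 2 = 1" by simp
    then have "\<zeta> ^ ((s + 2 + (s + 2)) * 2) = 1" by (simp only: power_mult power_add)
    then show ?thesis unfolding root_of_unity_def by (intro exI[of _ "(s + 2 + (s + 2)) * 2"]) simp
  qed
  then show ?thesis using z(2) by blast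
qed

section \<open>Graphs with a long tail and largest eigenvalue at most 2\<close>

context tailed_graph begin

lemma nb_eq_sum_neighbours: "nb x i = (\<Sum>j | E i j. x j)"
  unfolding nb_def by (intro sum.mono_neutral_cong_right) (auto dest: sym bound)

lemma finite_neighbours: "finite {j. E i j}"
  by (rule finite_subset[of _ "{..<n}"]) (auto dest: sym bound)

lemma nb_ge:
  assumes "\<forall>i. x i \<ge> 0" "A \<subseteq> {j. E i j}"
  shows "nb x i \<ge> (\<Sum>j\<in>A. x j)"
  unfolding nb_eq_sum_neighbours using assms finite_neighbours by (intro sum_mono2) auto

lemma closed_contains_all:
  assumes "S \<subseteq> {..<n}" "{k..<n} \<subseteq> S" "v \<in> S" "\<And>i j. i \<in> S \<Longrightarrow> E i j \<Longrightarrow> j \<in> S"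
  shows "S = {..<n}"
proof -
  have "S \<inter> {..<k} = {..<k}"
  proof (rule base_connected)
    fix i j assume "i \<in> S \<inter> {..<k}" "j < k" "E i j"
    then show "j \<in> S \<inter> {..<k}" using assms(4) by auto
  qed (use assms v_less in auto)
  then have "{..<k} \<subseteq> S" by blast
  moreover have "{..<n} \<subseteq> {..<k} \<union> {k..<n}" by auto
  ultimately show ?thesis using assms(1,2) by blast
qed

text \<open>A path starting at the end of the tail whose vertices before the last one have no other neighbours.\<close>

definition walk :: "nat \<Rightarrow> (nat \<Rightarrow> nat) \<Rightarrow> bool" where
  "walk s z \<longleftrightarrow> m \<le> s \<and> (\<forall>i<m. z i = n - 1 - i) \<and> z m = v \<and> inj_on z {..s} \<and> (\<forall>i\<le>s. z i < n) \<and>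
    (\<forall>i<s. {j. E (z i) j} = (if i = 0 then {} else {z (i - 1)}) \<union> {z (Suc i)})"

lemma walk_tail: "walk m (\<lambda>i. if i < m then n - 1 - i else v)"
proof -
  let ?z = "\<lambda>i. if i < m then n - 1 - i else v"
  have "{j. E (?z i) j} = (if i = 0 then {} else {?z (i - 1)}) \<union> {?z (Suc i)}" if i: "i < m" for i
  proof -
    have z: "?z i = n - 1 - i" "k \<le> n - 1 - i" "n - 1 - i < n" using i n_eq by auto
    have "E (n - 1 - i) j \<longleftrightarrow> j \<in> (if i = 0 then {} else {?z (i - 1)}) \<union> {?z (Suc i)}" for j
    proof (cases "j < k")
      case True
      have "E (n - 1 - i) j \<longleftrightarrow> j = v \<and> n - 1 - i = k"
        using link_edge[OF True z(2)] sym_iff[of "n - 1 - i" j] by simp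
      also have "\<dots> \<longleftrightarrow> j \<in> (if i = 0 then {} else {?z (i - 1)}) \<union> {?z (Suc i)}"
        using True i n_eq by auto
      finally show ?thesis .
    next
      case False
      then have "E (n - 1 - i) j \<longleftrightarrow> j < n \<and> (j = Suc (n - 1 - i) \<or> n - 1 - i = Suc j)"
        using tail_edge[OF z(2), of j] z(3) by simp
      also have "\<dots> \<longleftrightarrow> j \<in> (if i = 0 then {} else {?z (i - 1)}) \<union> {?z (Suc i)}"
        using False i n_eq v_less by auto
      finally show ?thesis .
    qed
    then show ?thesis unfolding z(1) by blast
  qed
  moreover have "inj_on ?z {..m}" using v_less n_eq by (auto simp: inj_on_def)
  moreover have "\<forall>i\<le>m. ?z i < n" using v_less n_eq by auto
  ultimately show ?thesis unfolding walk_def by auto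
qed

lemma walk_length: "walk s z \<Longrightarrow> s < n"
proof -
  assume w: "walk s z"
  have "card (z ` {..s}) \<le> card {..<n}" using w by (intro card_mono) (auto simp: walk_def)
  moreover have "card (z ` {..s}) = Suc s" using w by (subst card_image) (auto simp: walk_def)
  ultimately show ?thesis by simp
qed

lemma walk_covers_tail: "walk s z \<Longrightarrow> {k..<n} \<subseteq> z ` {..s}"
proof
  fix i assume w: "walk s z" and i: "i \<in> {k..<n}"
  have zi: "\<forall>t<m. z t = n - 1 - t" "m \<le> s" using w by (simp_all add: walk_def)
  have t: "n - 1 - i < m" "n - 1 - (n - 1 - i) = i" using i n_eq by auto
  then have "z (n - 1 - i) = i" "n - 1 - i \<le> s" using zi by auto
  then show "i \<in> z ` {..s}" by (metis atMost_iff imageI)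
qed

text \<open>Every earlier vertex of the walk has all its neighbours next to it on the walk, so only
  the predecessor can be adjacent to the last vertex.\<close>

lemma walk_neighbour_inside:
  assumes w: "walk s z" and i: "i \<le> s" and e: "E (z s) (z i)"
  shows "i = s - 1" "s \<ge> 1"
proof -
  have inj: "inj_on z {..s}" using w by (simp add: walk_def)
  have "i \<noteq> s" using e irrefl by auto
  then have i': "i < s" using i by simp
  then have "z s \<in> (if i = 0 then {} else {z (i - 1)}) \<union> {z (Suc i)}"
    using w e sym[OF e] unfolding walk_def by blast
  then consider "i \<noteq> 0" "z s = z (i - 1)" | "z s = z (Suc i)" by (auto split: if_splits)
  then have "s = Suc i"
  proof cases
    case 1
    then have "s = i - 1" using inj_onD[OF inj 1(2)] i by simp
    then show ?thesis using i' by simp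
  next
    case 2
    then show ?thesis using inj_onD[OF inj 2] i' by simp
  qed
  then show "i = s - 1" "s \<ge> 1" by auto
qed

text \<open>Weights growing linearly from the free end satisfy 2 x = nb x along the walk before its
  last vertex. Of the nonnegative quantity 2 <x, x> - <x, M x> only the contributions of the last
  vertex and of \<open>T\<close> remain.\<close>

lemma walk_test_vector:
  assumes w: "walk s z" and r: "rayleigh_bound r" "r \<le> 2"
    and T: "T \<subseteq> {..<n}" "T \<inter> z ` {..s} = {}" and f: "\<forall>i. f i \<ge> 0" and c0: "c0 \<ge> (0 :: real)"
  shows "\<exists>x. (\<forall>i. x i \<ge> 0) \<and> (\<forall>t\<le>s. x (z t) = c0 * (real t + 1)) \<and> (\<forall>i\<in>T. x i = f i) \<and>
    0 \<le> x (z s) * (2 * x (z s) - nb x (z s)) + (\<Sum>i\<in>T. x i * (2 * x i - nb x i))"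
proof -
  have inj: "inj_on z {..s}" and zn: "\<And>i. i \<le> s \<Longrightarrow> z i < n"
    and N: "\<And>i. i < s \<Longrightarrow> {j. E (z i) j} = (if i = 0 then {} else {z (i - 1)}) \<union> {z (Suc i)}"
    using w by (auto simp: walk_def)
  define x where "x i = (if i \<in> z ` {..s} then c0 * (real (inv_into {..s} z i) + 1)
    else if i \<in> T then f i else 0)" for i
  have x0: "\<forall>i. x i \<ge> 0" using f c0 by (simp add: x_def)
  have xz: "x (z t) = c0 * (real t + 1)" if "t \<le> s" for t
    using that inv_into_f_f[OF inj, of t] by (simp add: x_def)
  have xT: "x i = f i" if "i \<in> T" for i using that T(2) by (auto simp: x_def)
  define F where "F i = x i * (2 * x i - nb x i)" for i
  have Fz: "F (z t) = 0" if t: "t < s" for t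
  proof (cases "t = 0")
    case True
    then have "nb x (z t) = x (z (Suc t))" unfolding nb_eq_sum_neighbours N[OF t] by simp
    then show ?thesis using True t xz[of t] xz[of "Suc t"] by (simp add: F_def)
  next
    case False
    have "z (t - 1) \<noteq> z (Suc t)"
    proof
      assume "z (t - 1) = z (Suc t)"
      then have "t - 1 = Suc t" using inj_onD[OF inj, of "t - 1" "Suc t"] t by simp
      then show False by linarith
    qed
    then have "nb x (z t) = x (z (t - 1)) + x (z (Suc t))"
      unfolding nb_eq_sum_neighbours N[OF t] using False by simp
    also have "\<dots> = 2 * x (z t)"
      using False t xz[of "t - 1"] xz[of "Suc t"] xz[of t] by (simp add: algebra_simps of_nat_diff)
    finally show ?thesis by (simp add: F_def)
  qed
  have "ip x (nb x) \<le> r * ip x x" using r(1) by (simp add: rayleigh_bound_def)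
  also have "\<dots> \<le> 2 * ip x x" using r(2) ip_self_nonneg by (rule mult_right_mono)
  finally have "0 \<le> 2 * ip x x - ip x (nb x)" by simp
  also have "2 * ip x x - ip x (nb x) = (\<Sum>i<n. F i)"
  proof -
    have "F i = 2 * (x i * x i) - x i * nb x i" for i by (simp add: F_def algebra_simps)
    then show ?thesis by (simp only: ip_def sum_subtractf sum_distrib_left)
  qed
  also have "\<dots> = (\<Sum>i\<in>z ` {..s} \<union> T. F i)"
  proof (rule sum.mono_neutral_right)
    show "z ` {..s} \<union> T \<subseteq> {..<n}" using zn T(1) by auto
    show "\<forall>i\<in>{..<n} - (z ` {..s} \<union> T). F i = 0" by (auto simp: F_def x_def)
  qed simp
  also have "\<dots> = (\<Sum>i\<in>z ` {..s}. F i) + (\<Sum>i\<in>T. F i)"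
    using T finite_subset[OF T(1)] by (intro sum.union_disjoint) auto
  also have "(\<Sum>i\<in>z ` {..s}. F i) = (\<Sum>t\<le>s. F (z t))" by (simp add: sum.reindex[OF inj])
  also have "\<dots> = F (z s)"
  proof -
    have "(\<Sum>t\<le>s. F (z t)) = (\<Sum>t\<le>s. if t = s then F (z s) else 0)"
      by (intro sum.cong refl) (auto simp: Fz)
    then show ?thesis by simp
  qed
  finally have "0 \<le> F (z s) + (\<Sum>i\<in>T. F i)" .
  then show ?thesis using x0 xz xT unfolding F_def by blast
qed

lemma mult_bound_le: "(x :: real) \<ge> 0 \<Longrightarrow> b \<ge> a \<Longrightarrow> x * (2 * x - b) \<le> x * (2 * x - a)"
  by (intro mult_left_mono) auto

text \<open>Each forbidden configuration contains, with a longer arm, an affine diagram of index 2: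
  D4, the triangle A2, or E8. The test weights are their null vectors for arms with h = 2, 1, 6
  vertices, the last vertex of the walk included; a longer arm makes the form negative. The E8 case
  is the strictest, needing h > 6, and \<open>m \<ge> 7\<close> provides h >= 8.\<close>

lemma branch_vertex:
  assumes w: "walk s z" and r: "rayleigh_bound r" "r \<le> 2" and m7: "m \<ge> 7"
    and a: "E (z s) a" "a \<noteq> z (s - 1)" and b: "E (z s) b" "b \<noteq> z (s - 1)" and ab: "a \<noteq> b"
  shows "{j. E (z s) j} = {z (s - 1), a, b}" "\<not> E a b" "{j. E a j} = {z s}" "{j. E b j} = {z s}"
proof -
  define h where "h = real s + 1"
  have s7: "s \<ge> 7" using w m7 by (simp add: walk_def)
  then have h: "h \<ge> 8" by (simp add: h_def)
  then have h0: "\<forall>i :: nat. h \<ge> 0" by simp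
  have out: "e \<notin> z ` {..s}" "e < n" if "E (z s) e" "e \<noteq> z (s - 1)" for e
    using walk_neighbour_inside[OF w] that bound[OF sym[OF that(1)]] by auto
  have prev: "E (z s) (z (s - 1))"
  proof -
    have "z s \<in> {j. E (z (s - 1)) j}" using w s7 by (simp add: walk_def)
    then show ?thesis using sym by blast
  qed
  have zs: "z (s - 1) \<noteq> z s" using prev irrefl by metis
  show N: "{j. E (z s) j} = {z (s - 1), a, b}"
  proof (rule ccontr)
    assume "\<not> ?thesis"
    then obtain e where e: "E (z s) e" "e \<noteq> z (s - 1)" "e \<noteq> a" "e \<noteq> b" using prev a b by blast
    have T: "{a, b, e} \<subseteq> {..<n}" "{a, b, e} \<inter> z ` {..s} = {}" using out a b e by auto
    \<comment> \<open>Affine D4 weights: 2 h in the centre and h at three further neighbours, with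
      the excess 2 - h at the centre.\<close>
    have c0: "(0 :: real) \<le> 2" by simp
    from walk_test_vector[OF w r T h0 c0] obtain x where x: "\<forall>i. x i \<ge> 0" "\<forall>t\<le>s. x (z t) = 2 * (real t + 1)" "\<forall>i\<in>{a, b, e}. x i = h"
      and ineq: "0 \<le> x (z s) * (2 * x (z s) - nb x (z s)) + (\<Sum>i\<in>{a, b, e}. x i * (2 * x i - nb x i))"
      by (elim exE conjE)
    have xs: "x (z s) = 2 * h" "x (z (s - 1)) = 2 * h - 2"
      using x(2)[rule_format, of s] x(2)[rule_format, of "s - 1"] s7 by (simp_all add: h_def of_nat_diff)
    have "x i * (2 * x i - nb x i) \<le> 0" if i: "i \<in> {a, b, e}" for i
    proof -
      have "nb x i \<ge> (\<Sum>j\<in>{z s}. x j)"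
        by (rule nb_ge[OF x(1)]) (use i a b e sym in auto)
      then have "2 * x i - nb x i \<le> 0" using xs bspec[OF x(3) i] by simp
      then show ?thesis using x(1) by (intro mult_nonneg_nonpos) auto
    qed
    then have "(\<Sum>i\<in>{a, b, e}. x i * (2 * x i - nb x i)) \<le> (\<Sum>i\<in>{a, b, e}. 0)"
      by (intro sum_mono) auto
    moreover have "nb x (z s) \<ge> (\<Sum>j\<in>{z (s - 1), a, b, e}. x j)"
      by (rule nb_ge[OF x(1)]) (use prev a b e in auto)
    then have "nb x (z s) \<ge> 2 * h - 2 + 3 * h" using a b e ab xs x(3) by simp
    then have "x (z s) * (2 * x (z s) - nb x (z s)) \<le> 2 * h * (2 * (2 * h) - (2 * h - 2 + 3 * h))"
      using mult_bound_le[of "x (z s)" "2 * h - 2 + 3 * h" "nb x (z s)"] xs h by simp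
    moreover have "2 * h * (2 * (2 * h) - (2 * h - 2 + 3 * h)) < 0" using h by (intro mult_pos_neg) auto
    ultimately show False using ineq by simp
  qed
  have T2: "{a, b} \<subseteq> {..<n}" "{a, b} \<inter> z ` {..s} = {}" using out a b by auto
  show nab: "\<not> E a b"
  proof
    assume e: "E a b"
    \<comment> \<open>Equal weights h on the triangle; the predecessor on the walk then makes the
      excess at \<open>z s\<close> equal to 1 - h.\<close>
    have c0: "(0 :: real) \<le> 1" by simp
    from walk_test_vector[OF w r T2 h0 c0] obtain x where x: "\<forall>i. x i \<ge> 0" "\<forall>t\<le>s. x (z t) = 1 * (real t + 1)" "\<forall>i\<in>{a, b}. x i = h"
      and ineq: "0 \<le> x (z s) * (2 * x (z s) - nb x (z s)) + (\<Sum>i\<in>{a, b}. x i * (2 * x i - nb x i))"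
      by (elim exE conjE)
    have xs: "x (z s) = h" "x (z (s - 1)) = h - 1"
      using x(2)[rule_format, of s] x(2)[rule_format, of "s - 1"] s7 by (simp_all add: h_def of_nat_diff)
    have za: "z s \<noteq> a" "z s \<noteq> b" using T2 by auto
    have "nb x a \<ge> (\<Sum>j\<in>{z s, b}. x j)"
      by (rule nb_ge[OF x(1)]) (use a b e sym in auto)
    then have "nb x a \<ge> 2 * h" using za xs x(3) by simp
    moreover have "nb x b \<ge> (\<Sum>j\<in>{z s, a}. x j)"
      by (rule nb_ge[OF x(1)]) (use a b e sym in auto)
    then have "nb x b \<ge> 2 * h" using za xs x(3) by simp
    ultimately have "x a * (2 * x a - nb x a) \<le> 0" "x b * (2 * x b - nb x b) \<le> 0"
      using mult_bound_le[of "x a" "2 * h" "nb x a"] mult_bound_le[of "x b" "2 * h" "nb x b"] x(3) h by auto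
    moreover have "nb x (z s) \<ge> (\<Sum>j\<in>{z (s - 1), a, b}. x j)"
      by (rule nb_ge[OF x(1)]) (use prev a b in auto)
    then have "nb x (z s) \<ge> h - 1 + 2 * h" using a b ab xs x(3) by simp
    then have "x (z s) * (2 * x (z s) - nb x (z s)) \<le> h * (2 * h - (h - 1 + 2 * h))"
      using mult_bound_le[of "x (z s)" "h - 1 + 2 * h" "nb x (z s)"] xs h by simp
    moreover have "h * (2 * h - (h - 1 + 2 * h)) < 0" using h by (intro mult_pos_neg) auto
    ultimately show False using ineq ab by simp
  qed
  have leaf: "{j. E a j} = {z s}"
    if a: "E (z s) a" "a \<noteq> z (s - 1)" and b: "E (z s) b" "b \<noteq> z (s - 1)" and ab: "a \<noteq> b" and nab: "\<not> E a b" for a b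
  proof (rule ccontr)
    assume "\<not> ?thesis"
    then obtain e where e: "E a e" "e \<noteq> z s" using a sym by blast
    have T2: "{a, b} \<subseteq> {..<n}" "{a, b} \<inter> z ` {..s} = {}" using out a b by auto
    have "e \<notin> z ` {..s}"
    proof
      assume "e \<in> z ` {..s}"
      then obtain i where i: "i \<le> s" "e = z i" by auto
      then have "i < s" using e(2) by (cases "i = s") auto
      then have "a \<in> (if i = 0 then {} else {z (i - 1)}) \<union> {z (Suc i)}"
        using w sym[OF e(1)] unfolding walk_def i(2) by blast
      then have "a \<in> z ` {..s}" using \<open>i < s\<close> by (auto split: if_splits)
      then show False using T2 by blast
    qed
    moreover have ea: "e \<noteq> a" "e \<noteq> b" using e irrefl nab by auto
    ultimately have T: "{a, b, e} \<subseteq> {..<n}" "{a, b, e} \<inter> z ` {..s} = {}" using T2 bound[OF sym[OF e(1)]] by auto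
    \<comment> \<open>Affine E8 weights: 6 h at the branch vertex, arms 4 h, 2 h and 3 h; the excess
      there is 12 h - (13 h - 6) = 6 - h.\<close>
    define f where "f i = (if i = a then 4 * h else if i = b then 3 * h else 2 * h)" for i
    have f0: "\<forall>i. f i \<ge> 0" using h by (simp add: f_def)
    have c0: "(0 :: real) \<le> 6" by simp
    from walk_test_vector[OF w r T f0 c0] obtain x where x: "\<forall>i. x i \<ge> 0" "\<forall>t\<le>s. x (z t) = 6 * (real t + 1)" "\<forall>i\<in>{a, b, e}. x i = f i"
      and ineq: "0 \<le> x (z s) * (2 * x (z s) - nb x (z s)) + (\<Sum>i\<in>{a, b, e}. x i * (2 * x i - nb x i))"
      by (elim exE conjE)
    have xs: "x (z s) = 6 * h" "x (z (s - 1)) = 6 * h - 6"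
      using x(2)[rule_format, of s] x(2)[rule_format, of "s - 1"] s7 by (simp_all add: h_def of_nat_diff)
    have xv: "x a = 4 * h" "x b = 3 * h" "x e = 2 * h" using x(3) ea ab by (auto simp: f_def)
    have "nb x a \<ge> (\<Sum>j\<in>{z s, e}. x j)"
      by (rule nb_ge[OF x(1)]) (use a b e sym in auto)
    then have "nb x a \<ge> 8 * h" using e(2) xs xv by simp
    moreover have "nb x b \<ge> (\<Sum>j\<in>{z s}. x j)"
      by (rule nb_ge[OF x(1)]) (use a b e sym in auto)
    then have "nb x b \<ge> 6 * h" using xs xv by simp
    moreover have "nb x e \<ge> (\<Sum>j\<in>{a}. x j)"
      by (rule nb_ge[OF x(1)]) (use a b e sym in auto)
    then have "nb x e \<ge> 4 * h" using xs xv by simp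
    ultimately have "x a * (2 * x a - nb x a) \<le> 0" "x b * (2 * x b - nb x b) \<le> 0" "x e * (2 * x e - nb x e) \<le> 0"
      using xv h by (auto intro!: mult_nonneg_nonpos)
    moreover have "nb x (z s) \<ge> (\<Sum>j\<in>{z (s - 1), a, b}. x j)"
      by (rule nb_ge[OF x(1)]) (use prev a b in auto)
    then have "nb x (z s) \<ge> 6 * h - 6 + 7 * h" using a b ab xs xv by simp
    then have "x (z s) * (2 * x (z s) - nb x (z s)) \<le> 6 * h * (2 * (6 * h) - (6 * h - 6 + 7 * h))"
      using mult_bound_le[of "x (z s)" "6 * h - 6 + 7 * h" "nb x (z s)"] xs h by simp
    moreover have "6 * h * (2 * (6 * h) - (6 * h - 6 + 7 * h)) < 0" using h by (intro mult_pos_neg) auto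
    moreover have "(\<Sum>i\<in>{a, b, e}. x i * (2 * x i - nb x i)) =
        x a * (2 * x a - nb x a) + (x b * (2 * x b - nb x b) + x e * (2 * x e - nb x e))"
      using ea ab by simp
    ultimately show False using ineq by linarith
  qed
  show "{j. E a j} = {z s}" using leaf[OF a b ab nab] .
  show "{j. E b j} = {z s}" using leaf[OF b a] ab nab sym by blast
qed

lemma adj_from_neighbour_sets:
  assumes inj: "inj_on z {..<n}"
    and N: "\<And>i. i < n \<Longrightarrow> {w. E (z i) w} = z ` {j. j < n \<and> F i j}" and ij: "i < n" "j < n"
  shows "E (z i) (z j) \<longleftrightarrow> F i j"
proof -
  have "E (z i) (z j) \<longleftrightarrow> z j \<in> z ` {j. j < n \<and> F i j}" using N[OF ij(1)] by blast
  also have "\<dots> \<longleftrightarrow> F i j" using inj ij by (auto simp: inj_on_def)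
  finally show ?thesis .
qed

text \<open>For a longest walk, look at its last vertex: with no neighbour besides the predecessor
  the walk is a whole component, so the graph is a path; exactly one more neighbour would prolong
  the walk; two or more force the fork by the branch analysis. Connectedness excludes further
  vertices.\<close>

theorem small_index_classification:
  assumes r: "rayleigh_bound r" "r \<le> 2" and m7: "m \<ge> 7"
  shows "\<exists>z. bij_betw z {..<n} {..<n} \<and>
    ((\<forall>i<n. \<forall>j<n. E (z i) (z j) \<longleftrightarrow> path_adj i j) \<or>
     (4 \<le> n \<and> (\<forall>i<n. \<forall>j<n. E (z i) (z j) \<longleftrightarrow> fork_adj n i j)))"
proof -
  define W where "W = {s. \<exists>z. walk s z}"
  have "finite W" by (rule finite_subset[of _ "{..<n}"]) (auto simp: W_def walk_length)
  moreover have "W \<noteq> {}" using walk_tail by (auto simp: W_def)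
  ultimately have "Max W \<in> W" and Max: "\<And>s. s \<in> W \<Longrightarrow> s \<le> Max W" by simp_all
  then obtain s z where w: "walk s z" and max: "\<And>t y. walk t y \<Longrightarrow> t \<le> s" by (auto simp: W_def)
  have ms: "m \<le> s" and zm: "z m = v" and inj: "inj_on z {..s}" and zn: "\<And>i. i \<le> s \<Longrightarrow> z i < n"
    and N: "\<And>i. i < s \<Longrightarrow> {j. E (z i) j} = (if i = 0 then {} else {z (i - 1)}) \<union> {z (Suc i)}"
    using w by (auto simp: walk_def)
  have s7: "s \<ge> 7" using ms m7 by simp
  have prev: "E (z s) (z (s - 1))"
  proof -
    have "z s \<in> {j. E (z (s - 1)) j}" using N[of "s - 1"] s7 by simp
    then show ?thesis using sym by blast
  qed
  have tail: "{k..<n} \<subseteq> z ` {..s}" by (rule walk_covers_tail[OF w])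
  have vz: "v \<in> z ` {..s}" using zm ms by (metis atMost_iff imageI)
  have Nin: "{j. E (z i) j} \<subseteq> z ` {..s}" if "i < s" for i
    using N[OF that] that by auto
  consider "{j. E (z s) j} = {z (s - 1)}"
    | u where "{j. E (z s) j} = {z (s - 1), u}" "u \<noteq> z (s - 1)"
    | a b where "E (z s) a" "a \<noteq> z (s - 1)" "E (z s) b" "b \<noteq> z (s - 1)" "a \<noteq> b"
    using prev by blast
  then show ?thesis
  proof cases
    case 1
    have "z ` {..s} = {..<n}"
    proof (rule closed_contains_all[OF _ tail vz])
      fix i j assume "i \<in> z ` {..s}" "E i j"
      then obtain t where t: "t \<le> s" "E (z t) j" by auto
      show "j \<in> z ` {..s}"
      proof (cases "t = s")
        case True
        then show ?thesis using t(2) 1 by auto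
      next
        case False
        then show ?thesis using Nin[of t] t by auto
      qed
    qed (use zn in auto)
    moreover from this have ns: "n = Suc s" using card_image[OF inj] by simp
    moreover have atm: "{..s} = {..<n}" unfolding ns by auto
    ultimately have bij: "bij_betw z {..<n} {..<n}" and inj': "inj_on z {..<n}" using inj by (auto simp: bij_betw_def)
    have "{w. E (z i) w} = z ` {j. j < n \<and> path_adj i j}" if i: "i < n" for i
    proof (cases "i = s")
      case True
      have "{j. j < n \<and> path_adj s j} = {s - 1}" using ns s7 by (auto simp: path_adj_def)
      then show ?thesis using 1 True by simp
    next
      case False
      then have il: "i < s" using i ns by simp
      have "{j. j < n \<and> path_adj i j} = (if i = 0 then {} else {i - 1}) \<union> {Suc i}"
        using ns il by (auto simp: path_adj_def)
      then show ?thesis using N[OF il] by auto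
    qed
    then show ?thesis using adj_from_neighbour_sets[OF inj'] bij by blast
  next
    case (2 u)
    have Eu: "E (z s) u" using 2 by blast
    then have u: "u \<notin> z ` {..s}" "u < n"
      using walk_neighbour_inside[OF w] 2(2) bound[OF sym[OF Eu]] by auto
    define y where "y i = (if i = Suc s then u else z i)" for i
    have ys: "y i = z i" if "i \<le> s" for i using that by (simp add: y_def)
    have "inj_on y {..Suc s}"
    proof (rule inj_onI)
      fix i j assume ij: "i \<in> {..Suc s}" "j \<in> {..Suc s}" "y i = y j"
      show "i = j"
      proof (cases "i = Suc s \<or> j = Suc s")
        case True
        then show ?thesis using ij u(1) by (auto simp: y_def split: if_splits)
      next
        case False
        then show ?thesis using ij inj_onD[OF inj, of i j] by (auto simp: y_def)
      qed
    qed
    moreover have "{j. E (y i) j} = (if i = 0 then {} else {y (i - 1)}) \<union> {y (Suc i)}" if "i < Suc s" for i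
    proof (cases "i = s")
      case True
      then show ?thesis using 2 s7 ys by (auto simp: y_def)
    next
      case False
      then show ?thesis using N[of i] that ys[of i] ys[of "i - 1"] ys[of "Suc i"] by simp
    qed
    moreover have "\<forall>i\<le>Suc s. y i < n" using zn u by (auto simp: y_def le_Suc_eq)
    moreover have "\<forall>i<m. y i = n - 1 - i" "y m = v" using w ms by (auto simp: walk_def y_def)
    ultimately have "walk (Suc s) y" using ms unfolding walk_def by simp
    then show ?thesis using max[of "Suc s" y] by simp
  next
    case (3 a b)
    note br = branch_vertex[OF w r m7 3]
    have out: "e \<notin> z ` {..s}" "e < n" if "E (z s) e" "e \<noteq> z (s - 1)" for e
      using walk_neighbour_inside[OF w] that bound[OF sym[OF that(1)]] by auto
    have ab: "a \<notin> z ` {..s}" "a < n" "b \<notin> z ` {..s}" "b < n" using out 3 by blast+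
    define y where "y i = (if i = Suc s then a else if i = Suc (Suc s) then b else z i)" for i
    have ys: "y i = z i" if "i \<le> s" for i using that by (simp add: y_def)
    have img: "y ` {..<s + 3} = insert a (insert b (z ` {..s}))"
    proof -
      have "{..<s + 3} = insert (Suc s) (insert (Suc (Suc s)) {..s})" by auto
      then have "y ` {..<s + 3} = insert (y (Suc s)) (insert (y (Suc (Suc s))) (y ` {..s}))" by simp
      moreover have "y ` {..s} = z ` {..s}" by (intro image_cong) (auto simp: ys)
      ultimately show ?thesis by (simp add: y_def)
    qed
    have all: "y ` {..<s + 3} = {..<n}"
      unfolding img
    proof (rule closed_contains_all)
      fix i j assume i: "i \<in> insert a (insert b (z ` {..s}))" "E i j"
      consider "i = a" | "i = b" | "i = z s" | t where "t < s" "i = z t"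
        using i(1) by (auto simp: le_less)
      then show "j \<in> insert a (insert b (z ` {..s}))"
      proof cases
        case 1
        then show ?thesis using br(3) i(2) by auto
      next
        case 2
        then show ?thesis using br(4) i(2) by auto
      next
        case 3
        then show ?thesis using br(1) i(2) by auto
      next
        case (4 t)
        then show ?thesis using Nin[of t] i(2) by auto
      qed
    qed (use tail vz ab zn in auto)
    have "inj_on y {..<s + 3}"
    proof (rule inj_onI)
      fix i j assume ij: "i \<in> {..<s + 3}" "j \<in> {..<s + 3}" "y i = y j"
      have c: "i \<le> s \<or> i = Suc s \<or> i = Suc (Suc s)" "j \<le> s \<or> j = Suc s \<or> j = Suc (Suc s)" using ij by auto
      have za: "z t \<noteq> a" "z t \<noteq> b" if "t \<le> s" for t using ab that by auto
      show "i = j" using c ij(3) za 3(5) inj_onD[OF inj, of i j] by (auto simp: y_def split: if_splits)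
    qed
    moreover from this have ns: "n = s + 3" using card_image[of y "{..<s + 3}"] all by simp
    ultimately have bij: "bij_betw y {..<n} {..<n}" and inj': "inj_on y {..<n}" using all by (auto simp: bij_betw_def)
    have F: "fork_adj n i j \<longleftrightarrow> (j = Suc i \<and> i \<le> s) \<or> (i = Suc j \<and> j \<le> s) \<or>
        (i = s \<and> j = s + 2) \<or> (i = s + 2 \<and> j = s)" for i j
      unfolding fork_adj_def ns by auto
    have "{w. E (y i) w} = y ` {j. j < n \<and> fork_adj n i j}" if i: "i < n" for i
    proof -
      consider "i < s" | "i = s" | "i = Suc s" | "i = Suc (Suc s)" using i ns by linarith
      then show ?thesis
      proof cases
        case 1
        have "{j. j < n \<and> fork_adj n i j} = (if i = 0 then {} else {i - 1}) \<union> {Suc i}"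
          unfolding F using ns 1 by auto
        then show ?thesis using N[OF 1] 1 ys[of i] ys[of "i - 1"] ys[of "Suc i"] by auto
      next
        case 2
        have "{j. j < n \<and> fork_adj n i j} = {s - 1, Suc s, Suc (Suc s)}"
          unfolding F using ns 2 s7 by auto
        then show ?thesis using br(1) 2 ys[of s] ys[of "s - 1"] by (auto simp: y_def)
      next
        case 3
        have "{j. j < n \<and> fork_adj n i j} = {s}" unfolding F using ns 3 by auto
        then show ?thesis using br(3) 3 ys[of s] by (simp add: y_def)
      next
        case 4
        have "{j. j < n \<and> fork_adj n i j} = {s}" unfolding F using ns 4 by auto
        then show ?thesis using br(4) 4 ys[of s] by (simp add: y_def)
      qed
    qed
    then have "\<forall>i<n. \<forall>j<n. E (y i) (y j) \<longleftrightarrow> fork_adj n i j"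
      using adj_from_neighbour_sets[OF inj', of "fork_adj n"] by blast
    moreover have "4 \<le> n" using ns s7 by simp
    ultimately show ?thesis using bij by blast
  qed
qed

end

section \<open>Computability of the bound\<close>

lemma recursive_comp1: "recursive 1 f \<Longrightarrow> recursive k g \<Longrightarrow> recursive k (\<lambda>xs. f [g xs])"
  using recursive.comp[of "[g]" f k] by simp

lemma recursive_comp2:
  "recursive 2 f \<Longrightarrow> recursive k g \<Longrightarrow> recursive k h \<Longrightarrow> recursive k (\<lambda>xs. f [g xs, h xs])"
  using recursive.comp[of "[g, h]" f k] by (simp add: numeral_2_eq_2)

lemma recursive_Suc: "recursive k f \<Longrightarrow> recursive k (\<lambda>xs. Suc (f xs))"
  using recursive_comp1[OF recursive.succ] by simp

lemma recursive_const: "recursive k (\<lambda>_. c)"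
  by (induction c) (auto intro: recursive.zero recursive_Suc)

lemma recursive_add:
  assumes "recursive k f" "recursive k g"
  shows "recursive k (\<lambda>xs. f xs + g xs)"
proof -
  have "recursive (Suc 1) (\<lambda>xs. rec_nat (tl xs ! 0) (\<lambda>y r. Suc ((y # r # tl xs) ! 1)) (hd xs))"
    by (rule recursive.prim_rec[of 1 "\<lambda>xs. xs ! 0" "\<lambda>xs. Suc (xs ! 1)"])
      (auto intro!: recursive.proj recursive_Suc)
  moreover have "rec_nat a (\<lambda>y r. Suc r) b = b + a" for a b :: nat by (induction b) auto
  ultimately have "recursive 2 (\<lambda>xs. hd xs + tl xs ! 0)" by (simp add: numeral_2_eq_2)
  from recursive_comp2[OF this assms] show ?thesis by simp
qed

lemma recursive_mult:
  assumes "recursive k f" "recursive k g"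
  shows "recursive k (\<lambda>xs. f xs * g xs)"
proof -
  have "recursive (Suc 1) (\<lambda>xs. rec_nat 0 (\<lambda>y r. (y # r # tl xs) ! 1 + (y # r # tl xs) ! 2) (hd xs))"
    by (rule recursive.prim_rec[of 1 "\<lambda>xs. 0" "\<lambda>xs. xs ! 1 + xs ! 2"])
      (auto intro!: recursive.proj recursive.zero recursive_add)
  moreover have "rec_nat 0 (\<lambda>y r. r + a) b = b * a" for a b :: nat by (induction b) auto
  ultimately have "recursive 2 (\<lambda>xs. hd xs * tl xs ! 0)" by (simp add: numeral_2_eq_2)
  from recursive_comp2[OF this assms] show ?thesis by simp
qed

lemma recursive_power:
  assumes "recursive k f" "recursive k g"
  shows "recursive k (\<lambda>xs. f xs ^ g xs)"
proof -
  have "recursive (Suc 1) (\<lambda>xs. rec_nat 1 (\<lambda>y r. (y # r # tl xs) ! 1 * (y # r # tl xs) ! 2) (hd xs))"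
    by (rule recursive.prim_rec[of 1 "\<lambda>xs. 1" "\<lambda>xs. xs ! 1 * xs ! 2"])
      (auto intro!: recursive.proj recursive_const recursive_mult)
  moreover have "rec_nat 1 (\<lambda>y r. r * a) b = a ^ b" for a b :: nat by (induction b) auto
  ultimately have "recursive 2 (\<lambda>xs. (tl xs ! 0) ^ hd xs)" by (simp add: numeral_2_eq_2)
  \<comment> \<open>Primitive recursion runs over the first argument, here the exponent, hence the
    exchanged order.\<close>
  from recursive_comp2[OF this assms(2,1)] show ?thesis by simp
qed

text \<open>With P and P1 from the determinants of the base, and c = (k + 2)^(2 k) bounding both for
  |s| <= k + 1, the three terms of R are at most c^2, (2 k + 2) c^2 and 4 c^2.\<close>

definition value_bound :: "nat \<Rightarrow> nat" where
  "value_bound k = (2 * k + 7) * (k + 2) ^ (4 * k)"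

text \<open>The bound of \<open>card_G_bound\<close> with C = (k + 1)^2, which dominates the square
  of the largest eigenvalue.\<close>

definition group_bound :: "nat \<Rightarrow> nat \<Rightarrow> nat" where
  "group_bound d0 k = d0 + 2 + 4 * ((k + 1) ^ 2) ^ (16 * k)"

text \<open>The threshold \<open>d0\<close> is a fixed number independent of the graph and enters as
  a constant function.\<close>

lemma recursive_bound:
  "recursive 3 (\<lambda>xs. xs ! 0 + 8 + value_bound (xs ! 0) ^ group_bound d0 (xs ! 0))"
  unfolding value_bound_def group_bound_def
  by (intro recursive_add recursive_mult recursive_power recursive_const recursive.proj) simp_all

lemma digraph_iso_if_bij:
  fixes z :: "nat \<Rightarrow> nat"
  assumes G: "pverts G = {..<n}" "parcs G \<subseteq> {..<n} \<times> {..<n}"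
    and H: "pverts H = {..<n}" "parcs H \<subseteq> {..<n} \<times> {..<n}"
    and z: "bij_betw z {..<n} {..<n}"
    and iff: "\<And>i j. i < n \<Longrightarrow> j < n \<Longrightarrow> (z i, z j) \<in> parcs G \<longleftrightarrow> (i, j) \<in> parcs H"
  shows "digraph_iso (with_proj G) (with_proj H)"
proof -
  define w where "w = inv_into {..<n} z"
  have w: "bij_betw w {..<n} {..<n}" unfolding w_def by (rule bij_betw_inv_into[OF z])
  have zw: "z (w i) = i" if "i < n" for i
    using z that by (simp add: w_def bij_betw_def f_inv_into_f)
  have wz: "w (z i) = i" if "i < n" for i
    using z that by (simp add: w_def bij_betw_def)
  have wn: "w i < n" if "i < n" for i using w that by (auto simp: bij_betw_def)
  have zn: "z i < n" if "i < n" for i using z that by (auto simp: bij_betw_def)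
  define f where "f = \<lparr>iso_verts = w, iso_arcs = map_prod w w, iso_head = snd, iso_tail = fst\<rparr>"
  have injw: "inj_on w {..<n}" using w by (simp add: bij_betw_def)
  have "wf_digraph (with_proj G)"
    by unfold_locales (use G in auto)
  moreover have "inj_on (map_prod w w) (parcs G)"
    by (rule inj_on_subset[OF map_prod_inj_on[OF injw injw] G(2)])
  ultimately have "pre_digraph.digraph_isomorphism (with_proj G) f"
    unfolding pre_digraph.digraph_isomorphism_def f_def using injw G by auto
  moreover have "map_prod w w ` parcs G = parcs H"
  proof (intro equalityI subsetI)
    fix e assume "e \<in> map_prod w w ` parcs G"
    then obtain a b where ab: "e = (w a, w b)" "(a, b) \<in> parcs G" by auto
    then have "a < n" "b < n" using G by auto
    then show "e \<in> parcs H" using iff[of "w a" "w b"] ab zw wn by simp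
  next
    fix e assume e: "e \<in> parcs H"
    then obtain i j where ij: "e = (i, j)" "i < n" "j < n" using H by auto
    then have "(z i, z j) \<in> parcs G" using iff e by simp
    moreover have "map_prod w w (z i, z j) = e" using ij wz by simp
    ultimately show "e \<in> map_prod w w ` parcs G" by (metis image_eqI)
  qed
  then have "with_proj H = app_iso f (with_proj G)"
    unfolding app_iso_def with_proj_def f_def using G H w by (simp add: bij_betw_def)
  ultimately show ?thesis unfolding digraph_iso_def by blast
qed

lemma dynkin_A_parcs: "(i, j) \<in> parcs (dynkin_A n) \<longleftrightarrow> i < n \<and> j < n \<and> path_adj i j"
  by (auto simp: dynkin_A_def undirected_graph_def path_adj_def)

lemma dynkin_D_parcs:
  assumes "n \<ge> 4"
  shows "(i, j) \<in> parcs (dynkin_D n) \<longleftrightarrow> i < n \<and> j < n \<and> fork_adj n i j"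
  using assms by (auto simp: dynkin_D_def undirected_graph_def fork_adj_def)

lemma dynkin_pverts: "pverts (dynkin_A n) = {..<n}" "pverts (dynkin_D n) = {..<n}"
  by (simp_all add: dynkin_A_def dynkin_D_def undirected_graph_def)

lemma transport_eigenvector:
  fixes u :: "nat \<Rightarrow> complex"
  assumes z: "bij_betw z {..<n} {..<n}"
    and F: "\<And>i j. i < n \<Longrightarrow> j < n \<Longrightarrow> E (z i) (z j) \<longleftrightarrow> F i j"
    and u: "\<exists>i<n. u i \<noteq> 0" "\<forall>i<n. (\<Sum>j<n. if E i j then u j else 0) = \<mu> * u i"
  shows "\<exists>i<n. u (z i) \<noteq> 0" "\<And>i. i < n \<Longrightarrow> (\<Sum>j<n. if F i j then u (z j) else 0) = \<mu> * u (z i)"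
proof -
  show "\<exists>i<n. u (z i) \<noteq> 0" using u(1) z unfolding bij_betw_def by (metis imageE lessThan_iff)
  fix i assume i: "i < n"
  have "(\<Sum>j<n. if F i j then u (z j) else 0) = (\<Sum>j<n. if E (z i) (z j) then u (z j) else 0)"
    by (intro sum.cong refl) (use F[OF i] in auto)
  also have "\<dots> = (\<Sum>j<n. if E (z i) j then u j else 0)" by (rule sum.reindex_bij_betw[OF z])
  also have "\<dots> = \<mu> * u (z i)" using u(2) z i by (auto simp: bij_betw_def)
  finally show "(\<Sum>j<n. if F i j then u (z j) else 0) = \<mu> * u (z i)" .
qed

section \<open>The main estimate\<close>

lemma even_odd_decomposition:
  fixes R :: "int poly"
  shows "\<exists>A B. \<forall>s :: real. poly (of_int_poly R) s =
    poly (of_int_poly A) (s\<^sup>2) + s * poly (of_int_poly B) (s\<^sup>2)"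
proof (induction R)
  case 0
  then show ?case by (intro exI[of _ 0]) simp
next
  case (pCons a R)
  then obtain A B :: "int poly" where AB: "\<forall>s :: real. poly (of_int_poly R) s =
    poly (of_int_poly A) (s\<^sup>2) + s * poly (of_int_poly B) (s\<^sup>2)" by blast
  have "poly (of_int_poly (pCons a R)) s =
      poly (of_int_poly (pCons a B)) (s\<^sup>2) + s * poly (of_int_poly A) (s\<^sup>2)" for s :: real
    using AB by (simp add: of_int_hom.map_poly_pCons_hom power2_eq_square algebra_simps)
  then show ?case by blast
qed

lemma poly_of_int_poly_of_real:
  "poly (of_int_poly p) (of_real s :: complex) = of_real (poly (of_int_poly p) s)"
  by (induction p) (simp_all add: map_poly_pCons)

context tailed_graph
begin

text \<open>The characteristic polynomial of the squared adjacency matrix: it has the generator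
  lambda^2 of the field as a root, so every conjugate of lambda^2 is again an eigenvalue of the
  square.\<close>

definition square_char_poly :: "int poly" where
  "square_char_poly = char_poly (mat n n (\<lambda>(i, j). \<Sum>l<n. if E i l \<and> E l j then 1 else 0))"

lemma square_char_poly_root_iff:
  "poly (of_int_poly square_char_poly) (c :: complex) = 0 \<longleftrightarrow>
    (\<exists>u. (\<exists>i<n. u i \<noteq> 0) \<and>
      (\<forall>i<n. (\<Sum>l<n. if E i l then (\<Sum>j<n. if E l j then u j else 0) else 0) = c * u i))"
proof -
  let ?A = "mat n n (\<lambda>(i, j). \<Sum>l<n. if E i l \<and> E l j then 1 else 0) :: int mat"
  let ?B = "map_mat of_int ?A :: complex mat"
  have A: "?A \<in> carrier_mat n n" and B: "?B \<in> carrier_mat n n" by simp_all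
  have mv: "(?B *\<^sub>v vec n u) $ i = (\<Sum>l<n. if E i l then (\<Sum>j<n. if E l j then u j else 0) else 0)"
    if i: "i < n" for i u
  proof -
    have "(?B *\<^sub>v vec n u) $ i = (\<Sum>j<n. of_int (\<Sum>l<n. if E i l \<and> E l j then 1 else 0) * u j)"
      using i by (simp add: scalar_prod_def atLeast0LessThan)
    also have "\<dots> = (\<Sum>j<n. \<Sum>l<n. if E i l \<and> E l j then u j else 0)"
      unfolding of_int_sum sum_distrib_right by (intro sum.cong refl) auto
    also have "\<dots> = (\<Sum>l<n. \<Sum>j<n. if E i l \<and> E l j then u j else 0)" by (rule sum.swap)
    also have "\<dots> = (\<Sum>l<n. if E i l then (\<Sum>j<n. if E l j then u j else 0) else 0)"
      by (intro sum.cong refl) auto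
    finally show ?thesis .
  qed
  have "poly (of_int_poly square_char_poly) c = 0 \<longleftrightarrow> eigenvalue ?B c"
    unfolding square_char_poly_def eigenvalue_root_char_poly[OF B]
    using of_int_hom.char_poly_hom[OF A, where ?'a = complex] by simp
  also have "\<dots> \<longleftrightarrow> (\<exists>u. (\<exists>i<n. u i \<noteq> 0) \<and>
      (\<forall>i<n. (\<Sum>l<n. if E i l then (\<Sum>j<n. if E l j then u j else 0) else 0) = c * u i))" (is "_ \<longleftrightarrow> ?R")
  proof
    assume "eigenvalue ?B c"
    then obtain w where w: "w \<in> carrier_vec n" "w \<noteq> 0\<^sub>v n" "?B *\<^sub>v w = c \<cdot>\<^sub>v w"
      by (auto simp: eigenvalue_def eigenvector_def)
    have vw: "vec n (\<lambda>i. w $ i) = w" using w(1) by auto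
    have "\<exists>i<n. w $ i \<noteq> 0"
    proof (rule ccontr)
      assume "\<not> ?thesis"
      then have "w = 0\<^sub>v n" using w(1) by (intro eq_vecI) auto
      then show False using w(2) by blast
    qed
    moreover have "(\<Sum>l<n. if E i l then (\<Sum>j<n. if E l j then w $ j else 0) else 0) = c * w $ i"
      if "i < n" for i
      using mv[OF that, of "\<lambda>i. w $ i"] w(1,3) that unfolding vw by simp
    ultimately show ?R by (intro exI[of _ "\<lambda>i. w $ i"]) auto
  next
    assume ?R
    then obtain u where u: "\<exists>i<n. u i \<noteq> 0"
      "\<And>i. i < n \<Longrightarrow> (\<Sum>l<n. if E i l then (\<Sum>j<n. if E l j then u j else 0) else 0) = c * u i"
      by blast
    have "?B *\<^sub>v vec n u = c \<cdot>\<^sub>v vec n u"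
    proof (rule eq_vecI)
      fix i assume "i < dim_vec (c \<cdot>\<^sub>v vec n u)"
      then have i: "i < n" by simp
      show "(?B *\<^sub>v vec n u) $ i = (c \<cdot>\<^sub>v vec n u) $ i" unfolding mv[OF i] using u(2)[OF i] i by simp
    qed simp
    moreover have "vec n u \<noteq> 0\<^sub>v n" using u(1) by (metis index_vec index_zero_vec(1))
    ultimately show "eigenvalue ?B c" unfolding eigenvalue_def eigenvector_def
      by (intro exI[of _ "vec n u"]) simp
  qed
  finally show ?thesis .
qed

lemma square_char_poly_monic: "lead_coeff square_char_poly = 1"
  using degree_monic_char_poly[OF mat_carrier[of n n "\<lambda>(i, j). \<Sum>l<n. if E i l \<and> E l j then 1 else 0 :: int"]]
  unfolding square_char_poly_def by simp

definition base_poly :: "int poly" where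
  "base_poly = char_poly (mat k k (\<lambda>(i, j). of_bool (E i j)))"

text \<open>The base with a loop of weight 1 at \<open>v\<close>;
  \<open>base_poly - base_poly1\<close> is the characteristic polynomial of the base without
  \<open>v\<close>.\<close>

definition base_poly1 :: "int poly" where
  "base_poly1 = char_poly (mat k k (\<lambda>(i, j). of_bool (E i j) + of_bool (i = v \<and> j = v)))"

text \<open>The polynomial R of the overview: the form X^2 - s X Y + Y^2 conserved along the tail,
  at X = \<open>base_poly\<close> and Y = \<open>base_poly - base_poly1\<close>, with s the
  indeterminate.\<close>

definition limit_poly :: "int poly" where
  "limit_poly = base_poly\<^sup>2 - [:0, 1:] * base_poly * (base_poly - base_poly1) + (base_poly - base_poly1)\<^sup>2"

lemma base_poly_eval:
  "poly (of_int_poly base_poly) (s :: real) = det (mat k k (\<lambda>(i, j). (if i = j then s else 0) - of_bool (E i j)))"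
  "poly (of_int_poly base_poly1) s =
    det (mat k k (\<lambda>(i, j). (if i = j then s else 0) - of_bool (E i j) - of_bool (i = v \<and> j = v)))"
  unfolding base_poly_def base_poly1_def poly_char_poly_eq_det by (simp_all add: diff_diff_eq)

lemma limit_poly_eval:
  "poly (of_int_poly limit_poly) (s :: real) =
    (poly (of_int_poly base_poly) s)\<^sup>2 - s * poly (of_int_poly base_poly) s *
      (poly (of_int_poly base_poly) s - poly (of_int_poly base_poly1) s) +
    (poly (of_int_poly base_poly) s - poly (of_int_poly base_poly1) s)\<^sup>2"
proof -
  have X: "poly (of_int_poly [:0, 1:]) s = s" by simp
  show ?thesis
    by (simp only: limit_poly_def of_int_poly_hom.hom_add of_int_poly_hom.hom_minus of_int_poly_hom.hom_mult
        of_int_poly_hom.hom_power poly_add poly_diff poly_mult poly_power X)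
qed

text \<open>Leibniz expansion with entries of absolute value at most k + 2, together with k! <= (k +
  2)^k.\<close>

lemma poly_bounds:
  assumes s: "\<bar>s\<bar> \<le> real k + 1"
  shows "(poly (of_int_poly base_poly) s - poly (of_int_poly base_poly1) s)\<^sup>2 \<le> real (value_bound k)"
    "\<bar>poly (of_int_poly limit_poly) s\<bar> \<le> real (value_bound k)"
proof -
  let ?P = "poly (of_int_poly base_poly) s" and ?P1 = "poly (of_int_poly base_poly1) s"
  define c where "c = (real k + 2) ^ (2 * k)"
  have c: "fact k * (real k + 2) ^ k \<le> c"
  proof -
    have "(fact k :: nat) \<le> k ^ k" using fact_le_power[of k, where ?'a = nat] by simp
    also have "\<dots> \<le> (k + 2) ^ k" by (intro power_mono) auto
    finally have "real (fact k) \<le> real ((k + 2) ^ k)" by (rule of_nat_mono)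
    then have "fact k \<le> (real k + 2) ^ k" by (simp add: add.commute)
    then have "fact k * (real k + 2) ^ k \<le> (real k + 2) ^ k * (real k + 2) ^ k"
      by (intro mult_right_mono) auto
    then show ?thesis by (simp add: c_def mult_2 power_add)
  qed
  have c1: "c \<ge> 1" unfolding c_def by (rule one_le_power) simp
  have "\<bar>?P\<bar> \<le> fact k * (real k + 2) ^ k"
    unfolding base_poly_eval by (rule abs_det_le) (use s irrefl in auto)
  then have P: "\<bar>?P\<bar> \<le> c" using c by linarith
  have "\<bar>?P1\<bar> \<le> fact k * (real k + 2) ^ k"
    unfolding base_poly_eval by (rule abs_det_le) (use s irrefl in auto)
  then have Q: "\<bar>?P - ?P1\<bar> \<le> 2 * c" using c P by linarith
  have cc: "c * c = (real k + 2) ^ (4 * k)" by (simp add: c_def flip: power_add)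
  have vb: "real (value_bound k) = (2 * real k + 7) * (c * c)" unfolding cc value_bound_def by (simp add: add.commute)
  have PP: "?P\<^sup>2 \<le> c * c" using power_mono[OF P, of 2] by (simp add: power2_eq_square)
  have QQ: "(?P - ?P1)\<^sup>2 \<le> 4 * (c * c)" using power_mono[OF Q, of 2] by (simp add: power2_eq_square)
  have "\<bar>s * ?P * (?P - ?P1)\<bar> \<le> (real k + 1) * c * (2 * c)"
    unfolding abs_mult using s P Q c1 by (intro mult_mono) auto
  then have sPQ: "\<bar>s * ?P * (?P - ?P1)\<bar> \<le> (2 * real k + 2) * (c * c)" by (simp add: algebra_simps)
  have cc0: "c * c \<ge> 0" using c1 by simp
  then have "4 * (c * c) \<le> (2 * real k + 7) * (c * c)" by (intro mult_right_mono) auto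
  then show "(?P - ?P1)\<^sup>2 \<le> real (value_bound k)" using QQ unfolding vb by linarith
  have "(2 * real k + 7) * (c * c) = c * c + (2 * real k + 2) * (c * c) + 4 * (c * c)"
    by (simp add: algebra_simps)
  then show "\<bar>poly (of_int_poly limit_poly) s\<bar> \<le> real (value_bound k)"
    unfolding limit_poly_eval vb using PP QQ sPQ zero_le_power2[of ?P] zero_le_power2[of "?P - ?P1"] by linarith
qed

text \<open>A nonzero algebraic integer of the field has one conjugate of size at most H^2 / (m +
  1)^2 and all d conjugates at most H^2. The product of their absolute values is at least 1, so (m +
  1)^2 <= H^(2 d).\<close>

theorem tail_length_bound:
  assumes rb: "rayleigh_bound r" and y: "\<exists>i<n. y i \<noteq> 0" "\<forall>i. y i \<ge> 0" "\<forall>i<n. nb y i = r * y i"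
    and r2: "r > 2" and ab: "abelian_number_field (rat_adjoin (of_real (r\<^sup>2)))"
    and d0: "\<And>d. d \<ge> d0 \<Longrightarrow> \<exists>p::nat. prime p \<and> d < p \<and> p \<le> 8 * d"
  shows "m + 1 \<le> value_bound k ^ group_bound d0 k"
proof -
  define b where "b = complex_of_real (r\<^sup>2)"
  let ?K = "rat_adjoin b" and ?G = "carrier (galois_group (rat_adjoin b))"
  let ?q = "square_char_poly"
  have q0: "?q \<noteq> 0" using square_char_poly_monic by auto
  have "(\<Sum>l<n. if E i l then (\<Sum>j<n. if E l j then complex_of_real (y j) else 0) else 0) = b * of_real (y i)"
    if i: "i < n" for i
  proof -
    have "(\<Sum>l<n. if E i l then (\<Sum>j<n. if E l j then complex_of_real (y j) else 0) else 0) =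
        of_real (nb (nb y) i)"
      unfolding nb_def of_real_sum by (intro sum.cong refl) (auto intro!: sum.cong)
    also have "nb (nb y) i = nb (\<lambda>l. r * y l) i" by (rule nb_cong) (use y(3) in simp)
    also have "\<dots> = r\<^sup>2 * y i" using nb_scale[of r y i] y(3) i by (simp add: power2_eq_square)
    finally show ?thesis by (simp add: b_def)
  qed
  note eig_b = this
  have qb: "poly (of_int_poly ?q) b = 0"
    unfolding square_char_poly_root_iff
  proof (rule exI[of _ "\<lambda>i. of_real (y i)"], rule conjI)
    show "\<exists>i<n. complex_of_real (y i) \<noteq> 0" using y(1) by simp
  qed (intro allI impI eig_b)
  interpret abelian_galois ?K ?G
    by (rule abelian_galois_rat_adjoin[OF _ q0 qb]) (unfold b_def, rule ab)
  have bK: "b \<in> ?K" by (rule rat_adjoin_closed(1))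
  have "algebraic_int b"
    unfolding algebraic_int_altdef_ipoly using qb square_char_poly_monic by blast
  then have bO: "b \<in> ints_K" using bK by (simp add: ints_K_def)
  define ev where "ev c \<longleftrightarrow> (\<exists>x. (\<exists>i<n. x i \<noteq> 0) \<and> (\<forall>i<n. nb (nb x) i = c * x i))" for c
  \<comment> \<open>A conjugate of \<open>b\<close> is a root of the same integer polynomial, hence
    an eigenvalue of the squared matrix, hence real and in [0, r^2].\<close>
  have conj: "\<exists>c. \<sigma> b = of_real c \<and> c \<ge> 0 \<and> c \<le> r\<^sup>2 \<and> ev c"
    if s: "\<sigma> \<in> ?G" for \<sigma>
  proof -
    have "poly (of_int_poly ?q) (\<sigma> b) = 0"
      using G_poly_of_int[OF s bK, of ?q] qb G_zero[OF s] by simp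
    then have "\<exists>u. (\<exists>i<n. u i \<noteq> 0) \<and>
        (\<forall>i<n. (\<Sum>l<n. if E i l then (\<Sum>j<n. if E l j then u j else 0) else 0) = \<sigma> b * u i)"
      by (simp only: square_char_poly_root_iff)
    then obtain u where u0: "(\<exists>i<n. u i \<noteq> 0) \<and>
        (\<forall>i<n. (\<Sum>l<n. if E i l then (\<Sum>j<n. if E l j then u j else 0) else 0) = \<sigma> b * u i)" ..
    from u0[THEN conjunct1] obtain i where u: "i < n" "u i \<noteq> 0" by blast
    have "\<exists>c x. \<sigma> b = of_real c \<and> c \<ge> 0 \<and> (\<exists>i<n. x i \<noteq> 0) \<and> (\<forall>i<n. nb (nb x) i = c * x i)"
    proof (rule square_eigenvalue_real[where i = i and u = u and c = "\<sigma> b", OF u])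
      fix i assume "i < n"
      then show "(\<Sum>l<n. if E i l then (\<Sum>j<n. if E l j then u j else 0) else 0) = \<sigma> b * u i"
        using spec[OF u0[THEN conjunct2], of i] by (elim mp)
    qed
    then obtain c where "\<exists>x. \<sigma> b = of_real c \<and> c \<ge> 0 \<and> (\<exists>i<n. x i \<noteq> 0) \<and> (\<forall>i<n. nb (nb x) i = c * x i)" ..
    then obtain x where
      "\<sigma> b = of_real c \<and> c \<ge> 0 \<and> (\<exists>i<n. x i \<noteq> 0) \<and> (\<forall>i<n. nb (nb x) i = c * x i)" ..
    note cx = this this[THEN conjunct2, THEN conjunct1]
      this[THEN conjunct2, THEN conjunct2, THEN conjunct1] this[THEN conjunct2, THEN conjunct2, THEN conjunct2]
    from cx(3) obtain i where i: "i < n" "x i \<noteq> 0" by blast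
    have "c \<le> r\<^sup>2"
      by (rule square_eigenvalue_le[where i = i and x = x, OF rb cx(2) i]) (use cx(4) in simp)
    moreover have "ev c"
      unfolding ev_def by (rule exI[of _ x], rule conjI[OF cx(3,4)])
    ultimately show ?thesis using cx(2) cx(1)[THEN conjunct1] by blast
  qed
  have card_large: "card {\<sigma> \<in> ?G. Re (\<sigma> b) > 4} \<le> k"
  proof -
    let ?S = "{\<sigma> \<in> ?G. Re (\<sigma> b) > 4}"
    have inj: "inj_on (\<lambda>\<sigma>. Re (\<sigma> b)) ?S"
    proof (rule inj_onI)
      fix \<sigma> \<tau> assume *: "\<sigma> \<in> ?S" "\<tau> \<in> ?S" "Re (\<sigma> b) = Re (\<tau> b)"
      then have "\<sigma> \<in> ?G" "\<tau> \<in> ?G" by auto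
      then obtain c c' where "\<sigma> b = complex_of_real c" "\<tau> b = complex_of_real c'"
        using conj[of \<sigma>] conj[of \<tau>] by blast
      then have eq: "\<sigma> b = \<tau> b" using *(3) by simp
      show "\<sigma> = \<tau>"
        by (rule automorphism_eq_if_eq_on_generator[OF \<open>\<sigma> \<in> ?G\<close> \<open>\<tau> \<in> ?G\<close> eq])
    qed
    have "\<exists>x. (\<exists>i<n. x i \<noteq> 0) \<and> (\<forall>i<n. nb (nb x) i = c * x i)"
      if c: "c \<in> (\<lambda>\<sigma>. Re (\<sigma> b)) ` ?S" for c
    proof -
      obtain \<sigma> where s: "\<sigma> \<in> ?G" "c = Re (\<sigma> b)" using c by blast
      obtain c' where x: "\<sigma> b = of_real c'" "ev c'" using conj[OF s(1)] by blast
      then have "c = c'" using s(2) by simp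
      then show ?thesis using x(2) unfolding ev_def by simp
    qed
    then have "\<forall>c\<in>(\<lambda>\<sigma>. Re (\<sigma> b)) ` ?S. \<exists>x. (\<exists>i<n. x i \<noteq> 0) \<and> (\<forall>i<n. nb (nb x) i = c * x i)"
      by (rule ballI)
    from bchoice[OF this] obtain X where X: "\<forall>c\<in>(\<lambda>\<sigma>. Re (\<sigma> b)) ` ?S.
        (\<exists>i<n. X c i \<noteq> 0) \<and> (\<forall>i<n. nb (nb (X c)) i = c * X c i)" by (elim exE)
    have "card ((\<lambda>\<sigma>. Re (\<sigma> b)) ` ?S) \<le> k"
    proof (rule card_large_square_eigenvalues[OF tail_degree_1 tail_degree_2, of _ X])
      show "finite ((\<lambda>\<sigma>. Re (\<sigma> b)) ` ?S)" using finite_G by simp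
      fix c assume c: "c \<in> (\<lambda>\<sigma>. Re (\<sigma> b)) ` ?S"
      show "c > 4" using c by blast
      show "\<exists>i<n. X c i \<noteq> 0" using bspec[OF X c] by (rule conjunct1)
      fix i assume "i < n"
      then show "nb (nb (X c)) i = c * X c i" using bspec[OF X c] by simp
    qed
    then show ?thesis using card_image[OF inj] by simp
  qed
  have rk: "r \<le> real k + 1" by (rule perron_le[OF rb y r2])
  have r4: "r\<^sup>2 > 4" using r2 power_strict_mono[of 2 r 2] by simp
  have rC: "r\<^sup>2 \<le> real ((k + 1) ^ 2)"
    using power_mono[OF rk, of 2] r2 by simp
  obtain \<iota> where i: "\<iota> \<in> ?G" "\<forall>x\<in>?K. \<iota> x = x" using G_id by blast
  have d: "card ?G \<le> group_bound d0 k"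
    unfolding group_bound_def
  proof (rule card_G_bound[OF d0 bO b_def r4 _ _ card_large rC])
    fix \<sigma> assume s: "\<sigma> \<in> ?G"
    show "\<exists>c. \<sigma> b = of_real c \<and> 0 \<le> c \<and> c \<le> r\<^sup>2" using conj[OF s] by blast
    assume "\<sigma> b = b"
    then have "\<sigma> = \<iota>" using automorphism_eq_if_eq_on_generator[OF s i(1)] i(2) bK by simp
    then show "\<forall>x\<in>?K. \<sigma> x = x" using i(2) by simp
  qed
  define H where "H = real (value_bound k)"
  have H1: "H \<ge> 1"
  proof -
    have "value_bound k > 0" by (simp add: value_bound_def)
    then show ?thesis unfolding H_def by simp
  qed
  let ?R = "\<lambda>s :: real. poly (of_int_poly limit_poly) s"
  obtain A B :: "int poly" where AB: "\<And>s :: real. ?R s = poly (of_int_poly A) (s\<^sup>2) + s * poly (of_int_poly B) (s\<^sup>2)"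
    using even_odd_decomposition[of limit_poly] by blast
  let ?A = "\<lambda>t :: real. poly (of_int_poly A) t" and ?B = "\<lambda>t :: real. poly (of_int_poly B) t"
  have R1: "?R s * ?R (- s) = (?A (s\<^sup>2))\<^sup>2 - s\<^sup>2 * (?B (s\<^sup>2))\<^sup>2" for s
    unfolding AB[of s] AB[of "- s"] by (simp add: power2_eq_square algebra_simps)
  have R2: "?R s + ?R (- s) = 2 * ?A (s\<^sup>2)" for s
    unfolding AB[of s] AB[of "- s"] by simp
  have Rr: "?R r > 0" "?R r * (real m + 1)\<^sup>2 \<le> H"
  proof -
    show "?R r > 0" unfolding limit_poly_eval base_poly_eval by (rule small_value(1)[OF rb y r2])
    have "?R r * (real m + 1)\<^sup>2 \<le> (poly (of_int_poly base_poly) r - poly (of_int_poly base_poly1) r)\<^sup>2"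
      unfolding limit_poly_eval base_poly_eval by (rule small_value(2)[OF rb y r2])
    also have "\<dots> \<le> H" unfolding H_def by (rule poly_bounds(1)) (use rk r2 in auto)
    finally show "?R r * (real m + 1)\<^sup>2 \<le> H" .
  qed
  have Rb: "\<bar>?R s\<bar> \<le> H" if "\<bar>s\<bar> \<le> real k + 1" for s
    unfolding H_def by (rule poly_bounds(2)[OF that])
  \<comment> \<open>\<open>z1\<close> is the even part of R and \<open>z2\<close> the product R(s)
    R(-s) = A^2 - s^2 B^2, both written as polynomials in s^2 and so lying in the field.\<close>
  define z1 where "z1 = poly (of_int_poly A) b"
  define z2 where "z2 = (poly (of_int_poly A) b)\<^sup>2 - b * (poly (of_int_poly B) b)\<^sup>2"
  have pO: "poly (of_int_poly p) b \<in> ints_K" for p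
  proof (induction p)
    case (pCons a p)
    then show ?case by (simp add: map_poly_pCons O_add O_mult O_of_int bO)
  qed (simp add: O_0)
  have z1O: "z1 \<in> ints_K" unfolding z1_def by (rule pO)
  have z2O: "z2 \<in> ints_K" unfolding z2_def by (intro O_diff O_mult O_power pO bO)
  have z1s: "\<sigma> z1 = of_real (?A (s\<^sup>2))" and z2s: "\<sigma> z2 = of_real (?R s * ?R (- s))"
    if s: "\<sigma> \<in> ?G" and sb: "\<sigma> b = of_real (s\<^sup>2)" for \<sigma> s
  proof -
    show "\<sigma> z1 = of_real (?A (s\<^sup>2))"
      unfolding z1_def G_poly_of_int[OF s bK] sb by (rule poly_of_int_poly_of_real)
    have "\<sigma> z2 = (poly (of_int_poly A) (\<sigma> b))\<^sup>2 - \<sigma> b * (poly (of_int_poly B) (\<sigma> b))\<^sup>2"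
      unfolding z2_def using O_K[OF pO] bK
      by (simp add: G_diff[OF s] G_mult[OF s] G_power[OF s] G_poly_of_int[OF s] power_K mult_K)
    also have "\<dots> = of_real (?R s * ?R (- s))"
      unfolding sb poly_of_int_poly_of_real R1 by simp
    finally show "\<sigma> z2 = of_real (?R s * ?R (- s))" .
  qed
  have bounds: "cmod (\<sigma> z1) \<le> H\<^sup>2" "cmod (\<sigma> z2) \<le> H\<^sup>2" if s: "\<sigma> \<in> ?G" for \<sigma>
  proof -
    obtain c where c: "\<sigma> b = of_real c" "c \<ge> 0" "c \<le> r\<^sup>2" using conj[OF s] by blast
    define t where "t = sqrt c"
    have t: "t \<ge> 0" "t\<^sup>2 = c" using c(2) by (auto simp: t_def)
    have "t \<le> r" by (rule power2_le_imp_le) (use c(3) t(2) r2 in auto)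
    then have tk: "\<bar>t\<bar> \<le> real k + 1" "\<bar>- t\<bar> \<le> real k + 1" using rk t(1) by auto
    have sb: "\<sigma> b = of_real (t\<^sup>2)" using c(1) t(2) by simp
    have "\<bar>2 * ?A (t\<^sup>2)\<bar> \<le> 2 * H" using Rb[OF tk(1)] Rb[OF tk(2)] R2[of t] by linarith
    then have "\<bar>?A (t\<^sup>2)\<bar> \<le> H" by simp
    also have "H \<le> H\<^sup>2" using H1 by (simp add: power2_eq_square)
    finally show "cmod (\<sigma> z1) \<le> H\<^sup>2" unfolding z1s[OF s sb] by simp
    have "\<bar>?R t\<bar> * \<bar>?R (- t)\<bar> \<le> H * H" using Rb[OF tk(1)] Rb[OF tk(2)] H1 by (intro mult_mono) auto
    then show "cmod (\<sigma> z2) \<le> H\<^sup>2"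
      unfolding z2s[OF s sb] norm_of_real abs_mult by (simp add: power2_eq_square)
  qed
  have ib: "\<iota> b = of_real (r\<^sup>2)" using i(2) bK by (simp add: b_def)
  have m1: "(real m + 1)\<^sup>2 > 0" by simp
  have "\<exists>z\<in>ints_K. z \<noteq> 0 \<and> cmod (\<iota> z) * (real m + 1)\<^sup>2 \<le> H\<^sup>2 \<and> (\<forall>\<sigma>\<in>?G. cmod (\<sigma> z) \<le> H\<^sup>2)"
  proof (cases "z2 = 0")
    case False
    have "cmod (\<iota> z2) * (real m + 1)\<^sup>2 = (?R r * (real m + 1)\<^sup>2) * \<bar>?R (- r)\<bar>"
      unfolding z2s[OF i(1) ib] norm_of_real abs_mult using Rr(1) by simp
    also have "\<dots> \<le> H * H" using Rr Rb[of "- r"] rk r2 H1 by (intro mult_mono) auto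
    finally have "cmod (\<iota> z2) * (real m + 1)\<^sup>2 \<le> H\<^sup>2" by (simp only: power2_eq_square)
    then show ?thesis using False z2O bounds(2) by blast
  next
    case True
    then have "\<iota> z2 = 0" using G_zero[OF i(1)] by simp
    then have "?R r * ?R (- r) = 0" unfolding z2s[OF i(1) ib] by (simp only: of_real_eq_0_iff)
    \<comment> \<open>R(r) is positive, so the vanishing product forces R(-r) = 0, and the even part
      at r is exactly R(r) / 2: nonzero and just as small.\<close>
    then have "?R (- r) = 0" using Rr(1) by simp
    then have A2: "?A (r\<^sup>2) = ?R r / 2" using R2[of r] by simp
    have iz1: "\<iota> z1 = of_real (?R r / 2)" unfolding z1s[OF i(1) ib] A2 ..
    have "z1 \<noteq> 0"
    proof
      assume "z1 = 0"
      then have "\<iota> z1 = 0" using G_zero[OF i(1)] by simp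
      then show False using iz1 Rr(1) by simp
    qed
    moreover have "cmod (\<iota> z1) * (real m + 1)\<^sup>2 \<le> H\<^sup>2"
    proof -
      have "cmod (\<iota> z1) * (real m + 1)\<^sup>2 \<le> ?R r * (real m + 1)\<^sup>2"
        unfolding iz1 norm_of_real using Rr(1) by (intro mult_right_mono) auto
      also have "\<dots> \<le> H" by (rule Rr(2))
      also have "\<dots> \<le> H\<^sup>2" using H1 by (simp add: power2_eq_square)
      finally show ?thesis .
    qed
    ultimately show ?thesis using z1O bounds(1) by blast
  qed
  then obtain z where z: "z \<in> ints_K" "z \<noteq> 0" "cmod (\<iota> z) * (real m + 1)\<^sup>2 \<le> H\<^sup>2" "\<forall>\<sigma>\<in>?G. cmod (\<sigma> z) \<le> H\<^sup>2"
    by blast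
  have "1 \<le> (\<Prod>\<sigma>\<in>?G. cmod (\<sigma> z))" by (rule nrm_ge_1[OF z(1,2)])
  also have "\<dots> = cmod (\<iota> z) * (\<Prod>\<sigma>\<in>?G - {\<iota>}. cmod (\<sigma> z))"
    using i(1) finite_G by (simp add: prod.remove)
  finally have "(real m + 1)\<^sup>2 * 1 \<le> (real m + 1)\<^sup>2 * (cmod (\<iota> z) * (\<Prod>\<sigma>\<in>?G - {\<iota>}. cmod (\<sigma> z)))"
    by (intro mult_left_mono) auto
  also have "\<dots> = (cmod (\<iota> z) * (real m + 1)\<^sup>2) * (\<Prod>\<sigma>\<in>?G - {\<iota>}. cmod (\<sigma> z))" by (simp add: mult_ac)
  also have "\<dots> \<le> H\<^sup>2 * (\<Prod>\<sigma>\<in>?G - {\<iota>}. H\<^sup>2)"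
    using z(3,4) by (intro mult_mono prod_mono prod_nonneg) auto
  also have "\<dots> = (\<Prod>\<sigma>\<in>?G. H\<^sup>2)" by (rule prod.remove[OF finite_G i(1), symmetric])
  also have "\<dots> = (H ^ card ?G)\<^sup>2"
    unfolding prod_constant power_mult[symmetric] by (simp only: mult.commute)
  finally have "(real m + 1)\<^sup>2 \<le> (H ^ card ?G)\<^sup>2" by (simp only: mult_1_right)
  then have "real m + 1 \<le> H ^ card ?G" by (rule power2_le_imp_le) (use H1 in simp)
  also have "\<dots> \<le> H ^ group_bound d0 k" using H1 d by (intro power_increasing) auto
  finally have "real (m + 1) \<le> real (value_bound k ^ group_bound d0 k)" unfolding H_def by simp
  then show ?thesis by (simp only: of_nat_le_iff)
qed

end

section \<open>From pair digraphs with an added path to the tailed graph\<close>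

lemma connected_closed_subset:
  fixes \<Gamma> :: "nat pair_pre_digraph"
  assumes g: "pair_graph \<Gamma>" and con: "Digraph_Component.connected (with_proj \<Gamma>)"
    and S: "S \<subseteq> pverts \<Gamma>" "S \<noteq> {}" and cl: "\<And>i j. i \<in> S \<Longrightarrow> (i, j) \<in> parcs \<Gamma> \<Longrightarrow> j \<in> S"
  shows "S = pverts \<Gamma>"
proof -
  interpret pair_graph \<Gamma> by (rule g)
  obtain a where a: "a \<in> S" using S(2) by blast
  have "b \<in> S" if b: "b \<in> pverts \<Gamma>" for b
  proof -
    have "a \<rightarrow>\<^sup>*\<^bsub>mk_symmetric \<Gamma>\<^esub> b"
      using con a b S(1) unfolding connected_def strongly_connected_def by auto
    then have "(a, b) \<in> rtrancl_on (pverts \<Gamma>) (parcs \<Gamma>)"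
      using reachable_mk_symmetric_eq[OF pair_sym_arcs] unfolding reachable_def by simp
    then show ?thesis
      by (induction rule: rtrancl_on_induct) (use a cl in blast)+
  qed
  then show ?thesis using S(1) by blast
qed

lemma add_path_parcs:
  fixes \<Gamma> :: "nat pair_pre_digraph"
  assumes g: "pair_graph \<Gamma>" and k: "k = card (pverts \<Gamma>)" and m: "m > 0"
  shows "(i, j) \<in> parcs (add_path \<Gamma> v m) \<longleftrightarrow>
    (i, j) \<in> parcs \<Gamma> \<or> (i = v \<and> j = k) \<or> (i = k \<and> j = v) \<or>
    (k \<le> i \<and> k \<le> j \<and> i < k + m \<and> j < k + m \<and> (j = Suc i \<or> i = Suc j))"
proof -
  interpret pair_graph \<Gamma> by (rule g)
  have "(i, j) \<in> parcs \<Gamma> \<longleftrightarrow> (j, i) \<in> parcs \<Gamma>"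
    using arcs_symmetric[of i j] arcs_symmetric[of j i] by auto
  moreover have "(\<exists>l. a = k + l \<and> b = Suc (k + l) \<and> Suc l < m) \<longleftrightarrow> k \<le> a \<and> b < k + m \<and> b = Suc a" for a b
  proof
    assume *: "k \<le> a \<and> b < k + m \<and> b = Suc a"
    show "\<exists>l. a = k + l \<and> b = Suc (k + l) \<and> Suc l < m" by (rule exI[of _ "a - k"]) (use * in auto)
  qed auto
  ultimately show ?thesis
    unfolding add_path_def Let_def undirected_graph_def k[symmetric] using m by auto
qed

lemma tailed_graph_add_path:
  fixes \<Gamma> :: "nat pair_pre_digraph"
  assumes g: "pair_graph \<Gamma>" and V: "pverts \<Gamma> = {..<k}" and v: "v < k" and m: "m > 0"
    and con: "Digraph_Component.connected (with_proj \<Gamma>)"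
  shows "tailed_graph (k + m) (\<lambda>i j. (i, j) \<in> parcs (add_path \<Gamma> v m)) k m v"
proof -
  interpret pair_graph \<Gamma> by (rule g)
  have kc: "k = card (pverts \<Gamma>)" by (simp add: V)
  note mem = add_path_parcs[OF g kc m]
  have b: "i < k" "j < k" if "(i, j) \<in> parcs \<Gamma>" for i j
    using in_arcsD1[OF that] in_arcsD2[OF that] by (simp_all add: V)
  have irr: "(i, i) \<notin> parcs \<Gamma>" for i using pair_no_loops[of "(i, i)"] by auto
  show ?thesis
  proof unfold_locales
    fix i j
    show "(i, j) \<in> parcs (add_path \<Gamma> v m) \<Longrightarrow> (j, i) \<in> parcs (add_path \<Gamma> v m)"
      unfolding mem using arcs_symmetric[of i j] by auto
    show "(i, i) \<notin> parcs (add_path \<Gamma> v m)" unfolding mem using irr v by auto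
    show "(i, j) \<in> parcs (add_path \<Gamma> v m) \<Longrightarrow> i < k + m"
      unfolding mem using b(1)[of i j] v m by auto
    show "(i, j) \<in> parcs (add_path \<Gamma> v m) \<longleftrightarrow> i < k + m \<and> j < k + m \<and> (j = Suc i \<or> i = Suc j)"
      if "k \<le> i" "k \<le> j"
      unfolding mem using b[of i j] v that by auto
    show "(i, j) \<in> parcs (add_path \<Gamma> v m) \<longleftrightarrow> i = v \<and> j = k" if "i < k" "k \<le> j"
      unfolding mem using b[of i j] v that by auto
  next
    fix S assume S: "S \<subseteq> {..<k}" "S \<noteq> {}"
      and cl: "\<And>i j. i \<in> S \<Longrightarrow> j < k \<Longrightarrow> (i, j) \<in> parcs (add_path \<Gamma> v m) \<Longrightarrow> j \<in> S"
    have "S = pverts \<Gamma>"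
    proof (rule connected_closed_subset[OF g con])
      fix i j assume "i \<in> S" "(i, j) \<in> parcs \<Gamma>"
      then show "j \<in> S" by (intro cl[of i j]) (use b in \<open>auto simp: mem\<close>)
    qed (use S V in auto)
    then show "S = {..<k}" using V by simp
  qed (use m v in auto)
qed

theorem theorem1p0p6:
  shows "\<exists>N. recursive 3 N \<and>
    (\<forall>(\<Gamma> :: nat pair_pre_digraph) (v :: nat) (n :: nat).
       pair_graph \<Gamma> \<longrightarrow> pverts \<Gamma> = {..<card (pverts \<Gamma>)} \<longrightarrow>
       Digraph_Component.connected (with_proj \<Gamma>) \<longrightarrow> v \<in> pverts \<Gamma> \<longrightarrow>
       card (pverts \<Gamma>) \<le> n \<longrightarrow> N (graph_code \<Gamma> v) \<le> n \<longrightarrow>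
       (let \<Gamma>\<^sub>n = add_path \<Gamma> v (n - card (pverts \<Gamma>));
            lam = Max (spectrum (adjacency_matrix \<Gamma>\<^sub>n :: real mat))
        in ((\<forall>\<mu>. eigenvalue (adjacency_matrix \<Gamma>\<^sub>n :: complex mat) \<mu> \<longrightarrow>
               (\<exists>\<zeta>. root_of_unity \<zeta> \<and> \<mu> = \<zeta> + inverse \<zeta>)) \<and>
            (digraph_iso (with_proj \<Gamma>\<^sub>n) (with_proj (dynkin_A n)) \<or>
             4 \<le> n \<and> digraph_iso (with_proj \<Gamma>\<^sub>n) (with_proj (dynkin_D n))))
           \<or> (lam > 2 \<and>
              \<not> abelian_number_field (rat_adjoin (complex_of_real (lam\<^sup>2))))))"
proof -
  obtain d0 where d0: "\<And>d. d \<ge> d0 \<Longrightarrow> \<exists>p::nat. prime p \<and> d < p \<and> p \<le> 8 * d"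
    using eventually_prime_between by blast
  \<comment> \<open>Entry 0 of the code is the number of vertices. The summand 8 leaves a tail long
    enough for the classification when the largest eigenvalue is at most 2, and the last summand
    pushes the tail beyond what an abelian field permits.\<close>
  let ?N = "\<lambda>xs :: nat list. xs ! 0 + 8 + value_bound (xs ! 0) ^ group_bound d0 (xs ! 0)"
  show ?thesis
  proof (intro exI[of _ ?N] conjI allI impI, rule recursive_bound)
    fix \<Gamma> :: "nat pair_pre_digraph" and v n :: nat
    assume g: "pair_graph \<Gamma>" and V0: "pverts \<Gamma> = {..<card (pverts \<Gamma>)}"
      and con: "Digraph_Component.connected (with_proj \<Gamma>)" and v0: "v \<in> pverts \<Gamma>"
      and "card (pverts \<Gamma>) \<le> n" and n0: "?N (graph_code \<Gamma> v) \<le> n"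
    define k where "k = card (pverts \<Gamma>)"
    define m where "m = n - k"
    define G where "G = add_path \<Gamma> v m"
    have V: "pverts \<Gamma> = {..<k}" using V0 by (simp add: k_def)
    have v: "v < k" using v0 V by simp
    have big: "k + 8 + value_bound k ^ group_bound d0 k \<le> n" using n0 by (simp add: graph_code_def k_def)
    have m8: "m \<ge> 8" "value_bound k ^ group_bound d0 k < m" and n: "n = k + m" using big by (auto simp: m_def)
    interpret tailed_graph n "\<lambda>i j. (i, j) \<in> parcs G" k m v
      unfolding n G_def using g V v _ con by (rule tailed_graph_add_path) (use m8 in simp)
    have VG: "pverts G = {..<n}"
      by (auto simp: G_def add_path_def Let_def undirected_graph_def V n)
    have PG: "parcs G \<subseteq> {..<n} \<times> {..<n}" using bound sym by auto
    have adj: "adjacency_matrix G = mat n n (\<lambda>(i, j). if (i, j) \<in> parcs G then 1 else 0)"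
      by (simp add: adjacency_matrix_def VG)
    from exists_perron obtain r where "\<exists>y. rayleigh_bound r \<and> (\<exists>i<n. y i \<noteq> 0) \<and>
      (\<forall>i. y i \<ge> 0) \<and> (\<forall>i<n. nb y i = r * y i)" ..
    then obtain y where y0: "rayleigh_bound r \<and> (\<exists>i<n. y i \<noteq> 0) \<and>
      (\<forall>i. y i \<ge> 0) \<and> (\<forall>i<n. nb y i = r * y i)" ..
    have rb: "rayleigh_bound r"
      and y: "\<exists>i<n. y i \<noteq> 0" "\<forall>i. y i \<ge> 0" "\<forall>i<n. nb y i = r * y i"
      using y0 by simp_all
    have lam: "Max (spectrum (adjacency_matrix G :: real mat)) = r"
      unfolding adj by (rule spectrum_real_Max[OF rb y(1,3)])
    have "((\<forall>\<mu>. eigenvalue (adjacency_matrix G :: complex mat) \<mu> \<longrightarrow>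
               (\<exists>\<zeta>. root_of_unity \<zeta> \<and> \<mu> = \<zeta> + inverse \<zeta>)) \<and>
            (digraph_iso (with_proj G) (with_proj (dynkin_A n)) \<or>
             4 \<le> n \<and> digraph_iso (with_proj G) (with_proj (dynkin_D n)))) \<or>
          (r > 2 \<and> \<not> abelian_number_field (rat_adjoin (complex_of_real (r\<^sup>2))))"
    proof (cases "r > 2")
      case True
      have "\<not> abelian_number_field (rat_adjoin (complex_of_real (r\<^sup>2)))"
      proof
        assume "abelian_number_field (rat_adjoin (complex_of_real (r\<^sup>2)))"
        from tail_length_bound[OF rb y True this, of d0] d0
        have "m + 1 \<le> value_bound k ^ group_bound d0 k" by blast
        then show False using m8(2) by simp
      qed
      then show ?thesis using True by (intro disjI2 conjI)
    next
      case False
      then have "r \<le> 2" by simp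
      from small_index_classification[OF rb this] m8(1) obtain z where z: "bij_betw z {..<n} {..<n}"
        and alt: "(\<forall>i<n. \<forall>j<n. (z i, z j) \<in> parcs G \<longleftrightarrow> path_adj i j) \<or>
          (4 \<le> n \<and> (\<forall>i<n. \<forall>j<n. (z i, z j) \<in> parcs G \<longleftrightarrow> fork_adj n i j))"
        by auto
      from alt show ?thesis
      proof (elim disjE conjE)
        assume F: "\<forall>i<n. \<forall>j<n. (z i, z j) \<in> parcs G \<longleftrightarrow> path_adj i j"
        have "digraph_iso (with_proj G) (with_proj (dynkin_A n))"
          by (rule digraph_iso_if_bij[OF VG PG _ _ z]) (use F in \<open>auto simp: dynkin_pverts dynkin_A_parcs\<close>)
        moreover have "\<exists>\<zeta>. root_of_unity \<zeta> \<and> \<mu> = \<zeta> + inverse \<zeta>"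
          if ev: "eigenvalue (adjacency_matrix G :: complex mat) \<mu>" for \<mu>
        proof -
          from ev obtain u where u: "(\<exists>i<n. u i \<noteq> 0) \<and> (\<forall>i<n. (\<Sum>j<n. if (i, j) \<in> parcs G then u j else 0) = \<mu> * u i)"
            unfolding adj eigenvalue_adjacency_iff ..
          note t = transport_eigenvector[where E = "\<lambda>i j. (i, j) \<in> parcs G" and F = path_adj, OF z _ u[THEN conjunct1] u[THEN conjunct2]]
          show ?thesis by (rule path_eigenvalue[where u = "\<lambda>i. u (z i)" and n = n]) (use F t in auto)
        qed
        ultimately show ?thesis by blast
      next
        assume n4: "4 \<le> n" and F: "\<forall>i<n. \<forall>j<n. (z i, z j) \<in> parcs G \<longleftrightarrow> fork_adj n i j"
        have "digraph_iso (with_proj G) (with_proj (dynkin_D n))"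
          by (rule digraph_iso_if_bij[OF VG PG _ _ z])
            (use F in \<open>auto simp: dynkin_pverts dynkin_D_parcs[OF n4]\<close>)
        moreover have "\<exists>\<zeta>. root_of_unity \<zeta> \<and> \<mu> = \<zeta> + inverse \<zeta>"
          if ev: "eigenvalue (adjacency_matrix G :: complex mat) \<mu>" for \<mu>
        proof -
          from ev obtain u where u: "(\<exists>i<n. u i \<noteq> 0) \<and> (\<forall>i<n. (\<Sum>j<n. if (i, j) \<in> parcs G then u j else 0) = \<mu> * u i)"
            unfolding adj eigenvalue_adjacency_iff ..
          note t = transport_eigenvector[where E = "\<lambda>i j. (i, j) \<in> parcs G" and F = "fork_adj n", OF z _ u[THEN conjunct1] u[THEN conjunct2]]
          show ?thesis by (rule fork_eigenvalue[where u = "\<lambda>i. u (z i)" and n = n]) (use F t n4 in auto)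
        qed
        ultimately show ?thesis using n4 by blast
      qed
    qed
    then show "let \<Gamma>\<^sub>n = add_path \<Gamma> v (n - card (pverts \<Gamma>));
            lam = Max (spectrum (adjacency_matrix \<Gamma>\<^sub>n :: real mat))
        in ((\<forall>\<mu>. eigenvalue (adjacency_matrix \<Gamma>\<^sub>n :: complex mat) \<mu> \<longrightarrow>
               (\<exists>\<zeta>. root_of_unity \<zeta> \<and> \<mu> = \<zeta> + inverse \<zeta>)) \<and>
            (digraph_iso (with_proj \<Gamma>\<^sub>n) (with_proj (dynkin_A n)) \<or>
             4 \<le> n \<and> digraph_iso (with_proj \<Gamma>\<^sub>n) (with_proj (dynkin_D n))))
           \<or> (lam > 2 \<and>
              \<not> abelian_number_field (rat_adjoin (complex_of_real (lam\<^sup>2))))"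
      unfolding Let_def k_def[symmetric] m_def[symmetric] G_def[symmetric] lam .
  qed
qed

end
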